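(* Let $(u,v,g,h)$ be the unique global solution of the free boundary problem described in the context, and suppose $g_\infty=h_\infty=\infty$. Assume $b<\min\{a,1/c\}$ and $a>b(1+ac)$, and set $A=\frac{a-b}{1+bc}$, $B=\frac{1+ac}{1+bc}$. Then for each $0<k_0<\min\{\underline{k}_\beta,\underline{k}_\mu\}$, $$\lim_{t\to\infty}\max_{x\in[0,k_0t]}|u(t,x)-A|=0,\qquad \lim_{t\to\infty}\max_{x\in[0,k_0t]}|v(t,x)-B|=0.$$
   Context: Let $a,b,c,d,\beta,\mu>0$ and $0<h_0\le g_0$. Let $u_0\in C^2([0,g_0])$ with $u_0'(0)=0$, $u_0>0$ in $[0,g_0)$, $u_0=0$ in $[g_0,\infty)$, and $v_0\in C^2([0,h_0])$ with $v_0'(0)=0$, $v_0>0$ in $[0,h_0)$, $v_0=0$ in $[h_0,\infty)$. The problem is: $u_t-du_{xx}=u(a-u-bv)$ for $t>0$, $0<x<g(t)$; $v_t-v_{xx}=v(1-v+cu)$ for $t>0$, $0<x<h(t)$; $u_x(t,0)=v_x(t,0)=0$; $g'(t)=-\beta u_x(t,g(t))$, $h'(t)=-\mu v_x(t,h(t))$; $u(t,x)=0$ for $x\ge g(t)$, $v(t,x)=0$ for $x\ge h(t)$; $u(0,\cdot)=u_0$, $v(0,\cdot)=v_0$, $g(0)=g_0$, $h(0)=h_0$. It has a unique global classical solution with $g,h$ increasing; $g_\infty=\lim g(t)$, $h_\infty=\lim h(t)$. For $\nu,D,\theta>0$, $k(\nu,D,\theta)$ denotes the unique $k\in(0,2\sqrt{\theta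 D})$ for which there is a function $q$ with $Dq''-kq'+q(\theta-q)=0$ on $(0,\infty)$, $q(0)=0$, $q'(0)=k/\nu$, $q(\infty)=\theta$, $q'>0$ on $(0,\infty)$ (such $k$ exists and is unique). Set $\underline{k}_\mu=k(\mu,1,1)$ and $\underline{k}_\beta=k(\beta,d,a-b(1+ac))$. *)

theory Defs
  imports "HOL-Analysis.Analysis"
begin

definition C2_on :: "real \<Rightarrow> real \<Rightarrow> (real \<Rightarrow> real) \<Rightarrow> (real \<Rightarrow> real) \<Rightarrow> bool" where
  "C2_on l r f f' \<longleftrightarrow> (\<exists>f''.
     (\<forall>x\<in>{l..r}. (f has_real_derivative f' x) (at x within {l..r})) \<and>
     (\<forall>x\<in>{l..r}. (f' has_real_derivative f'' x) (at x within {l..r})) \<and>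
     continuous_on {l..r} f'')"

definition semi_wave_speed :: "real \<Rightarrow> real \<Rightarrow> real \<Rightarrow> real" where
  "semi_wave_speed \<nu> D \<theta> = (THE k. 0 < k \<and> k < 2 * sqrt (\<theta> * D) \<and>
     (\<exists>q q' q''. q 0 = 0 \<and> continuous_on {0..} q \<and>
        (\<forall>x\<ge>0. (q has_real_derivative q' x) (at x within {0..})) \<and>
        q' 0 = k / \<nu> \<and>
        (\<forall>x>0. (q' has_real_derivative q'' x) (at x)) \<and>
        (\<forall>x>0. D * q'' x - k * q' x + q x * (\<theta> - q x) = 0) \<and>
        (q \<longlongrightarrow> \<theta>) at_top \<and>
        (\<forall>x>0. q' x > 0)))"

definition fbp_solution ::
  "real \<Rightarrow> real \<Rightarrow> real \<Rightarrow> real \<Rightarrow> real \<Rightarrow> real \<Rightarrow> real \<Rightarrow> real \<Rightarrow>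
   (real \<Rightarrow> real) \<Rightarrow> (real \<Rightarrow> real) \<Rightarrow>
   (real \<Rightarrow> real \<Rightarrow> real) \<Rightarrow> (real \<Rightarrow> real \<Rightarrow> real) \<Rightarrow> (real \<Rightarrow> real) \<Rightarrow> (real \<Rightarrow> real) \<Rightarrow> bool" where
  "fbp_solution a b c d \<beta> \<mu> g0 h0 u0 v0 u v g h \<longleftrightarrow>
     continuous_on ({0..} \<times> {0..}) (\<lambda>(t,x). u t x) \<and>
     continuous_on ({0..} \<times> {0..}) (\<lambda>(t,x). v t x) \<and>
     continuous_on {0..} g \<and> continuous_on {0..} h \<and>
     g 0 = g0 \<and> h 0 = h0 \<and>
     (\<forall>x\<ge>0. u 0 x = u0 x \<and> v 0 x = v0 x) \<and>
     (\<forall>t>0. \<forall>x\<ge>g t. u t x = 0) \<and>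
     (\<forall>t>0. \<forall>x\<ge>h t. v t x = 0) \<and>
     (\<exists>ut ux uxx. 
        (\<forall>t>0. \<forall>x\<in>{0..g t}. ((\<lambda>y. u t y) has_real_derivative ux t x) (at x within {0..g t})) \<and>
        continuous_on {(t,x). t > 0 \<and> 0 \<le> x \<and> x \<le> g t} (\<lambda>(t,x). ux t x) \<and>
        (\<forall>t>0. \<forall>x\<in>{0<..<g t}. ((\<lambda>y. ux t y) has_real_derivative uxx t x) (at x)) \<and>
        (\<forall>t>0. \<forall>x\<in>{0<..<g t}. ((\<lambda>s. u s x) has_real_derivative ut t x) (at t)) \<and>
        (\<forall>t>0. \<forall>x\<in>{0<..<g t}. ut t x - d * uxx t x = u t x * (a - u t x - b * v t x)) \<and>
        (\<forall>t>0. ux t 0 = 0) \<and>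
        (\<forall>t>0. (g has_real_derivative (- \<beta> * ux t (g t))) (at t))) \<and>
     (\<exists>vt vx vxx. 
        (\<forall>t>0. \<forall>x\<in>{0..h t}. ((\<lambda>y. v t y) has_real_derivative vx t x) (at x within {0..h t})) \<and>
        continuous_on {(t,x). t > 0 \<and> 0 \<le> x \<and> x \<le> h t} (\<lambda>(t,x). vx t x) \<and>
        (\<forall>t>0. \<forall>x\<in>{0<..<h t}. ((\<lambda>y. vx t y) has_real_derivative vxx t x) (at x)) \<and>
        (\<forall>t>0. \<forall>x\<in>{0<..<h t}. ((\<lambda>s. v s x) has_real_derivative vt t x) (at t)) \<and>
        (\<forall>t>0. \<forall>x\<in>{0<..<h t}. vt t x - vxx t x = v t x * (1 - v t x + c * u t x)) \<and>
        (\<forall>t>0. vx t 0 = 0) \<and>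
        (\<forall>t>0. (h has_real_derivative (- \<mu> * vx t (h t))) (at t)))"

end

theory Submission
  imports Defs
begin

text \<open>
  The speed of a semi-wave is found by shooting: solve the profile equation from \<open>q 0 = 0\<close>, \<open>q' 0 = k / \<nu>\<close>.
  For small \<open>k\<close> the slope vanishes before \<open>q\<close> reaches \<open>\<theta>\<close>, for \<open>k = 2 sqrt (\<theta> D)\<close> the profile crosses \<open>\<theta>\<close>;
  both alternatives are open in \<open>k\<close>, so some \<open>k\<close> in between satisfies neither and gives a semi-wave.
  In the phase plane the slope as a function of the height increases strictly with \<open>k\<close>, hence \<open>k\<close> is unique.

  By the maximum principle, \<open>limsup u \<le> a\<close> and then \<open>limsup v \<le> 1 + a c\<close>. Hence each species is a
  supersolution of a scalar logistic free boundary problem, and a slightly slowed and lowered semi-wave,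
  placed once the species is established near \<open>x = 0\<close>, is a subsolution that stays behind the free boundary.
  This gives positive lower bounds on \<open>[0, k t]\<close> for every \<open>k\<close> below both speeds. On space-time windows of
  fixed size inside this cone, bounds for one species improve those for the other; the resulting
  map of lower bounds for \<open>u\<close> is affine with slope \<open>(b c)\<^sup>2 < 1\<close> and fixed point \<open>(a - b) / (1 + b c)\<close>.
\<close>

section \<open>Semi-waves\<close>

lemma first_zero:
  fixes m :: "real \<Rightarrow> real"
  assumes cm: "continuous_on {a..b} m" and ab: "a \<le> b" and ma: "m a > 0" and mb: "m b \<le> 0"
  obtains X where "a < X" "X \<le> b" "m X = 0" "\<And>y. a \<le> y \<Longrightarrow> y < X \<Longrightarrow> m y > 0"
proof -
  define S where "S = {x\<in>{a..b}. m x \<le> 0}"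
  have "closed S" unfolding S_def
    by (intro continuous_on_closed_Collect_le cm continuous_intros closed_real_atLeastAtMost)
  moreover have bd: "bdd_below S" "S \<noteq> {}" using ab mb by (auto simp: S_def)
  ultimately have "Inf S \<in> S" using closed_contains_Inf by blast
  define X where "X = Inf S"
  have X: "X \<in> {a..b}" "m X \<le> 0" using \<open>Inf S \<in> S\<close> by (auto simp: X_def S_def)
  have before: "m y > 0" if "a \<le> y" "y < X" for y
  proof -
    have "y \<notin> S" using that cInf_lower[of y S] bd by (auto simp: X_def)
    thus ?thesis using that X by (auto simp: S_def)
  qed
  have "\<exists>y\<ge>a. y \<le> X \<and> m y = 0"
    using IVT2'[of m X 0 a] ma X continuous_on_subset[OF cm, of "{a..X}"] by auto
  then obtain y where "a \<le> y" "y \<le> X" "m y = 0" by auto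
  hence "m X = 0" using before[of y] by (cases "y = X") auto
  moreover have "a \<noteq> X" using \<open>m X = 0\<close> ma by auto
  ultimately show ?thesis using X before by (intro that[of X]) auto
qed

lemma integral_exp_bound:
  fixes L x :: real
  assumes "L > 0" "x \<ge> 0"
  shows "((\<lambda>s. L * exp (2 * L * s)) has_integral (exp (2 * L * x) - 1) / 2) {0..x}"
proof -
  have "((\<lambda>s. L * exp (2 * L * s)) has_integral exp (2 * L * x) / 2 - exp (2 * L * 0) / 2) {0..x}"
    using assms
    by (intro fundamental_theorem_of_calculus)
       (auto simp: has_real_derivative_iff_has_vector_derivative[symmetric] intro!: derivative_eq_intros)
  thus ?thesis by (simp add: diff_divide_distrib)
qed

lemma picard_global:
  fixes F :: "'a::banach \<Rightarrow> 'a"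
  assumes L: "L > 0" and lip: "\<And>x y. norm (F x - F y) \<le> L * norm (x - y)"
  shows "\<exists>y. y 0 = y0 \<and> (\<forall>x\<ge>0. (y has_vector_derivative F (y x)) (at x within {0..}))"
proof -
  have contF: "continuous_on UNIV F"
    by (rule lipschitz_on_continuous_on[of L]) (auto simp: lipschitz_on_def dist_norm lip L less_imp_le)
  define G :: "(real \<Rightarrow> 'a) \<Rightarrow> real \<Rightarrow> 'a" where "G z s = F (exp (2 * L * s) *\<^sub>R z s)" for z s
  have contG: "continuous_on S (G z)" if "continuous_on UNIV z" for z S
    unfolding G_def
    by (intro continuous_on_compose2[OF contF] continuous_intros continuous_on_subset[OF that]) auto
  have intG: "G z integrable_on {0..x}" if "continuous_on UNIV z" for z x
    by (rule integrable_continuous_real[OF contG[OF that]])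
  define I where "I z x = integral {0..x} (G z)" for z x
  have derI: "(I z has_vector_derivative G z x) (at x within {0..})"
    if "continuous_on UNIV z" "x \<ge> 0" for z x
  proof -
    have "(I z has_vector_derivative G z x) (at x within {0..x+1})"
      unfolding I_def by (rule integral_has_vector_derivative[OF contG[OF that(1)]]) (use that in auto)
    moreover have "at x within {0..x+1} = at x within {0..}"
      by (rule at_within_nhd[of _ "{..<x+1}"]) auto
    ultimately show ?thesis by simp
  qed
  have contI: "continuous_on {0..} (I z)" if "continuous_on UNIV z" for z
    using derI[OF that] by (meson atLeast_iff continuous_on_eq_continuous_within has_vector_derivative_continuous)
  define T where "T z x = exp (- 2 * L * max 0 x) *\<^sub>R (y0 + I z (max 0 x))" for z x
  have contT: "continuous_on UNIV (T z)" if "continuous_on UNIV z" for z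
    unfolding T_def
    by (intro continuous_intros continuous_on_compose2[OF contI[OF that]]) auto
  have diffT: "norm (T z x - T z' x) \<le> 1/2 * B"
    if c: "continuous_on UNIV z" "continuous_on UNIV z'" and B: "\<And>s. norm (z s - z' s) \<le> B" for z z' x B
  proof -
    define X where "X = max 0 x"
    have X: "X \<ge> 0" by (simp add: X_def)
    have B0: "B \<ge> 0" using B[of 0] norm_ge_zero order_trans by blast
    have "norm (I z X - I z' X) = norm (integral {0..X} (\<lambda>s. G z s - G z' s))"
      unfolding I_def by (subst integral_diff[OF intG[OF c(1)] intG[OF c(2)]]) simp
    also have "\<dots> \<le> integral {0..X} (\<lambda>s. (L * exp (2 * L * s)) * B)"
    proof (rule integral_norm_bound_integral)
      show "(\<lambda>s. G z s - G z' s) integrable_on {0..X}"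
        by (rule integrable_diff[OF intG[OF c(1)] intG[OF c(2)]])
      show "(\<lambda>s. (L * exp (2 * L * s)) * B) integrable_on {0..X}"
        by (intro integrable_continuous_real continuous_intros)
      fix s assume "s \<in> {0..X}"
      have "norm (G z s - G z' s) \<le> L * norm (exp (2 * L * s) *\<^sub>R z s - exp (2 * L * s) *\<^sub>R z' s)"
        unfolding G_def by (rule lip)
      also have "\<dots> = L * exp (2 * L * s) * norm (z s - z' s)"
        by (simp add: scaleR_diff_right[symmetric])
      also have "\<dots> \<le> L * exp (2 * L * s) * B"
        using B L by (intro mult_left_mono) auto
      finally show "norm (G z s - G z' s) \<le> (L * exp (2 * L * s)) * B" .
    qed
    also have "\<dots> = (exp (2 * L * X) - 1) / 2 * B"
      by (rule integral_unique[OF has_integral_mult_left[OF integral_exp_bound[OF L X]]])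
    finally have 1: "norm (I z X - I z' X) \<le> (exp (2 * L * X) - 1) / 2 * B" .
    have "norm (T z x - T z' x) = exp (- 2 * L * X) * norm (I z X - I z' X)"
      unfolding T_def X_def[symmetric] by (simp add: scaleR_diff_right[symmetric])
    also have "\<dots> \<le> exp (- 2 * L * X) * ((exp (2 * L * X) - 1) / 2 * B)"
      by (rule mult_left_mono[OF 1]) simp
    also have "\<dots> = (1 - exp (- 2 * L * X)) / 2 * B"
      by (simp add: exp_minus field_simps)
    also have "\<dots> \<le> 1/2 * B" using B0 by (intro mult_right_mono) auto
    finally show ?thesis .
  qed
  have T0: "norm (T (\<lambda>_. 0) x) \<le> norm y0 + norm (F 0) / (2 * L)" for x
  proof -
    define X where "X = max 0 x"
    have X: "X \<ge> 0" by (simp add: X_def)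
    have "G (\<lambda>_. 0) = (\<lambda>_. F 0)" by (auto simp: G_def)
    hence I0: "I (\<lambda>_. 0) X = X *\<^sub>R F 0" using X by (simp add: I_def)
    have "2 * L * X \<le> exp (2 * L * X)" using exp_ge_add_one_self[of "2*L*X"] by linarith
    hence e: "exp (- 2 * L * X) * X \<le> 1 / (2 * L)" using L by (simp add: exp_minus field_simps)
    have e1: "exp (- 2 * L * X) \<le> 1" using L X by simp
    have "norm (T (\<lambda>_. 0) x) = exp (- 2 * L * X) * norm (y0 + X *\<^sub>R F 0)"
      unfolding T_def X_def[symmetric] I0 by simp
    also have "\<dots> \<le> exp (- 2 * L * X) * (norm y0 + X * norm (F 0))"
      by (rule mult_left_mono) (use norm_triangle_ineq[of y0 "X *\<^sub>R F 0"] X in auto)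
    also have "\<dots> = exp (- 2 * L * X) * norm y0 + (exp (- 2 * L * X) * X) * norm (F 0)"
      by (simp add: algebra_simps)
    also have "\<dots> \<le> 1 * norm y0 + 1 / (2 * L) * norm (F 0)"
      by (intro add_mono mult_right_mono e e1) auto
    finally show ?thesis by simp
  qed
  have bdT: "T z \<in> bcontfun" if c: "continuous_on UNIV z" and b: "\<And>s. norm (z s) \<le> B" for z B
  proof (rule bcontfun_normI[OF contT[OF c]])
    fix x
    have "norm (T z x) \<le> norm (T z x - T (\<lambda>_. 0) x) + norm (T (\<lambda>_. 0) x)"
      by (metis diff_add_cancel norm_triangle_ineq)
    also have "\<dots> \<le> 1/2 * B + (norm y0 + norm (F 0) / (2 * L))"
      by (intro add_mono diffT T0 c) (use b in auto)
    finally show "norm (T z x) \<le> 1/2 * B + (norm y0 + norm (F 0) / (2 * L))" .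
  qed
  define TT :: "(real \<Rightarrow>\<^sub>C 'a) \<Rightarrow> (real \<Rightarrow>\<^sub>C 'a)" where "TT z = Bcontfun (T (apply_bcontfun z))" for z
  have cz: "continuous_on UNIV (apply_bcontfun z)" for z :: "real \<Rightarrow>\<^sub>C 'a"
    by (rule continuous_on_apply_bcontfun)
  have TT: "apply_bcontfun (TT z) = T (apply_bcontfun z)" for z
    unfolding TT_def by (rule Bcontfun_inverse[OF bdT[OF cz norm_bounded]])
  have "\<exists>!z. TT z = z"
  proof (rule banach_fix_type[where c = "1/2"])
    show "\<forall>z z'. dist (TT z) (TT z') \<le> 1/2 * dist z z'"
    proof (intro allI dist_bound)
      fix z z' x
      show "dist (apply_bcontfun (TT z) x) (apply_bcontfun (TT z') x) \<le> 1/2 * dist z z'"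
        unfolding TT dist_norm[of "T _ _"]
        by (rule diffT[OF cz cz]) (metis dist_bounded dist_norm)
    qed
  qed auto
  then obtain z where z: "TT z = z" by auto
  define Z where "Z = apply_bcontfun z"
  have ZT: "Z = T Z" using TT[of z] z by (simp add: Z_def)
  have contZ: "continuous_on UNIV Z" using cz by (simp add: Z_def)
  define y where "y x = y0 + I Z x" for x
  have yZ: "exp (2 * L * x) *\<^sub>R Z x = y x" if "x \<ge> 0" for x
  proof -
    have "Z x = exp (- 2 * L * x) *\<^sub>R y x"
      using fun_cong[OF ZT, of x] that by (simp add: T_def y_def)
    thus ?thesis by (simp add: exp_minus)
  qed
  show ?thesis
  proof (intro exI[of _ y] conjI allI impI)
    show "y 0 = y0" by (simp add: y_def I_def)
    fix x :: real assume x: "x \<ge> 0"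
    have "(y has_vector_derivative G Z x) (at x within {0..})"
      unfolding y_def using derI[OF contZ x] by (auto intro!: derivative_eq_intros)
    thus "(y has_vector_derivative F (y x)) (at x within {0..})"
      by (simp add: G_def yZ[OF x])
  qed
qed

lemma DERIV_nonneg_within_imp_le:
  fixes h h' :: "real \<Rightarrow> real"
  assumes "0 \<le> x" "x \<le> y"
    and "\<And>z. x \<le> z \<Longrightarrow> z \<le> y \<Longrightarrow> (h has_real_derivative h' z) (at z within {0..})"
    and "\<And>z. x < z \<Longrightarrow> z < y \<Longrightarrow> h' z \<ge> 0"
  shows "h x \<le> h y"
proof (cases "x = y")
  case False
  hence xy: "x < y" using assms by auto
  have "\<exists>z\<in>{x<..<y}. h y - h x = (\<lambda>d. h' z * d) (y - x)"
  proof (rule mvt_simple[OF xy])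
    fix z assume "x \<le> z" "z \<le> y"
    hence "(h has_real_derivative h' z) (at z within {0..})" using assms by auto
    hence "(h has_real_derivative h' z) (at z within {x..y})"
      by (rule DERIV_subset) (use assms in auto)
    thus "(h has_derivative (\<lambda>d. h' z * d)) (at z within {x..y})"
      by (rule has_field_derivative_imp_has_derivative)
  qed
  then obtain z where "z \<in> {x<..<y}" "h y - h x = h' z * (y - x)" by auto
  moreover from this have "h' z * (y - x) \<ge> 0" using assms(4)[of z] xy by (intro mult_nonneg_nonneg) auto
  ultimately show ?thesis by simp
qed auto

locale semi_wave_shooting =
  fixes \<nu> D \<theta> :: real
  assumes nu: "\<nu> > 0" and D: "D > 0" and theta: "\<theta> > 0"
begin

text \<open>Clamping the argument to \<open>[0, \<theta>]\<close> makes the nonlinearity globally Lipschitz.\<close>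
definition f :: "real \<Rightarrow> real" where
  "f q = max 0 (min \<theta> q) * (\<theta> - max 0 (min \<theta> q))"

lemma f_lipschitz: "\<bar>f x - f y\<bar> \<le> \<theta> * \<bar>x - y\<bar>"
proof -
  define r s where "r = max 0 (min \<theta> x)" and "s = max 0 (min \<theta> y)"
  have "\<bar>f x - f y\<bar> = \<bar>r - s\<bar> * \<bar>\<theta> - (r + s)\<bar>"
    unfolding f_def r_def[symmetric] s_def[symmetric] abs_mult[symmetric] by (simp add: algebra_simps)
  also have "\<dots> \<le> \<bar>r - s\<bar> * \<theta>"
    using theta by (intro mult_left_mono) (auto simp: r_def s_def)
  also have "\<dots> \<le> \<bar>x - y\<bar> * \<theta>"
    using theta by (intro mult_right_mono) (auto simp: r_def s_def)
  finally show ?thesis by (simp add: mult.commute)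
qed

lemma f_eq: "0 \<le> q \<Longrightarrow> q \<le> \<theta> \<Longrightarrow> f q = q * (\<theta> - q)"
  by (auto simp: f_def)

lemma ivp_exists:
  "\<exists>q p. q 0 = 0 \<and> p 0 = k / \<nu> \<and>
     (\<forall>x\<ge>0. (q has_real_derivative p x) (at x within {0..})) \<and>
     (\<forall>x\<ge>0. (p has_real_derivative (k * p x - f (q x)) / D) (at x within {0..}))"
proof -
  define F :: "real \<times> real \<Rightarrow> real \<times> real" where "F = (\<lambda>(q, p). (p, (k * p - f q) / D))"
  define L where "L = 1 + (\<bar>k\<bar> + \<theta>) / D"
  have L: "L > 0" unfolding L_def using theta D by (intro add_pos_nonneg divide_nonneg_pos) auto
  have lip: "norm (F x - F y) \<le> L * norm (x - y)" for x y
  proof -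
    obtain q p q' p' where xy: "x = (q, p)" "y = (q', p')" by (metis surj_pair)
    have q: "\<bar>q - q'\<bar> \<le> norm (x - y)" using norm_fst_le[of "q - q'" "p - p'"] by (simp add: xy)
    have p: "\<bar>p - p'\<bar> \<le> norm (x - y)" using norm_snd_le[of "p - p'" "q - q'"] by (simp add: xy)
    have "\<bar>(k * p - f q) / D - (k * p' - f q') / D\<bar> = \<bar>k * (p - p') - (f q - f q')\<bar> / D"
      using D by (simp add: abs_divide[symmetric] diff_divide_distrib[symmetric] algebra_simps)
    also have "\<dots> \<le> (\<bar>k\<bar> * \<bar>p - p'\<bar> + \<theta> * \<bar>q - q'\<bar>) / D"
      using D f_lipschitz[of q q'] abs_mult[of k "p - p'"] by (intro divide_right_mono) linarith+
    also have "\<dots> \<le> (\<bar>k\<bar> * norm (x - y) + \<theta> * norm (x - y)) / D"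
      using D theta p q by (intro divide_right_mono add_mono mult_left_mono) auto
    finally have "\<bar>(k * p - f q) / D - (k * p' - f q') / D\<bar> \<le> (\<bar>k\<bar> + \<theta>) / D * norm (x - y)"
      by (simp add: algebra_simps)
    moreover have "norm (F x - F y) \<le> \<bar>p - p'\<bar> + \<bar>(k * p - f q) / D - (k * p' - f q') / D\<bar>"
      using norm_Pair_le[of "p - p'" "(k * p - f q) / D - (k * p' - f q') / D"]
      by (simp add: F_def xy)
    ultimately show ?thesis using p by (simp add: L_def algebra_simps)
  qed
  obtain y where y: "y 0 = (0, k / \<nu>)"
    "\<And>x. x \<ge> 0 \<Longrightarrow> (y has_vector_derivative F (y x)) (at x within {0..})"
    using picard_global[OF L lip, of "(0, k/\<nu>)"] by blast
  show ?thesis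
  proof (rule exI[of _ "fst \<circ> y"], rule exI[of _ "snd \<circ> y"], intro conjI allI impI)
    fix x :: real assume "x \<ge> 0"
    from y(2)[OF this] have *: "(y has_vector_derivative F (y x)) (at x within {0..})" .
    show "(fst \<circ> y has_real_derivative (snd \<circ> y) x) (at x within {0..})"
      using bounded_linear.has_vector_derivative[OF bounded_linear_fst *]
      by (simp add: has_real_derivative_iff_has_vector_derivative F_def case_prod_beta o_def)
    show "(snd \<circ> y has_real_derivative (k * (snd \<circ> y) x - f ((fst \<circ> y) x)) / D) (at x within {0..})"
      using bounded_linear.has_vector_derivative[OF bounded_linear_snd *]
      by (simp add: has_real_derivative_iff_has_vector_derivative F_def case_prod_beta o_def)
  qed (auto simp: y)
qed

definition ivp where
  "ivp k q p \<longleftrightarrow> q 0 = 0 \<and> p 0 = k / \<nu> \<and>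
     (\<forall>x\<ge>0. (q has_real_derivative p x) (at x within {0..})) \<and>
     (\<forall>x\<ge>0. (p has_real_derivative (k * p x - f (q x)) / D) (at x within {0..}))"

context
  fixes k :: real and q p :: "real \<Rightarrow> real"
  assumes ivp: "ivp k q p" and k: "k > 0"
begin

lemma q0: "q 0 = 0" and p0: "p 0 = k / \<nu>"
  and dq: "x \<ge> 0 \<Longrightarrow> (q has_real_derivative p x) (at x within {0..})"
  and dp: "x \<ge> 0 \<Longrightarrow> (p has_real_derivative (k * p x - f (q x)) / D) (at x within {0..})"
  using ivp by (auto simp: ivp_def)

lemma cont_q: "continuous_on {0..} q" and cont_p: "continuous_on {0..} p"
  using dq dp by (meson DERIV_continuous atLeast_iff continuous_on_eq_continuous_within)+

lemma p0_pos: "p 0 > 0" using p0 k nu by simp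

lemma q_mono: 
  assumes "0 \<le> x" "x \<le> y" "\<And>z. x < z \<Longrightarrow> z < y \<Longrightarrow> p z > 0"
  shows "q x \<le> q y"
  by (rule DERIV_nonneg_within_imp_le[of _ _ _ p]) (use assms dq in \<open>auto simp: less_imp_le\<close>)

lemma q_nonneg:
  assumes "0 \<le> x" "\<And>z. 0 < z \<Longrightarrow> z < x \<Longrightarrow> p z > 0" shows "q x \<ge> 0"
  using q_mono[of 0 x] assms by (auto simp: q0)

lemma q_pos:
  assumes "0 < x" "\<And>z. 0 < z \<Longrightarrow> z < x \<Longrightarrow> p z > 0" shows "q x > 0"
proof -
  obtain e where e: "e > 0" "\<And>h. 0 < h \<Longrightarrow> h < e \<Longrightarrow> q (0 + h) > q 0"
    using has_real_derivative_pos_inc_right[OF dq[of 0] p0_pos] by auto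
  define h where "h = min (e/2) (x/2)"
  have "0 < h" "h < e" "h < x" using e assms by (auto simp: h_def)
  hence "q h > 0" "q h \<le> q x" using e(2)[of h] q0 q_mono[of h x] assms by auto
  thus ?thesis by linarith
qed

text \<open>\<open>p\<^sup>2 + (\<theta> - q)\<^sup>2\<close> decays at most exponentially.\<close>
lemma not_equilibrium:
  assumes x: "x \<ge> 0" and pos: "\<And>z. 0 \<le> z \<Longrightarrow> z < x \<Longrightarrow> p z > 0 \<and> q z < \<theta>"
  shows "\<not> (p x = 0 \<and> q x = \<theta>)"
proof
  assume *: "p x = 0 \<and> q x = \<theta>"
  define C where "C = 1 + \<theta> / D"
  define z where "z y = exp (2 * C * y) * ((p y)\<^sup>2 + (\<theta> - q y)\<^sup>2)" for y
  define z' where "z' y = 2 * exp (2 * C * y) * (C * ((p y)\<^sup>2 + (\<theta> - q y)\<^sup>2) + p y * ((k * p y - f (q y)) / D) - (\<theta> - q y) * p y)" for y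
  have "z 0 \<le> z x"
  proof (rule DERIV_nonneg_within_imp_le[of 0 x z z'])
    fix y assume y: "0 \<le> y" "y \<le> x"
    show "(z has_real_derivative z' y) (at y within {0..})"
      unfolding z_def z'_def using dp[OF y(1)] dq[OF y(1)]
      by (auto intro!: derivative_eq_intros simp: algebra_simps)
  next
    fix y assume y: "0 < y" "y < x"
    have P: "p y > 0" "q y < \<theta>" using pos y by auto
    have Q: "q y \<ge> 0" by (rule q_nonneg) (use y pos in auto)
    define r where "r = \<theta> - q y"
    have r: "r > 0" "r \<le> \<theta>" using P Q by (auto simp: r_def)
    have f: "f (q y) = q y * r" using f_eq Q P by (auto simp: r_def)
    have pr: "2 * (p y * r) \<le> (p y)\<^sup>2 + r\<^sup>2" using sum_squares_bound[of "p y" r] by simp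
    have pr0: "0 \<le> p y * r" using P r by simp
    have "q y * (p y * r) \<le> \<theta> * (p y * r)" using P pr0 by (intro mult_right_mono) auto
    hence "p y * (q y * r) \<le> \<theta> * (p y * r)" by (simp add: mult.left_commute)
    hence "(p y * (q y * r)) / D \<le> \<theta> * (p y * r) / D" using D by (intro divide_right_mono) auto
    moreover have "\<theta> * (p y * r) / D \<le> \<theta> / D * ((p y)\<^sup>2 + r\<^sup>2)"
      using pr pr0 theta D mult_left_mono[of "p y * r" "(p y)\<^sup>2 + r\<^sup>2" "\<theta>/D"] by auto
    moreover have "p y * ((k * p y - f (q y)) / D) = k * (p y * p y) / D - (p y * (q y * r)) / D"
      using D by (simp add: f field_simps)
    moreover have "k * (p y * p y) / D \<ge> 0" using k D P by simp
    ultimately have "0 \<le> C * ((p y)\<^sup>2 + r\<^sup>2) + p y * ((k * p y - f (q y)) / D) - r * p y"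
      using pr pr0 by (simp add: C_def distrib_right mult.commute)
    thus "z' y \<ge> 0" unfolding z'_def r_def by simp
  qed (use x in auto)
  moreover have "z x = 0" using * by (simp add: z_def)
  moreover have "z 0 > 0" using p0_pos by (simp add: z_def add_pos_nonneg)
  ultimately show False by simp
qed

lemma trichotomy:
  obtains (neg) x where "x > 0" "p x < 0" "\<And>y. 0 \<le> y \<Longrightarrow> y \<le> x \<Longrightarrow> q y < \<theta>"
  | (exceed) x where "x > 0" "q x > \<theta>" "\<And>y. 0 \<le> y \<Longrightarrow> y \<le> x \<Longrightarrow> p y > 0"
  | (semiwave) "\<And>x. x \<ge> 0 \<Longrightarrow> p x > 0 \<and> q x < \<theta>"
proof (cases "\<forall>x\<ge>0. p x > 0 \<and> q x < \<theta>")
  case True thus ?thesis using semiwave by blast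
next
  case False
  define m where "m x = min (p x) (\<theta> - q x)" for x
  have cm: "continuous_on {0..} m" unfolding m_def by (intro continuous_intros cont_p cont_q)
  from False obtain b where b: "b \<ge> 0" "m b \<le> 0" by (force simp: m_def)
  have m0: "m 0 > 0" using p0_pos q0 theta by (auto simp: m_def)
  obtain X where X: "0 < X" "X \<le> b" "m X = 0" "\<And>y. 0 \<le> y \<Longrightarrow> y < X \<Longrightarrow> m y > 0"
    by (rule first_zero[OF continuous_on_subset[OF cm] b(1) m0 b(2)]) auto
  note X0 = X(1)
  have before: "p y > 0 \<and> q y < \<theta>" if "0 \<le> y" "y < X" for y
    using X(4)[OF that] by (auto simp: m_def)
  have pX: "p X \<ge> 0" "q X \<le> \<theta>" using X(3) by (auto simp: m_def min_def split: if_splits)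
  have ne: "\<not> (p X = 0 \<and> q X = \<theta>)" by (rule not_equilibrium) (use before X0 in auto)
  show ?thesis
  proof (cases "p X = 0")
    case True
    hence qX: "q X < \<theta>" using ne pX by auto
    have "q X > 0" by (rule q_pos) (use X0 before in auto)
    hence "(k * p X - f (q X)) / D < 0" using True qX D f_eq[of "q X"] by (simp add: divide_neg_pos)
    from has_real_derivative_neg_dec_right[OF dp this] X0
    obtain e where e: "e > 0" "\<And>h. 0 < h \<Longrightarrow> h < e \<Longrightarrow> p (X + h) < 0" using True by auto
    have "\<exists>d>0. \<forall>y\<in>{0..}. dist y X < d \<longrightarrow> dist (q y) (q X) < \<theta> - q X"
      using cont_q qX X0 unfolding continuous_on_iff by (meson atLeast_iff diff_gt_0_iff_gt less_imp_le)
    then obtain d where d: "d > 0" "\<And>y. y \<ge> 0 \<Longrightarrow> \<bar>y - X\<bar> < d \<Longrightarrow> q y < \<theta>"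
      by (force simp: dist_real_def)
    define h where "h = min (e/2) (d/2)"
    have h: "h > 0" "h < e" "h < d" using e d by (auto simp: h_def)
    show ?thesis
    proof (rule neg[of "X + h"])
      fix y assume y: "0 \<le> y" "y \<le> X + h"
      show "q y < \<theta>" using before[of y] d(2)[of y] y h by (cases "y < X") auto
    qed (use h X0 e in auto)
  next
    case False
    hence qX: "q X = \<theta>" and pX: "p X > 0" using X(3) pX by (auto simp: m_def min_def split: if_splits)
    from has_real_derivative_pos_inc_right[OF dq pX] X0
    obtain e where e: "e > 0" "\<And>h. 0 < h \<Longrightarrow> h < e \<Longrightarrow> q (X + h) > \<theta>" using qX by auto
    have "\<exists>d>0. \<forall>y\<in>{0..}. dist y X < d \<longrightarrow> dist (p y) (p X) < p X"
      using cont_p pX X0 unfolding continuous_on_iff by (meson atLeast_iff less_imp_le)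
    then obtain d where d: "d > 0" "\<And>y. y \<ge> 0 \<Longrightarrow> \<bar>y - X\<bar> < d \<Longrightarrow> p y > 0"
      by (force simp: dist_real_def)
    define h where "h = min (e/2) (d/2)"
    have h: "h > 0" "h < e" "h < d" using e d by (auto simp: h_def)
    show ?thesis
    proof (rule exceed[of "X + h"])
      fix y assume y: "0 \<le> y" "y \<le> X + h"
      show "p y > 0" using before[of y] d(2)[of y] y h by (cases "y < X") auto
    qed (use h X0 e in auto)
  qed
qed

lemma semiwave_limit:
  assumes sw: "\<And>x. x \<ge> 0 \<Longrightarrow> p x > 0 \<and> q x < \<theta>"
  shows "(q \<longlongrightarrow> \<theta>) at_top"
proof (rule increasing_tendsto)
  show "\<forall>\<^sub>F x in at_top. q x \<le> \<theta>"
    using eventually_ge_at_top[of 0] by eventually_elim (use sw in \<open>auto simp: less_imp_le\<close>)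
next
  fix l assume l: "l < \<theta>"
  have mono: "q x \<le> q y" if "0 \<le> x" "x \<le> y" for x y by (rule q_mono) (use that sw in auto)
  have "\<exists>x\<ge>0. q x > l"
  proof (rule ccontr)
    assume "\<not> ?thesis"
    hence ub: "q x \<le> l" if "x \<ge> 0" for x using that by force
    have q1: "q 1 > 0" by (rule q_pos) (use sw in auto)
    define m where "m = q 1 * (\<theta> - l)"
    have m: "m > 0" using q1 l by (simp add: m_def)
    have fm: "f (q x) \<ge> m" if "x \<ge> 1" for x
    proof -
      have "q 1 \<le> q x" "q x \<le> l" "q x < \<theta>" using mono[of 1 x] ub[of x] sw[of x] that by auto
      thus ?thesis using q1 l f_eq[of "q x"] by (auto simp: m_def intro!: mult_mono)
    qed
    define H where "H x = - (D * p x - k * q x + m * x)" for x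
    define X where "X = 1 + (k * l - k * q 1 + D * p 1) / m"
    have kl: "k * l \<ge> k * q 1" using ub[of 1] k by simp
    have X1: "X \<ge> 1" using m kl D sw[of 1] by (simp add: X_def add_nonneg_nonneg)
    have "H 1 \<le> H X"
    proof (rule DERIV_nonneg_within_imp_le[of 1 X H "\<lambda>x. f (q x) - m"])
      fix z assume "1 \<le> z" "z \<le> X"
      thus "(H has_real_derivative f (q z) - m) (at z within {0..})"
        unfolding H_def using dp[of z] dq[of z] D by (auto intro!: derivative_eq_intros)
    qed (use X1 fm in auto)
    hence "D * p X + m * (X - 1) \<le> D * p 1 + k * (q X - q 1)" by (simp add: H_def algebra_simps)
    moreover have "m * (X - 1) = k * l - k * q 1 + D * p 1" using m by (simp add: X_def)
    moreover have "k * q X \<le> k * l" using ub[of X] X1 k by simp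
    ultimately have "D * p X \<le> 0" by (simp add: algebra_simps)
    thus False using sw[of X] X1 D by (simp add: mult_le_0_iff)
  qed
  then obtain x where "x \<ge> 0" "q x > l" by auto
  thus "\<forall>\<^sub>F x in at_top. l < q x"
    using mono by (auto simp: eventually_at_top_linorder intro!: exI[of _ x] intro: less_le_trans)
qed

lemma small_speed_undershoots:
  assumes small: "k\<^sup>2 * (D / (2 * \<nu>\<^sup>2) + (1 / \<nu> + \<theta> / D) * \<theta>) < \<theta> ^ 3 / 12"
  shows "\<exists>x>0. p x < 0 \<and> (\<forall>y. 0 \<le> y \<and> y \<le> x \<longrightarrow> q y < \<theta>)"
proof -
  define C where "C = 1 / \<nu> + \<theta> / D"
  have C: "C > 0" using nu theta D by (simp add: C_def add_pos_pos)
  have False if x: "x > 0" "q x = \<theta> / 2" and pos: "\<And>y. 0 \<le> y \<Longrightarrow> y \<le> x \<Longrightarrow> p y > 0" for x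
  proof -
    have qle: "0 \<le> q y" "q y \<le> \<theta> / 2" if "0 \<le> y" "y \<le> x" for y
      using q_nonneg[of y] q_mono[of y x] that pos x by auto
    have pC: "p y \<le> k * C" if y: "0 \<le> y" "y \<le> x" for y
    proof -
      have "k / D * q 0 - p 0 \<le> k / D * q y - p y"
      proof (rule DERIV_nonneg_within_imp_le[of 0 y "\<lambda>y. k / D * q y - p y" "\<lambda>y. f (q y) / D"])
        fix z assume "0 \<le> z" "z \<le> y"
        thus "((\<lambda>y. k / D * q y - p y) has_real_derivative f (q z) / D) (at z within {0..})"
          using dp[of z] dq[of z] D by (auto intro!: derivative_eq_intros simp: field_simps)
      next
        fix z assume "0 < z" "z < y"
        hence "0 \<le> q z" "q z \<le> \<theta> / 2" using y qle by auto
        thus "f (q z) / D \<ge> 0" using D theta f_eq[of "q z"] by auto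
      qed (use y in auto)
      moreover have "k / D * q y \<le> k / D * \<theta>" using qle[OF y] k D theta by (intro mult_left_mono) auto
      ultimately show ?thesis using p0 q0 by (simp add: C_def algebra_simps)
    qed
    define H where "H y = k\<^sup>2 * C * q y - (D * (p y)\<^sup>2 / 2 + (\<theta> * (q y)\<^sup>2 / 2 - (q y)^3 / 3))" for y
    have "H 0 \<le> H x"
    proof (rule DERIV_nonneg_within_imp_le[of 0 x H "\<lambda>y. k * p y * (k * C - p y)"])
      fix z assume z: "0 \<le> z" "z \<le> x"
      have fz: "f (q z) = q z * (\<theta> - q z)" using qle[OF z] theta by (intro f_eq) auto
      show "(H has_real_derivative k * p z * (k * C - p z)) (at z within {0..})"
        unfolding H_def using dp[of z] dq[of z] D z
        by (auto intro!: derivative_eq_intros simp: fz field_simps power2_eq_square)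
    next
      fix z assume "0 < z" "z < x"
      thus "k * p z * (k * C - p z) \<ge> 0" using pC[of z] pos[of z] k by auto
    qed (use x in auto)
    moreover have "H 0 = - (k\<^sup>2 * (D / (2 * \<nu>\<^sup>2)))" by (simp add: H_def q0 p0 power_divide mult.commute)
    moreover have "H x \<le> k\<^sup>2 * C * \<theta> - \<theta>^3/12"
    proof -
      have "\<theta> * (\<theta> / 2)\<^sup>2 / 2 - (\<theta> / 2)^3 / 3 = \<theta>^3/12" by (simp add: power2_eq_square power3_eq_cube)
      moreover have "k\<^sup>2 * C * (\<theta>/2) \<le> k\<^sup>2 * C * \<theta>" using C theta by (intro mult_left_mono) auto
      ultimately show ?thesis using D unfolding H_def x(2)
        by (smt (verit) divide_nonneg_nonneg zero_le_mult_iff zero_le_power2)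
    qed
    moreover have "k\<^sup>2 * (D / (2 * \<nu>\<^sup>2) + C * \<theta>) = k\<^sup>2 * (D / (2 * \<nu>\<^sup>2)) + k\<^sup>2 * C * \<theta>"
      by (simp add: distrib_left)
    ultimately show False using small unfolding C_def[symmetric] by linarith
  qed
  note no = this
  show ?thesis
  proof (cases rule: trichotomy)
    case (neg x) thus ?thesis by auto
  next
    case (exceed x)
    obtain y where y: "0 \<le> y" "y \<le> x" "q y = \<theta> / 2"
      using IVT'[of q 0 "\<theta>/2" x] exceed theta q0 continuous_on_subset[OF cont_q, of "{0..x}"] by auto
    have "y \<noteq> 0" using y q0 theta by auto
    thus ?thesis using no[of y] y exceed(3) by auto
  next
    case semiwave
    have "\<forall>\<^sub>F x in at_top. q x > \<theta> / 2"
      using order_tendstoD(1)[OF semiwave_limit[OF semiwave], of "\<theta>/2"] theta by simp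
    then obtain x where x: "x \<ge> 0" "q x > \<theta> / 2" 
      by (metis eventually_at_top_linorder linorder_linear)
    obtain y where y: "0 \<le> y" "y \<le> x" "q y = \<theta> / 2"
      using IVT'[of q 0 "\<theta>/2" x] x theta q0 continuous_on_subset[OF cont_q, of "{0..x}"] by auto
    have "y \<noteq> 0" using y q0 theta by auto
    thus ?thesis using no[of y] y semiwave by auto
  qed
qed

text \<open>At this speed the linearisation at \<open>0\<close> has the double root \<open>l = sqrt (\<theta> / D)\<close>, which makes \<open>p - l q\<close> grow.\<close>
lemma critical_exceeds:
  assumes crit: "k = 2 * sqrt (\<theta> * D)"
  shows "\<exists>x>0. q x > \<theta> \<and> (\<forall>y. 0 \<le> y \<and> y \<le> x \<longrightarrow> p y > 0)"
proof -
  define l where "l = sqrt (\<theta> / D)"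
  have l: "l > 0" using theta D by (simp add: l_def)
  have l2: "l\<^sup>2 = \<theta> / D" using theta D by (simp add: l_def)
  have "(l * D)\<^sup>2 = l\<^sup>2 * D\<^sup>2" by (rule power_mult_distrib)
  also have "\<dots> = (sqrt (\<theta> * D))\<^sup>2" using theta D unfolding l2 by (simp add: power2_eq_square)
  finally have "(l * D)\<^sup>2 = (sqrt (\<theta> * D))\<^sup>2" .
  hence kl: "k = 2 * (l * D)" using l D theta crit
    by (metis less_imp_le mult_nonneg_nonneg power2_eq_imp_eq real_sqrt_ge_zero)
  have low: "p x \<ge> k / \<nu>" if x: "x \<ge> 0" and pos: "\<And>z. 0 \<le> z \<Longrightarrow> z < x \<Longrightarrow> p z > 0" for x
  proof -
    have "exp (- l * 0) * (p 0 - l * q 0) \<le> exp (- l * x) * (p x - l * q x)"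
    proof (rule DERIV_nonneg_within_imp_le[of 0 x "\<lambda>x. exp (- l * x) * (p x - l * q x)"
            "\<lambda>x. exp (- l * x) * (l\<^sup>2 * q x - f (q x) / D)"])
      fix z assume "0 \<le> z" "z \<le> x"
      thus "((\<lambda>x. exp (- l * x) * (p x - l * q x)) has_real_derivative 
          exp (- l * z) * (l\<^sup>2 * q z - f (q z) / D)) (at z within {0..})"
        using dp[of z] dq[of z] D 
        by (auto intro!: derivative_eq_intros simp: kl field_simps power2_eq_square)
    next
      fix z assume z: "0 < z" "z < x"
      have "q z \<ge> 0" by (rule q_nonneg) (use z pos in auto)
      hence "f (q z) \<le> \<theta> * q z"
        using f_lipschitz[of "q z" 0] theta by (auto simp: f_def)
      hence "f (q z) / D \<le> l\<^sup>2 * q z" using D by (simp add: l2 divide_right_mono)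
      thus "exp (- l * z) * (l\<^sup>2 * q z - f (q z) / D) \<ge> 0" by simp
    qed (use x in auto)
    hence 1: "k / \<nu> \<le> exp (- l * x) * (p x - l * q x)" by (simp add: p0 q0)
    hence "p x - l * q x \<ge> 0" using k nu 
      by (smt (verit, best) divide_pos_pos exp_gt_zero mult_pos_neg)
    moreover have "exp (- l * x) \<le> 1" using l x by simp
    ultimately have "exp (- l * x) * (p x - l * q x) \<le> p x - l * q x"
      by (simp add: mult_left_le_one_le)
    moreover have "q x \<ge> 0" by (rule q_nonneg) (use x pos in auto)
    hence "l * q x \<ge> 0" using l by simp
    ultimately show ?thesis using 1 by linarith
  qed
  have kn: "k / \<nu> > 0" using k nu by simp
  show ?thesis
  proof (cases rule: trichotomy)
    case (neg x)
    obtain X where X: "0 < X" "p X = 0" "\<And>y. 0 \<le> y \<Longrightarrow> y < X \<Longrightarrow> p y > 0"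
      by (rule first_zero[OF continuous_on_subset[OF cont_p] _ p0_pos, of x]) (use neg in auto)
    hence "p X \<ge> k / \<nu>" using low[of X] by auto
    hence "0 \<ge> k / \<nu>" using X by simp
    thus ?thesis using kn by linarith
  next
    case (exceed x) thus ?thesis by auto
  next
    case semiwave
    have "q 0 - k / \<nu> * 0 \<le> q (\<theta> * \<nu> / k) - k / \<nu> * (\<theta> * \<nu> / k)"
    proof (rule DERIV_nonneg_within_imp_le[of 0 _ "\<lambda>x. q x - k / \<nu> * x" "\<lambda>x. p x - k / \<nu>"])
      fix z :: real assume "0 \<le> z"
      thus "((\<lambda>x. q x - k / \<nu> * x) has_real_derivative p z - k / \<nu>) (at z within {0..})"
        using dq[of z] nu by (auto intro!: derivative_eq_intros)
    qed (use theta nu k low semiwave in auto)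
    hence "q (\<theta> * \<nu> / k) \<ge> \<theta>" using q0 k nu by simp
    thus ?thesis using semiwave[of "\<theta> * \<nu> / k"] theta nu k by auto
  qed
qed

end

lemma ivp_dependence:
  assumes 1: "ivp k1 q1 p1" and k1: "k1 > 0" and X: "X \<ge> 0" and e: "e > 0"
  shows "\<exists>d>0. \<forall>k2 q2 p2 x. ivp k2 q2 p2 \<and> 0 < k2 \<and> \<bar>k1 - k2\<bar> < d \<and> 0 \<le> x \<and> x \<le> X \<longrightarrow>
           \<bar>q1 x - q2 x\<bar> < e \<and> \<bar>p1 x - p2 x\<bar> < e"
proof -
  have "bounded (p1 ` {0..X})"
    by (intro compact_imp_bounded compact_continuous_image continuous_on_subset[OF cont_p[OF 1 k1]]) auto
  then obtain M where M: "\<And>x. 0 \<le> x \<Longrightarrow> x \<le> X \<Longrightarrow> \<bar>p1 x\<bar> \<le> M"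
    unfolding bounded_iff by (metis atLeastAtMost_iff image_eqI real_norm_def)
  define C where "C = 1 + (2 * (k1 + 1) + 1 + \<theta>) / D"
  define E where "E = (1 / \<nu>\<^sup>2 + X * (M\<^sup>2 / D)) * exp (C * X) + 1"
  have C0: "C \<ge> 0" using k1 theta D by (simp add: C_def)
  have E: "E > 0" using X D nu by (simp add: E_def add_nonneg_pos)
  define d where "d = min 1 (e / sqrt E)"
  have d: "d > 0" using e E by (simp add: d_def)
  show ?thesis
  proof (rule exI[of _ d], rule conjI[OF d], intro allI impI)
    fix k2 q2 p2 x
    assume A: "ivp k2 q2 p2 \<and> 0 < k2 \<and> \<bar>k1 - k2\<bar> < d \<and> 0 \<le> x \<and> x \<le> X"
    hence 2: "ivp k2 q2 p2" and k2: "k2 > 0" and kd: "\<bar>k1 - k2\<bar> < d" and x: "0 \<le> x" "x \<le> X" by auto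
    define \<kappa> where "\<kappa> = k1 - k2"
    define z where "z y = (q1 y - q2 y)\<^sup>2 + (p1 y - p2 y)\<^sup>2" for y
    define z' where "z' y = 2 * (q1 y - q2 y) * (p1 y - p2 y) + 
        2 * (p1 y - p2 y) * ((k1 * p1 y - f (q1 y)) / D - (k2 * p2 y - f (q2 y)) / D)" for y
    have dz: "(z has_real_derivative z' y) (at y within {0..})" if "y \<ge> 0" for y
      unfolding z_def z'_def
      using dq[OF 1 k1 that] dp[OF 1 k1 that] dq[OF 2 k2 that] dp[OF 2 k2 that] D
      by (auto intro!: derivative_eq_intros simp: field_simps)
    have z': "z' y \<le> C * z y + \<kappa>\<^sup>2 * (M\<^sup>2 / D)" if y: "0 \<le> y" "y \<le> X" for y
    proof -
      define a b where "a = q1 y - q2 y" and "b = p1 y - p2 y"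
      define g where "g = f (q1 y) - f (q2 y)"
      have g: "\<bar>g\<bar> \<le> \<theta> * \<bar>a\<bar>" using f_lipschitz by (simp add: g_def a_def)
      have zab: "z y = a\<^sup>2 + b\<^sup>2" by (simp add: z_def a_def b_def)
      have "z' y = 2 * a * b + 2 * b * (k2 * b + \<kappa> * p1 y - g) / D"
        unfolding z'_def a_def b_def g_def \<kappa>_def using D by (simp add: field_simps)
      also have "\<dots> \<le> z y + ((2 * (k1 + 1) + 1 + \<theta>) * z y + \<kappa>\<^sup>2 * M\<^sup>2) / D"
      proof (intro add_mono divide_right_mono)
        show "2 * a * b \<le> z y" using sum_squares_bound[of a b] by (simp add: zab)
        have "2 * b * (k2 * b) \<le> 2 * (k1 + 1) * z y"
        proof -
          have "k2 \<le> k1 + 1" using kd by (auto simp: d_def)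
          hence "2 * k2 * b\<^sup>2 \<le> 2 * (k1 + 1) * z y"
            using k1 k2 by (intro mult_mono) (auto simp: zab)
          thus ?thesis by (simp add: power2_eq_square algebra_simps)
        qed
        moreover have "2 * b * (\<kappa> * p1 y) \<le> z y + \<kappa>\<^sup>2 * M\<^sup>2"
        proof -
          have "2 * b * (\<kappa> * p1 y) \<le> b\<^sup>2 + (\<kappa> * p1 y)\<^sup>2" by (rule sum_squares_bound)
          also have "(\<kappa> * p1 y)\<^sup>2 \<le> \<kappa>\<^sup>2 * M\<^sup>2"
          proof -
            have "(p1 y)\<^sup>2 \<le> M\<^sup>2" using M[OF y] by (simp add: abs_le_square_iff[symmetric])
            thus ?thesis by (simp add: power_mult_distrib mult_left_mono)
          qed
          finally show ?thesis by (simp add: zab) (smt (verit) zero_le_power2)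
        qed
        moreover have "2 * b * (- g) \<le> \<theta> * z y"
        proof -
          have "2 * b * (- g) \<le> 2 * \<bar>b\<bar> * \<bar>g\<bar>" by (metis abs_ge_self abs_minus_cancel abs_mult abs_numeral)
          also have "\<dots> \<le> 2 * \<bar>b\<bar> * (\<theta> * \<bar>a\<bar>)" using g by (intro mult_left_mono) auto
          also have "\<dots> = \<theta> * (2 * \<bar>a\<bar> * \<bar>b\<bar>)" by simp
          also have "\<dots> \<le> \<theta> * z y" using theta sum_squares_bound[of "\<bar>a\<bar>" "\<bar>b\<bar>"]
            by (intro mult_left_mono) (auto simp: zab)
          finally show ?thesis .
        qed
        ultimately show "2 * b * (k2 * b + \<kappa> * p1 y - g) \<le> (2 * (k1 + 1) + 1 + \<theta>) * z y + \<kappa>\<^sup>2 * M\<^sup>2"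
          by (simp add: algebra_simps)
      qed (use D in auto)
      also have "\<dots> = C * z y + \<kappa>\<^sup>2 * (M\<^sup>2 / D)" using D by (simp add: C_def field_simps)
      finally show ?thesis .
    qed
    have "- (exp (- C * 0) * z 0) + \<kappa>\<^sup>2 * (M\<^sup>2 / D) * 0 \<le> - (exp (- C * x) * z x) + \<kappa>\<^sup>2 * (M\<^sup>2 / D) * x"
    proof (rule DERIV_nonneg_within_imp_le[of 0 x "\<lambda>y. - (exp (- C * y) * z y) + \<kappa>\<^sup>2 * (M\<^sup>2 / D) * y"
          "\<lambda>y. \<kappa>\<^sup>2 * (M\<^sup>2 / D) - exp (- C * y) * (z' y - C * z y)"])
      fix y assume y: "0 \<le> y" "y \<le> x"
      show "((\<lambda>y. - (exp (- C * y) * z y) + \<kappa>\<^sup>2 * (M\<^sup>2 / D) * y) has_real_derivative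
         \<kappa>\<^sup>2 * (M\<^sup>2 / D) - exp (- C * y) * (z' y - C * z y)) (at y within {0..})"
        using dz[OF y(1)] D by (auto intro!: derivative_eq_intros simp: algebra_simps)
    next
      fix y assume y: "0 < y" "y < x"
      have "exp (- C * y) * (z' y - C * z y) \<le> exp (- C * y) * (\<kappa>\<^sup>2 * (M\<^sup>2 / D))"
        using z'[of y] y x by (intro mult_left_mono) auto
      also have "\<dots> \<le> 1 * (\<kappa>\<^sup>2 * (M\<^sup>2 / D))"
        using y C0 D by (intro mult_right_mono) auto
      finally show "0 \<le> \<kappa>\<^sup>2 * (M\<^sup>2 / D) - exp (- C * y) * (z' y - C * z y)" by simp
    qed (use x in auto)
    moreover have "z 0 = \<kappa>\<^sup>2 / \<nu>\<^sup>2"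
      unfolding z_def \<kappa>_def p0[OF 1 k1] p0[OF 2 k2] q0[OF 1 k1] q0[OF 2 k2]
      by (simp add: diff_divide_distrib[symmetric] power_divide)
    ultimately have "exp (- C * x) * z x \<le> \<kappa>\<^sup>2 * (1 / \<nu>\<^sup>2 + x * (M\<^sup>2 / D))"
      by (simp add: algebra_simps)
    also have "\<dots> \<le> \<kappa>\<^sup>2 * (1 / \<nu>\<^sup>2 + X * (M\<^sup>2 / D))"
      using x D by (intro mult_left_mono add_left_mono mult_right_mono divide_right_mono) auto
    finally have "exp (C * x) * (exp (- C * x) * z x) \<le> exp (C * x) * (\<kappa>\<^sup>2 * (1 / \<nu>\<^sup>2 + X * (M\<^sup>2 / D)))"
      by (intro mult_left_mono) auto
    hence "z x \<le> exp (C * x) * (\<kappa>\<^sup>2 * (1 / \<nu>\<^sup>2 + X * (M\<^sup>2 / D)))"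
      by (simp add: exp_minus field_simps)
    also have "\<dots> \<le> exp (C * X) * (\<kappa>\<^sup>2 * (1 / \<nu>\<^sup>2 + X * (M\<^sup>2 / D)))"
      using x C0 X D by (intro mult_right_mono) (auto simp: mult_left_mono)
    also have "\<dots> = \<kappa>\<^sup>2 * (E - 1)" by (simp add: E_def)
    also have "\<dots> \<le> \<kappa>\<^sup>2 * E" by (intro mult_left_mono) auto
    finally have zx: "z x \<le> \<kappa>\<^sup>2 * E" .
    have "\<bar>\<kappa>\<bar> < e / sqrt E" using kd by (simp add: \<kappa>_def d_def)
    hence "\<bar>\<kappa>\<bar> * sqrt E < e" using E by (simp add: field_simps)
    hence "(\<bar>\<kappa>\<bar> * sqrt E)\<^sup>2 < e\<^sup>2" using E by (intro power_strict_mono) auto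
    hence ze: "z x < e\<^sup>2" using zx E by (simp add: power_mult_distrib)
    have "(q1 x - q2 x)\<^sup>2 < e\<^sup>2" "(p1 x - p2 x)\<^sup>2 < e\<^sup>2"
      using ze unfolding z_def by (smt (verit) zero_le_power2)+
    thus "\<bar>q1 x - q2 x\<bar> < e \<and> \<bar>p1 x - p2 x\<bar> < e"
      using e power_less_imp_less_base[of "\<bar>q1 x - q2 x\<bar>" 2 e] power_less_imp_less_base[of "\<bar>p1 x - p2 x\<bar>" 2 e]
      by simp
  qed
qed

definition undershoot where
  "undershoot k \<longleftrightarrow> (\<exists>q p. ivp k q p \<and> (\<exists>x>0. p x < 0 \<and> (\<forall>y. 0 \<le> y \<and> y \<le> x \<longrightarrow> q y < \<theta>)))"

definition overshoot where
  "overshoot k \<longleftrightarrow> (\<exists>q p. ivp k q p \<and> (\<exists>x>0. q x > \<theta> \<and> (\<forall>y. 0 \<le> y \<and> y \<le> x \<longrightarrow> p y > 0)))"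

lemma ivp_ex: "\<exists>q p. ivp k q p"
  using ivp_exists[of k] unfolding ivp_def by blast

lemma ivp_unique:
  assumes "ivp k q p" "ivp k q' p'" "k > 0" "x \<ge> 0"
  shows "q x = q' x" "p x = p' x"
proof -
  have "\<bar>q x - q' x\<bar> < e \<and> \<bar>p x - p' x\<bar> < e" if "e > 0" for e
    using ivp_dependence[OF assms(1,3,4) that] assms by fastforce
  thus "q x = q' x" "p x = p' x"
    by (metis dense_ge abs_ge_zero abs_le_zero_iff less_imp_le eq_iff_diff_eq_0)+
qed

lemma undershoot_open:
  assumes "undershoot k" "k > 0"
  shows "\<exists>d>0. \<forall>k'>0. \<bar>k - k'\<bar> < d \<longrightarrow> undershoot k'"
proof -
  from assms obtain q p x where S: "ivp k q p" "x > 0" "p x < 0" "\<And>y. 0 \<le> y \<Longrightarrow> y \<le> x \<Longrightarrow> q y < \<theta>"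
    by (auto simp: undershoot_def)
  obtain y0 where y0: "y0 \<in> {0..x}" "\<And>y. y \<in> {0..x} \<Longrightarrow> q y \<le> q y0"
    using continuous_attains_sup[of "{0..x}" q] continuous_on_subset[OF cont_q[OF S(1) assms(2)], of "{0..x}"] S(2)
    by auto
  define e where "e = min (\<theta> - q y0) (- p x)"
  have e: "e > 0" using S y0 by (auto simp: e_def)
  obtain d where d: "d > 0" "\<And>k2 q2 p2 x'. ivp k2 q2 p2 \<Longrightarrow> 0 < k2 \<Longrightarrow> \<bar>k - k2\<bar> < d \<Longrightarrow> 0 \<le> x' \<Longrightarrow> x' \<le> x \<Longrightarrow>
           \<bar>q x' - q2 x'\<bar> < e \<and> \<bar>p x' - p2 x'\<bar> < e"
    using ivp_dependence[OF S(1) assms(2) _ e, of x] S(2) by (metis less_imp_le)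
  show ?thesis
  proof (intro exI[of _ d] conjI d(1) allI impI)
    fix k' assume k': "k' > 0" "\<bar>k - k'\<bar> < d"
    obtain q2 p2 where 2: "ivp k' q2 p2" using ivp_ex by blast
    have "p2 x < 0" using d(2)[OF 2 k', of x] S(2) by (auto simp: e_def)
    moreover have "q2 y < \<theta>" if "0 \<le> y" "y \<le> x" for y
      using d(2)[OF 2 k', of y] y0(2)[of y] that by (auto simp: e_def)
    ultimately show "undershoot k'" unfolding undershoot_def using 2 S(2) by blast
  qed
qed

lemma overshoot_open:
  assumes "overshoot k" "k > 0"
  shows "\<exists>d>0. \<forall>k'>0. \<bar>k - k'\<bar> < d \<longrightarrow> overshoot k'"
proof -
  from assms obtain q p x where S: "ivp k q p" "x > 0" "q x > \<theta>" "\<And>y. 0 \<le> y \<Longrightarrow> y \<le> x \<Longrightarrow> p y > 0"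
    by (auto simp: overshoot_def)
  obtain y0 where y0: "y0 \<in> {0..x}" "\<And>y. y \<in> {0..x} \<Longrightarrow> p y \<ge> p y0"
    using continuous_attains_inf[of "{0..x}" p] continuous_on_subset[OF cont_p[OF S(1) assms(2)], of "{0..x}"] S(2)
    by auto
  define e where "e = min (p y0) (q x - \<theta>)"
  have e: "e > 0" using S y0 by (auto simp: e_def)
  obtain d where d: "d > 0" "\<And>k2 q2 p2 x'. ivp k2 q2 p2 \<Longrightarrow> 0 < k2 \<Longrightarrow> \<bar>k - k2\<bar> < d \<Longrightarrow> 0 \<le> x' \<Longrightarrow> x' \<le> x \<Longrightarrow>
           \<bar>q x' - q2 x'\<bar> < e \<and> \<bar>p x' - p2 x'\<bar> < e"
    using ivp_dependence[OF S(1) assms(2) _ e, of x] S(2) by (metis less_imp_le)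
  show ?thesis
  proof (intro exI[of _ d] conjI d(1) allI impI)
    fix k' assume k': "k' > 0" "\<bar>k - k'\<bar> < d"
    obtain q2 p2 where 2: "ivp k' q2 p2" using ivp_ex by blast
    have "q2 x > \<theta>" using d(2)[OF 2 k', of x] S(2) by (auto simp: e_def)
    moreover have "p2 y > 0" if "0 \<le> y" "y \<le> x" for y
      using d(2)[OF 2 k', of y] y0(2)[of y] that by (auto simp: e_def)
    ultimately show "overshoot k'" unfolding overshoot_def using 2 S(2) by blast
  qed
qed

lemma not_under_and_overshoot:
  assumes "undershoot k" "overshoot k" "k > 0" shows False
proof -
  from assms obtain q p x q' p' x' where 
    1: "ivp k q p" "x > 0" "p x < 0" "\<And>y. 0 \<le> y \<Longrightarrow> y \<le> x \<Longrightarrow> q y < \<theta>" and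
    2: "ivp k q' p'" "x' > 0" "q' x' > \<theta>" "\<And>y. 0 \<le> y \<Longrightarrow> y \<le> x' \<Longrightarrow> p' y > 0"
    by (auto simp: undershoot_def overshoot_def)
  note eq = ivp_unique[OF 1(1) 2(1) assms(3)]
  show False
    using 1(2,3) 2(2,3) 1(4)[of x'] 2(4)[of x] eq(1)[of x'] eq(2)[of x] by (cases "x \<le> x'") auto
qed

lemma semiwave_speed_exists:
  "\<exists>k q p. 0 < k \<and> k < 2 * sqrt (\<theta> * D) \<and> ivp k q p \<and> (\<forall>x\<ge>0. p x > 0 \<and> q x < \<theta>)"
proof -
  define K where "K = 2 * sqrt (\<theta> * D)"
  have K: "K > 0" using theta D by (simp add: K_def)
  have overK: "overshoot K"
    using ivp_ex[of K] critical_exceeds[OF _ K K_def] unfolding overshoot_def by blast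
  define C where "C = D / (2 * \<nu>\<^sup>2) + (1 / \<nu> + \<theta> / D) * \<theta>"
  have C: "C > 0" using nu theta D by (simp add: C_def add_pos_pos)
  define k0 where "k0 = min K (sqrt (\<theta>^3 / (24 * C)))"
  have k0: "0 < k0" "k0 \<le> K" using K C theta by (auto simp: k0_def)
  have "k0\<^sup>2 \<le> (sqrt (\<theta>^3 / (24 * C)))\<^sup>2" using k0 by (intro power_mono) (auto simp: k0_def)
  also have "\<dots> = \<theta>^3 / (24 * C)" using C theta by simp
  finally have "k0\<^sup>2 * C \<le> \<theta>^3 / 24" using C by (simp add: field_simps)
  also have "\<dots> < \<theta>^3/12" using theta by simp
  finally have "k0\<^sup>2 * C < \<theta>^3/12" .
  hence underk0: "undershoot k0"
    using ivp_ex[of k0] small_speed_undershoots[OF _ k0(1)] unfolding undershoot_def C_def by blast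
  have "\<exists>k\<in>{k0..K}. \<not> undershoot k \<and> \<not> overshoot k"
  proof (rule ccontr)
    assume "\<not> ?thesis"
    hence all: "undershoot k \<or> overshoot k" if "k \<in> {k0..K}" for k using that by auto
    define U where "U = {k. k > 0 \<and> undershoot k}"
    define V where "V = {k. k > 0 \<and> overshoot k}"
    have U: "open U"
      unfolding open_dist
    proof
      fix k assume k: "k \<in> U"
      then obtain d where "d > 0" "\<forall>k'>0. \<bar>k - k'\<bar> < d \<longrightarrow> undershoot k'" 
        using undershoot_open by (auto simp: U_def)
      thus "\<exists>e>0. \<forall>y. dist y k < e \<longrightarrow> y \<in> U" using k
        by (intro exI[of _ "min d k"]) (auto simp: U_def dist_real_def abs_minus_commute)
    qed
    have V: "open V"
      unfolding open_dist
    proof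
      fix k assume k: "k \<in> V"
      then obtain d where "d > 0" "\<forall>k'>0. \<bar>k - k'\<bar> < d \<longrightarrow> overshoot k'" 
        using overshoot_open by (auto simp: V_def)
      thus "\<exists>e>0. \<forall>y. dist y k < e \<longrightarrow> y \<in> V" using k
        by (intro exI[of _ "min d k"]) (auto simp: V_def dist_real_def abs_minus_commute)
    qed
    have "connected {k0..K}" by simp
    moreover have "U \<inter> V \<inter> {k0..K} = {}" using not_under_and_overshoot by (auto simp: U_def V_def)
    moreover have "{k0..K} \<subseteq> U \<union> V" using all k0 by (force simp: U_def V_def)
    moreover have "k0 \<in> U \<inter> {k0..K}" "K \<in> V \<inter> {k0..K}" using k0 K underk0 overK by (auto simp: U_def V_def)
    ultimately show False using U V unfolding connected_def by blast
  qed
  then obtain k where k: "k0 \<le> k" "k \<le> K" "\<not> undershoot k" "\<not> overshoot k" by auto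
  have kpos: "k > 0" using k k0 by linarith
  have "k \<noteq> K" using overK k by auto
  obtain q p where qp: "ivp k q p" using ivp_ex by blast
  have "\<forall>x\<ge>0. p x > 0 \<and> q x < \<theta>"
  proof (cases rule: trichotomy[OF qp kpos])
    case (1 x) thus ?thesis using k(3) qp unfolding undershoot_def by blast
  next
    case (2 x) thus ?thesis using k(4) qp unfolding overshoot_def by blast
  qed auto
  thus ?thesis using qp kpos k \<open>k \<noteq> K\<close> unfolding K_def by force
qed

end

definition semi_wave :: "real \<Rightarrow> real \<Rightarrow> real \<Rightarrow> real \<Rightarrow> (real \<Rightarrow> real) \<Rightarrow> (real \<Rightarrow> real) \<Rightarrow> (real \<Rightarrow> real) \<Rightarrow> bool" where
  "semi_wave \<nu> D \<theta> k q q' q'' \<longleftrightarrow> q 0 = 0 \<and> continuous_on {0..} q \<and>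
        (\<forall>x\<ge>0. (q has_real_derivative q' x) (at x within {0..})) \<and>
        q' 0 = k / \<nu> \<and>
        (\<forall>x>0. (q' has_real_derivative q'' x) (at x)) \<and>
        (\<forall>x>0. D * q'' x - k * q' x + q x * (\<theta> - q x) = 0) \<and>
        (q \<longlongrightarrow> \<theta>) at_top \<and>
        (\<forall>x>0. q' x > 0)"

lemma semi_wave_exists:
  assumes "\<nu> > 0" "D > 0" "\<theta> > 0"
  shows "\<exists>k q q' q''. 0 < k \<and> k < 2 * sqrt (\<theta> * D) \<and> semi_wave \<nu> D \<theta> k q q' q''"
proof -
  interpret semi_wave_shooting \<nu> D \<theta> by standard (use assms in auto)
  obtain k q p where k: "0 < k" "k < 2 * sqrt (\<theta> * D)" and ivp: "ivp k q p"
    and sw: "\<And>x. x \<ge> 0 \<Longrightarrow> p x > 0 \<and> q x < \<theta>"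
    using semiwave_speed_exists by blast
  note facts = q0[OF ivp k(1)] p0[OF ivp k(1)] dq[OF ivp k(1)] dp[OF ivp k(1)]
  have "semi_wave \<nu> D \<theta> k q p (\<lambda>x. (k * p x - f (q x)) / D)"
    unfolding semi_wave_def
  proof (intro conjI allI impI)
    show "continuous_on {0..} q" by (rule cont_q[OF ivp k(1)])
    show "(q \<longlongrightarrow> \<theta>) at_top" by (rule semiwave_limit[OF ivp k(1) sw])
    fix x :: real assume x: "x > 0"
    have "at x within {0..} = at x" by (rule at_within_interior) (use x in auto)
    thus "(p has_real_derivative (k * p x - f (q x)) / D) (at x)" using facts(4)[of x] x by simp
    have "q x \<ge> 0" by (rule q_nonneg[OF ivp k(1)]) (use x sw in auto)
    hence "f (q x) = q x * (\<theta> - q x)" using sw[of x] x by (intro f_eq) auto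
    thus "D * ((k * p x - f (q x)) / D) - k * p x + q x * (\<theta> - q x) = 0" using D by simp
  qed (use facts sw in auto)
  thus ?thesis using k by blast
qed

context
  fixes \<nu> D \<theta> k :: real and q q' q'' :: "real \<Rightarrow> real"
  assumes sw: "semi_wave \<nu> D \<theta> k q q' q''" and nu: "\<nu> > 0" and D: "D > 0" and theta: "\<theta> > 0" and k: "k > 0"
begin

lemma sw_simps: "q 0 = 0" "q' 0 = k / \<nu>" "continuous_on {0..} q" "(q \<longlongrightarrow> \<theta>) at_top"
  and sw_dq0: "x \<ge> 0 \<Longrightarrow> (q has_real_derivative q' x) (at x within {0..})"
  and sw_dq': "x > 0 \<Longrightarrow> (q' has_real_derivative q'' x) (at x)"
  and sw_ode: "x > 0 \<Longrightarrow> D * q'' x = k * q' x - q x * (\<theta> - q x)"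
  using sw by (auto simp: semi_wave_def)

lemma sw_q'_pos: "x \<ge> 0 \<Longrightarrow> q' x > 0"
  using sw nu k by (cases "x = 0") (auto simp: semi_wave_def)

lemma sw_dq: "x > 0 \<Longrightarrow> (q has_real_derivative q' x) (at x)"
  using sw_dq0[of x] at_within_interior[of x "{0..}"] by simp

lemma sw_strict_mono: "0 \<le> x \<Longrightarrow> x < y \<Longrightarrow> q x < q y"
proof (rule DERIV_pos_imp_increasing_open[of x y q])
  assume xy: "0 \<le> x" "x < y"
  show "\<exists>d. (q has_real_derivative d) (at z) \<and> 0 < d" if "x < z" "z < y" for z
    using sw_dq[of z] sw_q'_pos[of z] that xy by auto
  show "continuous_on {x..y} q" by (rule continuous_on_subset[OF sw_simps(3)]) (use xy in auto)
qed

lemma sw_less: "x \<ge> 0 \<Longrightarrow> q x < \<theta>"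
proof -
  assume x: "x \<ge> 0"
  have "q (x + 1) \<le> \<theta>"
  proof (rule tendsto_lowerbound[OF sw_simps(4)])
    show "\<forall>\<^sub>F y in at_top. q (x + 1) \<le> q y"
      using eventually_ge_at_top[of "x+1"] 
    proof eventually_elim
      case (elim y)
      thus ?case using sw_strict_mono[of "x+1" y] x by (cases "y = x + 1") auto
    qed
  qed auto
  thus ?thesis using sw_strict_mono[of x "x+1"] x by auto
qed

lemma sw_nonneg: "x \<ge> 0 \<Longrightarrow> q x \<ge> 0"
  using sw_strict_mono[of 0 x] sw_simps(1) by (cases "x = 0") auto

text \<open>\<open>D q' - k q\<close> is Lipschitz by the equation, which makes the one-sided derivative at \<open>0\<close> a limit.\<close>
lemma sw_q'_tendsto_0: "(q' \<longlongrightarrow> k / \<nu>) (at_right 0)"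
proof -
  have quot: "((\<lambda>x. q x / x) \<longlongrightarrow> k / \<nu>) (at_right 0)"
  proof -
    have "((\<lambda>x. (q x - q 0) / (x - 0)) \<longlongrightarrow> q' 0) (at 0 within {0..})"
      using sw_dq0[of 0] unfolding has_field_derivative_iff by simp
    hence "((\<lambda>x. (q x - q 0) / (x - 0)) \<longlongrightarrow> q' 0) (at 0 within {0<..})"
      by (rule tendsto_within_subset) auto
    thus ?thesis by (simp add: sw_simps)
  qed
  have q0: "(q \<longlongrightarrow> 0) (at_right 0)"
  proof -
    have "(q \<longlongrightarrow> q 0) (at 0 within {0..})"
      using sw_simps(3) unfolding continuous_on_def by auto
    hence "(q \<longlongrightarrow> q 0) (at 0 within {0<..})"
      by (rule tendsto_within_subset) auto
    thus ?thesis by (simp add: sw_simps)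
  qed
  have bound: "\<bar>q' x - q x / x\<bar> \<le> (\<theta>\<^sup>2 * x + k * q x) / D" if x: "x > 0" for x
  proof -
    have "\<exists>l \<xi>. 0 < \<xi> \<and> \<xi> < x \<and> (q has_real_derivative l) (at \<xi>) \<and> q x - q 0 = (x - 0) * l"
    proof (rule MVT[OF x])
      show "continuous_on {0..x} q" by (rule continuous_on_subset[OF sw_simps(3)]) auto
      show "q differentiable (at y)" if "0 < y" "y < x" for y
        using sw_dq[OF that(1)] real_differentiable_def by blast
    qed
    then obtain l \<xi> where xi: "0 < \<xi>" "\<xi> < x" "(q has_real_derivative l) (at \<xi>)" "q x - q 0 = (x - 0) * l" by blast
    hence xi: "0 < \<xi>" "\<xi> < x" "q x - q 0 = (x - 0) * q' \<xi>"
      using DERIV_unique[OF xi(3) sw_dq[OF xi(1)]] by auto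
    define W where "W x = D * q' x - k * q x" for x
    have "\<exists>z. \<xi> < z \<and> z < x \<and> W x - W \<xi> = (x - \<xi>) * (- (q z * (\<theta> - q z)))"
    proof (rule MVT2[OF xi(2)])
      fix z assume "\<xi> \<le> z" "z \<le> x"
      hence "z > 0" using xi by auto
      thus "(W has_real_derivative - (q z * (\<theta> - q z))) (at z)"
        unfolding W_def using sw_dq[of z] sw_dq'[of z] sw_ode[of z]
        by (auto intro!: derivative_eq_intros simp: mult.commute)
    qed
    then obtain z where z: "\<xi> < z" "z < x" "W x - W \<xi> = (x - \<xi>) * (- (q z * (\<theta> - q z)))" by auto
    have qz: "0 \<le> q z" "q z < \<theta>" using sw_nonneg[of z] sw_less[of z] z xi by auto
    have "\<bar>W x - W \<xi>\<bar> = (x - \<xi>) * (q z * (\<theta> - q z))"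
      unfolding z(3) using xi qz by (simp add: abs_mult)
    also have "\<dots> \<le> x * (\<theta> * \<theta>)" using xi qz by (intro mult_mono) auto
    finally have 1: "\<bar>W x - W \<xi>\<bar> \<le> \<theta>\<^sup>2 * x" by (simp add: power2_eq_square mult.commute)
    have "q \<xi> \<ge> 0" "q \<xi> < q x" using sw_nonneg[of \<xi>] sw_strict_mono[of \<xi> x] xi by auto
    hence 2: "0 \<le> k * (q x - q \<xi>)" "k * (q x - q \<xi>) \<le> k * q x" using k by auto
    have "D * (q' x - q' \<xi>) = (W x - W \<xi>) + k * (q x - q \<xi>)" by (simp add: W_def algebra_simps)
    hence "D * \<bar>q' x - q' \<xi>\<bar> \<le> \<theta>\<^sup>2 * x + k * q x" using 1 2 D abs_mult[of D "q' x - q' \<xi>"] by linarith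
    moreover have "q' \<xi> = q x / x" using xi(3) x by (simp add: sw_simps)
    ultimately show ?thesis using D by (simp add: field_simps)
  qed
  have "((\<lambda>x. q' x - q x / x) \<longlongrightarrow> 0) (at_right 0)"
  proof (rule Lim_null_comparison)
    show "\<forall>\<^sub>F x in at_right 0. norm (q' x - q x / x) \<le> (\<theta>\<^sup>2 * x + k * q x) / D"
      using bound by (auto simp: eventually_at_filter)
    have "((\<lambda>x. (\<theta>\<^sup>2 * x + k * q x) / D) \<longlongrightarrow> (\<theta>\<^sup>2 * 0 + k * 0) / D) (at_right 0)"
      using D by (intro tendsto_intros q0) auto
    thus "((\<lambda>x. (\<theta>\<^sup>2 * x + k * q x) / D) \<longlongrightarrow> 0) (at_right 0)" by simp
  qed
  from tendsto_add[OF this quot] show ?thesis by simp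
qed

lemma sw_phase_plane:
  obtains P where "\<And>y. 0 < y \<Longrightarrow> y < \<theta> \<Longrightarrow> P y > 0"
    "\<And>y. 0 < y \<Longrightarrow> y < \<theta> \<Longrightarrow> (P has_real_derivative (k - y * (\<theta> - y) / P y) / D) (at y)"
    "(P \<longlongrightarrow> k / \<nu>) (at_right 0)"
    "\<And>\<delta> y0. \<delta> > 0 \<Longrightarrow> 0 < y0 \<Longrightarrow> y0 < \<theta> \<Longrightarrow> \<exists>y>y0. y < \<theta> \<and> P y < \<delta>"
proof -
  define G where "G = inv_into {0..} q"
  have inj: "inj_on q {0..}"
    by (rule linorder_inj_onI) (use sw_strict_mono in force)+
  have Gq: "G (q x) = x" if "x \<ge> 0" for x unfolding G_def using inj that by simp
  have surj: "\<exists>x>0. q x = y" if y: "0 < y" "y < \<theta>" for y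
  proof -
    have "\<forall>\<^sub>F x in at_top. q x > y \<and> x \<ge> 0"
      using order_tendstoD(1)[OF sw_simps(4) y(2)] eventually_ge_at_top[of 0] by eventually_elim auto
    then obtain X where "q X > y" "X \<ge> 0" using eventually_happens[of _ "at_top :: real filter"] by auto
    then obtain x where "0 \<le> x" "q x = y"
      using IVT'[of q 0 y X] y sw_simps(1) continuous_on_subset[OF sw_simps(3), of "{0..X}"] by auto
    moreover have "x \<noteq> 0" using \<open>q x = y\<close> y sw_simps(1) by auto
    ultimately show ?thesis by (intro exI[of _ x]) auto
  qed
  have qG: "q (G y) = y" "G y > 0" if "0 < y" "y < \<theta>" for y
    using surj[OF that] Gq by force+
  have dG: "(G has_real_derivative inverse (q' (G y))) (at y)" if y: "0 < y" "y < \<theta>" for y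
  proof (rule DERIV_inverse_function[of q _ G y 0 \<theta>])
    show "(q has_real_derivative q' (G y)) (at (G y))" using sw_dq qG[OF y] by simp
    show "q' (G y) \<noteq> 0" using sw_q'_pos[of "G y"] qG[OF y] by auto
    have "isCont G (q (G y))"
    proof (rule isCont_inverse_function[of "G y / 2" "G y" G q])
      fix z assume "\<bar>z - G y\<bar> \<le> G y / 2"
      hence z: "z > 0" using qG(2)[OF y] by linarith
      show "G (q z) = z" using Gq z by simp
      show "isCont q z" using sw_dq[OF z] DERIV_isCont by blast
    qed (use qG[OF y] in auto)
    thus "isCont G y" using qG[OF y] by simp
  qed (use y qG in auto)
  define P where "P y = q' (G y)" for y
  have Ppos: "P y > 0" if "0 < y" "y < \<theta>" for y unfolding P_def using sw_q'_pos[of "G y"] qG[OF that] by auto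
  show ?thesis
  proof (rule that[of P, OF Ppos])
    fix y assume y: "0 < y" "y < \<theta>"
    have "((\<lambda>y. q' (G y)) has_real_derivative q'' (G y) * inverse (q' (G y))) (at y)"
      by (rule DERIV_chain2[OF sw_dq' dG]) (use qG y in auto)
    moreover have "q'' (G y) * inverse (q' (G y)) = (k - y * (\<theta> - y) / P y) / D"
      using sw_ode[of "G y"] qG[OF y] D Ppos[OF y] unfolding P_def
      by (simp add: field_simps)
    ultimately show "(P has_real_derivative (k - y * (\<theta> - y) / P y) / D) (at y)" unfolding P_def by simp
  next
    show "(P \<longlongrightarrow> k / \<nu>) (at_right 0)"
    proof (rule tendstoI)
      fix e :: real assume "e > 0"
      from tendstoD[OF sw_q'_tendsto_0 this] obtain b where b: "b > 0" "\<And>x. 0 < x \<Longrightarrow> x < b \<Longrightarrow> dist (q' x) (k/\<nu>) < e"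
        unfolding eventually_at_right_field by auto
      have qb: "0 < q b" using sw_strict_mono[of 0 b] b sw_simps(1) by auto
      have "dist (P y) (k / \<nu>) < e" if y: "0 < y" "y < min (q b) \<theta>" for y
      proof -
        have "G y < b"
        proof (rule ccontr)
          assume "\<not> G y < b"
          hence "q b \<le> q (G y)" using sw_strict_mono[of b "G y"] b by (cases "G y = b") auto
          thus False using qG[of y] y by auto
        qed
        thus ?thesis using b(2)[of "G y"] qG[of y] y by (simp add: P_def)
      qed
      thus "\<forall>\<^sub>F y in at_right 0. dist (P y) (k / \<nu>) < e"
        unfolding eventually_at_right_field using qb theta by (intro exI[of _ "min (q b) \<theta>"]) auto
    qed
  next
    fix \<delta> y0 :: real assume d: "\<delta> > 0" and y0: "0 < y0" "y0 < \<theta>"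
    show "\<exists>y>y0. y < \<theta> \<and> P y < \<delta>"
    proof (rule ccontr)
      assume "\<not> ?thesis"
      hence ge: "P y \<ge> \<delta>" if "y0 < y" "y < \<theta>" for y using that by force
      define x0 where "x0 = G y0"
      have x0: "x0 > 0" "q x0 = y0" using qG[OF y0] by (auto simp: x0_def)
      define X where "X = x0 + \<theta> / \<delta>"
      have X: "X > x0" using theta d by (simp add: X_def)
      obtain z where z: "x0 < z" "z < X" "q X - q x0 = (X - x0) * q' z"
        using MVT2[OF X, of q q'] sw_dq x0 by force
      have "q z > y0" "q z < \<theta>" using sw_strict_mono[of x0 z] sw_less[of z] z x0 by auto
      hence "q' z \<ge> \<delta>" using ge[of "q z"] Gq[of z] z x0 by (simp add: P_def)
      hence "(X - x0) * q' z \<ge> (X - x0) * \<delta>" using X by (intro mult_left_mono) auto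
      moreover have "(X - x0) * \<delta> = \<theta>" using d by (simp add: X_def)
      ultimately have "q X \<ge> \<theta> + y0" using z x0 by simp
      thus False using sw_less[of X] X x0 y0 by auto
    qed
  qed
qed

end

lemma semi_wave_unique_less:
  assumes sw: "semi_wave \<nu> D \<theta> k1 q1 q1' q1''" "semi_wave \<nu> D \<theta> k2 q2 q2' q2''"
    and pos: "\<nu> > 0" "D > 0" "\<theta> > 0" "k1 > 0" "k1 < k2"
  shows False
proof -
  have k2: "k2 > 0" using pos by simp
  obtain P1 where P1: "\<And>y. 0 < y \<Longrightarrow> y < \<theta> \<Longrightarrow> P1 y > 0"
    "\<And>y. 0 < y \<Longrightarrow> y < \<theta> \<Longrightarrow> (P1 has_real_derivative (k1 - y * (\<theta> - y) / P1 y) / D) (at y)"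
    "(P1 \<longlongrightarrow> k1 / \<nu>) (at_right 0)"
    "\<And>\<delta> y0. \<delta> > 0 \<Longrightarrow> 0 < y0 \<Longrightarrow> y0 < \<theta> \<Longrightarrow> \<exists>y>y0. y < \<theta> \<and> P1 y < \<delta>"
    by (rule sw_phase_plane[OF sw(1) pos(1-4)], rule that)
  obtain P2 where P2: "\<And>y. 0 < y \<Longrightarrow> y < \<theta> \<Longrightarrow> P2 y > 0"
    "\<And>y. 0 < y \<Longrightarrow> y < \<theta> \<Longrightarrow> (P2 has_real_derivative (k2 - y * (\<theta> - y) / P2 y) / D) (at y)"
    "(P2 \<longlongrightarrow> k2 / \<nu>) (at_right 0)"
    "\<And>\<delta> y0. \<delta> > 0 \<Longrightarrow> 0 < y0 \<Longrightarrow> y0 < \<theta> \<Longrightarrow> \<exists>y>y0. y < \<theta> \<and> P2 y < \<delta>"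
    by (rule sw_phase_plane[OF sw(2) pos(1-3) k2], rule that)
  define \<Delta> where "\<Delta> y = P2 y - P1 y" for y
  have "(\<Delta> \<longlongrightarrow> k2 / \<nu> - k1 / \<nu>) (at_right 0)"
    unfolding \<Delta>_def by (intro tendsto_intros P1 P2)
  moreover have "k2 / \<nu> - k1 / \<nu> > 0" using pos by (simp add: divide_strict_right_mono)
  ultimately have "\<forall>\<^sub>F y in at_right 0. \<Delta> y > 0" by (rule order_tendstoD)
  then obtain b where b: "b > 0" "\<And>y. 0 < y \<Longrightarrow> y < b \<Longrightarrow> \<Delta> y > 0" unfolding eventually_at_right_field by auto
  define y0 where "y0 = min (b/2) (\<theta>/2)"
  have y0: "0 < y0" "y0 < \<theta>" "\<Delta> y0 > 0" using b pos by (auto simp: y0_def)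
  have d\<Delta>: "(\<Delta> has_real_derivative ((k2 - k1) + y * (\<theta> - y) * (1 / P1 y - 1 / P2 y)) / D) (at y)"
    if "0 < y" "y < \<theta>" for y
    unfolding \<Delta>_def using P1(2)[OF that] P2(2)[OF that] pos
    by (auto intro!: derivative_eq_intros simp: diff_divide_distrib add_divide_distrib algebra_simps)
  have incr: "\<Delta> y0 \<le> \<Delta> y" if y: "y0 \<le> y" "y < \<theta>" and p: "\<And>z. y0 \<le> z \<Longrightarrow> z < y \<Longrightarrow> \<Delta> z > 0" for y
  proof (rule DERIV_nonneg_imp_increasing_open[of y0 y \<Delta>])
    fix z assume z: "y0 < z" "z < y"
    have "\<Delta> z > 0" using p z by auto
    hence "P1 z < P2 z" by (simp add: \<Delta>_def)
    hence "1 / P2 z \<le> 1 / P1 z" using P1(1)[of z] z y0 y by (intro divide_left_mono) auto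
    hence "((k2 - k1) + z * (\<theta> - z) * (1 / P1 z - 1 / P2 z)) / D \<ge> 0"
      using z y y0 pos by (intro divide_nonneg_pos add_nonneg_nonneg mult_nonneg_nonneg) auto
    thus "\<exists>w. (\<Delta> has_real_derivative w) (at z) \<and> 0 \<le> w"
      using d\<Delta>[of z] z y y0 by force
  next
    show "continuous_on {y0..y} \<Delta>"
      by (rule continuous_at_imp_continuous_on) (use y0 y in \<open>auto intro!: DERIV_isCont[OF d\<Delta>]\<close>)
  qed (use y in auto)
  have pos\<Delta>: "\<Delta> y > 0" if y: "y0 \<le> y" "y < \<theta>" for y
  proof (rule ccontr)
    assume "\<not> \<Delta> y > 0"
    hence neg: "\<Delta> y \<le> 0" by simp
    have cont: "continuous_on {y0..y} \<Delta>"
      by (rule continuous_at_imp_continuous_on) (use y0 y in \<open>auto intro!: DERIV_isCont[OF d\<Delta>]\<close>)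
    obtain X where X: "y0 < X" "X \<le> y" "\<Delta> X = 0" "\<And>z. y0 \<le> z \<Longrightarrow> z < X \<Longrightarrow> \<Delta> z > 0"
      by (rule first_zero[OF cont y(1) y0(3) neg], rule that)
    thus False using incr[of X] y y0 by auto
  qed
  obtain y where y: "y > y0" "y < \<theta>" "P2 y < \<Delta> y0" using P2(4)[OF y0(3,1,2)] by auto
  have "\<Delta> y0 \<le> \<Delta> y" using incr[of y] pos\<Delta> y by auto
  thus False using y P1(1)[of y] y0 by (auto simp: \<Delta>_def)
qed

lemma semi_wave_speed_is_speed:
  assumes "\<nu> > 0" "D > 0" "\<theta> > 0"
  shows "0 < semi_wave_speed \<nu> D \<theta>" "\<exists>q q' q''. semi_wave \<nu> D \<theta> (semi_wave_speed \<nu> D \<theta>) q q' q''"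
proof -
  obtain k where k: "0 < k" "k < 2 * sqrt (\<theta> * D)" "\<exists>q q' q''. semi_wave \<nu> D \<theta> k q q' q''"
    using semi_wave_exists[OF assms] by blast
  have "semi_wave_speed \<nu> D \<theta> = k"
    unfolding semi_wave_speed_def semi_wave_def[symmetric]
  proof (rule the_equality)
    show "0 < k \<and> k < 2 * sqrt (\<theta> * D) \<and> (\<exists>q q' q''. semi_wave \<nu> D \<theta> k q q' q'')" using k by simp
    fix k' assume "0 < k' \<and> k' < 2 * sqrt (\<theta> * D) \<and> (\<exists>q q' q''. semi_wave \<nu> D \<theta> k' q q' q'')"
    thus "k' = k" using k semi_wave_unique_less[OF _ _ assms] by (metis linorder_less_linear)
  qed
  thus "0 < semi_wave_speed \<nu> D \<theta>" "\<exists>q q' q''. semi_wave \<nu> D \<theta> (semi_wave_speed \<nu> D \<theta>) q q' q''"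
    using k by auto
qed

section \<open>Parabolic comparison\<close>

lemma second_derivative_test:
  fixes f f' :: "real \<Rightarrow> real"
  assumes e: "e > 0" and d: "\<And>y. \<bar>y - x\<bar> < e \<Longrightarrow> (f has_real_derivative f' y) (at y)"
    and d2: "(f' has_real_derivative f2) (at x)" and min: "\<And>y. \<bar>y - x\<bar> < e \<Longrightarrow> f x \<le> f y"
  shows "f' x = 0" "f2 \<ge> 0"
proof -
  show 0: "f' x = 0"
    by (rule DERIV_local_min[OF d[of x] e]) (use e min in \<open>auto simp: abs_minus_commute\<close>)
  show "f2 \<ge> 0"
  proof (rule ccontr)
    assume "\<not> f2 \<ge> 0"
    then obtain \<delta> where \<delta>: "\<delta> > 0" "\<And>h. 0 < h \<Longrightarrow> h < \<delta> \<Longrightarrow> f' (x + h) < 0"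
      using DERIV_neg_dec_right[OF d2] 0 by auto
    define h where "h = min (\<delta>/2) (e/2)"
    have h: "0 < h" "h < \<delta>" "h < e" using e \<delta> by (auto simp: h_def)
    obtain z where z: "x < z" "z < x + h" "f (x + h) - f x = (x + h - x) * f' z"
      using MVT2[of x "x + h" f f'] d h by auto
    have "f' z < 0" using \<delta>(2)[of "z - x"] z h by auto
    hence "(x + h - x) * f' z < 0" using h by (intro mult_pos_neg) auto
    hence "f (x + h) < f x" using z(3) by linarith
    thus False using min[of "x + h"] h by auto
  qed
qed

definition region :: "real \<Rightarrow> real \<Rightarrow> real \<Rightarrow> (real \<Rightarrow> real) \<Rightarrow> (real \<times> real) set" where
  "region t0 T l r = {(t, x). t \<in> {t0..T} \<and> l \<le> x \<and> x \<le> r t}"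

lemma region_compact:
  assumes cr: "continuous_on {t0..T} r"
  shows "compact (region t0 T l r)" "\<exists>C. \<forall>(t, x)\<in>region t0 T l r. x < C"
proof -
  have "bounded (r ` {t0..T})"
    by (intro compact_imp_bounded compact_continuous_image cr) auto
  then obtain C where C: "\<And>t. t \<in> {t0..T} \<Longrightarrow> r t \<le> C"
    unfolding bounded_iff by (metis abs_le_D1 image_eqI real_norm_def)
  have eq: "region t0 T l r = {p \<in> {t0..T} \<times> {l..C}. snd p \<le> r (fst p)}"
    using C by (force simp: region_def)
  have "closed (region t0 T l r)" unfolding eq
    by (intro continuous_on_closed_Collect_le continuous_intros continuous_on_compose2[OF cr] closed_Times) auto
  moreover have "bounded (region t0 T l r)"
    by (rule bounded_subset[OF bounded_Times[OF bounded_closed_interval bounded_closed_interval], of _ t0 T l C])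
       (auto simp: eq)
  ultimately show "compact (region t0 T l r)" by (simp add: compact_eq_bounded_closed)
  have "\<forall>(t, x)\<in>region t0 T l r. x < C + 1" by (auto simp: eq)
  thus "\<exists>C. \<forall>(t, x)\<in>region t0 T l r. x < C" by blast
qed

lemma region_bounded:
  assumes "continuous_on {t0..T} r" "continuous_on (region t0 T l r) (\<lambda>(t, x). f t x)"
  shows "\<exists>K::real. \<forall>t x. t0 \<le> t \<longrightarrow> t \<le> T \<longrightarrow> l \<le> x \<longrightarrow> x \<le> r t \<longrightarrow> \<bar>f t x\<bar> \<le> K"
proof -
  have "bounded ((\<lambda>(t, x). f t x) ` region t0 T l r)"
    by (intro compact_imp_bounded compact_continuous_image region_compact assms)
  then obtain K where K: "\<forall>y\<in>(\<lambda>(t, x). f t x) ` region t0 T l r. norm y \<le> K" unfolding bounded_iff by blast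
  have "\<bar>f t x\<bar> \<le> K" if "t0 \<le> t" "t \<le> T" "l \<le> x" "x \<le> r t" for t x
  proof -
    have "f t x \<in> (\<lambda>(t, x). f t x) ` region t0 T l r"
      by (rule image_eqI[of _ _ "(t, x)"]) (use that in \<open>auto simp: region_def\<close>)
    thus ?thesis using K by auto
  qed
  thus ?thesis by blast
qed

definition parabolic_on ::
  "real \<Rightarrow> real \<Rightarrow> real \<Rightarrow> (real \<Rightarrow> real) \<Rightarrow> (real \<Rightarrow> real \<Rightarrow> real) \<Rightarrow> (real \<Rightarrow> real \<Rightarrow> real) \<Rightarrow>
   (real \<Rightarrow> real \<Rightarrow> real) \<Rightarrow> (real \<Rightarrow> real \<Rightarrow> real) \<Rightarrow> bool" where
  "parabolic_on t0 T l r w wt wx wxx \<longleftrightarrow>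
     continuous_on (region t0 T l r) (\<lambda>(t, x). w t x) \<and>
     (\<forall>t x. t0 < t \<longrightarrow> t \<le> T \<longrightarrow> l < x \<longrightarrow> x < r t \<longrightarrow>
        (w t has_real_derivative wx t x) (at x) \<and>
        (wx t has_real_derivative wxx t x) (at x) \<and>
        ((\<lambda>s. w s x) has_real_derivative wt t x) (at t))"

lemma parabolic_on_diff:
  assumes "parabolic_on t0 T l r w wt wx wxx" "parabolic_on t0 T l r \<phi> \<phi>t \<phi>x \<phi>xx"
  shows "parabolic_on t0 T l r (\<lambda>t x. w t x - \<phi> t x) (\<lambda>t x. wt t x - \<phi>t t x)
           (\<lambda>t x. wx t x - \<phi>x t x) (\<lambda>t x. wxx t x - \<phi>xx t x)"
  using assms unfolding parabolic_on_def
  by (auto simp: case_prod_beta intro!: continuous_intros derivative_intros)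

text \<open>The function \<open>exp (- \<Lambda> (t - t0)) z + \<epsilon> (C - x)\<close> with \<open>\<Lambda> > K\<close> cannot have a negative minimum;
  the tilt \<open>- \<epsilon> x\<close> excludes minima on a Neumann boundary, where no second derivative is available.\<close>
lemma parabolic_minimum_principle:
  fixes z zt zx zxx :: "real \<Rightarrow> real \<Rightarrow> real" and r :: "real \<Rightarrow> real"
  assumes D: "D > 0" and cr: "continuous_on {t0..T} r"
    and z: "parabolic_on t0 T l r z zt zx zxx"
    and init: "\<And>x. l \<le> x \<Longrightarrow> x \<le> r t0 \<Longrightarrow> z t0 x \<ge> 0"
    and right: "\<And>t. t0 < t \<Longrightarrow> t \<le> T \<Longrightarrow> l \<le> r t \<Longrightarrow> z t (r t) \<ge> 0"
    and left: "\<And>t. t0 < t \<Longrightarrow> t \<le> T \<Longrightarrow> l < r t \<Longrightarrow> z t l \<ge> 0 \<or>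
        (\<exists>m\<le>0. (z t has_real_derivative m) (at l within {l..r t}))"
    and pde: "\<And>t x. t0 < t \<Longrightarrow> t \<le> T \<Longrightarrow> l < x \<Longrightarrow> x < r t \<Longrightarrow> z t x < 0 \<Longrightarrow>
        zt t x - D * zxx t x \<ge> K * z t x"
    and tx: "t0 \<le> t1" "t1 \<le> T" "l \<le> x1" "x1 \<le> r t1"
  shows "z t1 x1 \<ge> 0"
proof (rule ccontr)
  assume neg: "\<not> z t1 x1 \<ge> 0"
  define \<Lambda> where "\<Lambda> = K + 1"
  define E where "E t = exp (- \<Lambda> * (t - t0))" for t
  have E: "E t > 0" for t by (simp add: E_def)
  obtain C where C: "\<And>t x. (t, x) \<in> region t0 T l r \<Longrightarrow> x < C"
    using region_compact(2)[OF cr, of l] by blast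
  have in1: "(t1, x1) \<in> region t0 T l r" using tx by (simp add: region_def)
  define \<epsilon> where "\<epsilon> = - (E t1 * z t1 x1) / (2 * (C - x1))"
  have Ez1: "E t1 * z t1 x1 < 0" using neg E[of t1] by (simp add: mult_pos_neg)
  have \<epsilon>: "\<epsilon> > 0" unfolding \<epsilon>_def using Ez1 C[OF in1] by (intro divide_pos_pos) auto
  define Z where "Z t x = E t * z t x + \<epsilon> * (C - x)" for t x
  have "\<epsilon> * (C - x1) = - (E t1 * z t1 x1) / 2"
    using C[OF in1] by (simp add: \<epsilon>_def field_simps)
  hence Z1: "Z t1 x1 < 0" using Ez1 by (simp add: Z_def)
  have "continuous_on (region t0 T l r) (\<lambda>(t, x). Z t x)"
    using z unfolding parabolic_on_def Z_def E_def case_prod_beta by (intro continuous_intros) auto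
  then obtain p where p: "p \<in> region t0 T l r" "\<And>y. y \<in> region t0 T l r \<Longrightarrow> (\<lambda>(t, x). Z t x) p \<le> (\<lambda>(t, x). Z t x) y"
    using continuous_attains_inf[OF region_compact(1)[OF cr], of l "\<lambda>(t, x). Z t x"] in1 by blast
  obtain t x where ptx: "p = (t, x)" by fastforce
  have min: "Z t x \<le> Z s y" if "(s, y) \<in> region t0 T l r" for s y using p(2)[OF that] by (simp add: ptx)
  have reg: "t0 \<le> t" "t \<le> T" "l \<le> x" "x \<le> r t" using p(1) by (auto simp: ptx region_def)
  have Zneg: "Z t x < 0" using min[OF in1] Z1 by simp
  have "\<epsilon> * (C - x) > 0" using \<epsilon> C[of t x] p ptx by simp
  hence "E t * z t x < 0" using Zneg by (simp add: Z_def)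
  hence zneg: "z t x < 0" using E[of t] by (simp add: mult_less_0_iff)
  have t: "t0 < t" using init[of x] zneg reg by (cases "t = t0") auto
  have x: "x < r t" using right[OF t reg(2)] zneg reg by (cases "x = r t") auto
  have xl: "l < x"
  proof (rule ccontr)
    assume "\<not> l < x"
    hence xl: "x = l" using reg by simp
    then obtain m where m: "m \<le> 0" "(z t has_real_derivative m) (at l within {l..r t})"
      using left[OF t reg(2)] x zneg by auto
    have "(Z t has_real_derivative (E t * m - \<epsilon>)) (at l within {l..r t})"
      unfolding Z_def using m(2) by (auto intro!: derivative_eq_intros)
    moreover have "E t * m - \<epsilon> < 0" using m(1) E[of t] \<epsilon> by (smt (verit) mult_nonneg_nonpos)
    ultimately obtain d where d: "d > 0" "\<And>h. h > 0 \<Longrightarrow> l + h \<in> {l..r t} \<Longrightarrow> h < d \<Longrightarrow> Z t (l + h) < Z t l"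
      using has_real_derivative_neg_dec_right by blast
    define h where "h = min (d/2) (r t - l)"
    have h: "h > 0" "h < d" "l + h \<in> {l..r t}" using d x xl by (auto simp: h_def)
    have "Z t l \<le> Z t (l + h)" using min[of t "l + h"] reg h xl by (auto simp: region_def)
    thus False using d(2)[OF h(1,3,2)] by simp
  qed
  define e where "e = min (x - l) (r t - x)"
  have e: "e > 0" using x xl by (simp add: e_def)
  have inside: "l < y" "y < r t" if "\<bar>y - x\<bar> < e" for y using that by (auto simp: e_def)
  define Zx where "Zx y = E t * zx t y - \<epsilon>" for y
  have dZ: "(Z t has_real_derivative Zx y) (at y)" if "\<bar>y - x\<bar> < e" for y
    unfolding Z_def Zx_def using z inside[OF that] t reg unfolding parabolic_on_def
    by (auto intro!: derivative_eq_intros)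
  have dZ2: "(Zx has_real_derivative E t * zxx t x) (at x)"
    unfolding Zx_def using z t reg x xl unfolding parabolic_on_def
    by (auto intro!: derivative_eq_intros)
  have "E t * zxx t x \<ge> 0"
    by (rule second_derivative_test(2)[OF e dZ dZ2])
       (use inside reg in \<open>auto intro!: min simp: region_def less_imp_le\<close>)
  moreover have "E t * (zt t x - \<Lambda> * z t x) \<le> 0"
  proof (rule ccontr)
    assume neg: "\<not> E t * (zt t x - \<Lambda> * z t x) \<le> 0"
    have "((\<lambda>s. Z s x) has_real_derivative E t * (zt t x - \<Lambda> * z t x)) (at t)"
      unfolding Z_def E_def using z t reg x xl unfolding parabolic_on_def
      by (auto intro!: derivative_eq_intros simp: algebra_simps)
    from DERIV_pos_inc_left[OF this] neg obtain d where d: "d > 0" "\<And>h. h > 0 \<Longrightarrow> h < d \<Longrightarrow> Z (t - h) x < Z t x"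
      by auto
    have "\<exists>d>0. \<forall>s\<in>{t0..T}. dist s t < d \<longrightarrow> dist (r s) (r t) < r t - x"
      using cr x reg unfolding continuous_on_iff by (meson atLeastAtMost_iff diff_gt_0_iff_gt)
    then obtain d' where d': "d' > 0" "\<And>s. s \<in> {t0..T} \<Longrightarrow> \<bar>s - t\<bar> < d' \<Longrightarrow> r s > x"
      by (force simp: dist_real_def)
    define h where "h = min (min (d/2) (d'/2)) (t - t0)"
    have h: "h > 0" "h < d" "h < d'" "t - h \<ge> t0" using d d' t by (auto simp: h_def)
    have "(t - h, x) \<in> region t0 T l r"
      using d'(2)[of "t - h"] h reg by (auto simp: region_def)
    from min[OF this] d(2)[OF h(1,2)] show False by simp
  qed
  ultimately have "E t * (zt t x - \<Lambda> * z t x) - D * (E t * zxx t x) \<le> 0"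
    using D by (smt (verit) mult_nonneg_nonneg)
  hence "E t * (zt t x - D * zxx t x - \<Lambda> * z t x) \<le> 0" by (simp add: algebra_simps)
  hence "zt t x - D * zxx t x \<le> \<Lambda> * z t x" using E[of t] by (simp add: mult_le_0_iff)
  moreover have "\<Lambda> * z t x < K * z t x" using zneg by (simp add: \<Lambda>_def)
  ultimately show False using pde[OF t reg(2) xl x zneg] by linarith
qed

lemma logistic_comparison:
  fixes w wt wx wxx \<phi> \<phi>t \<phi>x \<phi>xx :: "real \<Rightarrow> real \<Rightarrow> real" and r :: "real \<Rightarrow> real"
  assumes D: "D > 0" and cr: "continuous_on {t0..T} r"
    and w: "parabolic_on t0 T l r w wt wx wxx"
    and \<phi>: "parabolic_on t0 T l r \<phi> \<phi>t \<phi>x \<phi>xx"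
    and init: "\<And>x. l \<le> x \<Longrightarrow> x \<le> r t0 \<Longrightarrow> \<phi> t0 x \<le> w t0 x"
    and right: "\<And>t. t0 < t \<Longrightarrow> t \<le> T \<Longrightarrow> l \<le> r t \<Longrightarrow> \<phi> t (r t) \<le> w t (r t)"
    and left: "\<And>t. t0 < t \<Longrightarrow> t \<le> T \<Longrightarrow> l < r t \<Longrightarrow> \<phi> t l \<le> w t l \<or>
        (\<exists>m m'. m \<le> m' \<and> (w t has_real_derivative m) (at l within {l..r t}) \<and>
          (\<phi> t has_real_derivative m') (at l within {l..r t}))"
    and pdew: "\<And>t x. t0 < t \<Longrightarrow> t \<le> T \<Longrightarrow> l < x \<Longrightarrow> x < r t \<Longrightarrow>
        wt t x - D * wxx t x \<ge> w t x * (\<theta> - w t x)"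
    and pde\<phi>: "\<And>t x. t0 < t \<Longrightarrow> t \<le> T \<Longrightarrow> l < x \<Longrightarrow> x < r t \<Longrightarrow>
        \<phi>t t x - D * \<phi>xx t x \<le> \<phi> t x * (\<theta> - \<phi> t x)"
    and tx: "t0 \<le> t" "t \<le> T" "l \<le> x" "x \<le> r t"
  shows "\<phi> t x \<le> w t x"
proof -
  have "continuous_on (region t0 T l r) (\<lambda>(t, x). \<theta> - w t x - \<phi> t x)"
    using w \<phi> unfolding parabolic_on_def case_prod_beta by (intro continuous_intros) auto
  then obtain K where K: "\<And>t x. t0 \<le> t \<Longrightarrow> t \<le> T \<Longrightarrow> l \<le> x \<Longrightarrow> x \<le> r t \<Longrightarrow> \<bar>\<theta> - w t x - \<phi> t x\<bar> \<le> K"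
    using region_bounded[OF cr] by blast
  have "w t x - \<phi> t x \<ge> 0"
  proof (rule parabolic_minimum_principle[OF D cr parabolic_on_diff[OF w \<phi>], of K])
    fix t assume t: "t0 < t" "t \<le> T" "l < r t"
    show "0 \<le> w t l - \<phi> t l \<or>
      (\<exists>m\<le>0. ((\<lambda>x. w t x - \<phi> t x) has_real_derivative m) (at l within {l..r t}))"
      using left[OF t]
    proof (elim disjE exE conjE)
      fix m m' assume "m \<le> m'" "(w t has_real_derivative m) (at l within {l..r t})"
        "(\<phi> t has_real_derivative m') (at l within {l..r t})"
      thus ?thesis by (intro disjI2 exI[of _ "m - m'"]) (auto intro!: derivative_intros)
    qed auto
  next
    fix t x assume tx: "t0 < t" "t \<le> T" "l < x" "x < r t" and neg: "w t x - \<phi> t x < 0"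
    have "K * (w t x - \<phi> t x) \<le> (\<theta> - w t x - \<phi> t x) * (w t x - \<phi> t x)"
      using K[of t x] tx neg by (intro mult_right_mono_neg) auto
    also have "\<dots> = w t x * (\<theta> - w t x) - \<phi> t x * (\<theta> - \<phi> t x)" by (simp add: algebra_simps)
    also have "\<dots> \<le> (wt t x - D * wxx t x) - (\<phi>t t x - D * \<phi>xx t x)"
      using pdew[OF tx] pde\<phi>[OF tx] by linarith
    finally show "K * (w t x - \<phi> t x) \<le> (wt t x - \<phi>t t x) - D * (wxx t x - \<phi>xx t x)"
      by (simp add: algebra_simps)
  qed (use init right tx in auto)
  thus ?thesis by simp
qed

lemma logistic_eventually:
  fixes \<kappa> :: real
  assumes "\<kappa> > 0" "m < \<kappa>"
  shows "\<exists>\<tau>\<ge>0. \<forall>s\<ge>\<tau>. m \<le> \<kappa> / (1 + C * exp (- \<kappa> * s))"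
proof -
  have "filterlim (\<lambda>s. - \<kappa> * s) at_bot at_top"
    using assms by (simp add: filterlim_uminus_at_bot filterlim_tendsto_pos_mult_at_top[OF tendsto_const] filterlim_ident)
  hence "((\<lambda>s. exp (- \<kappa> * s)) \<longlongrightarrow> 0) at_top" by (rule filterlim_compose[OF exp_at_bot])
  hence "((\<lambda>s. \<kappa> / (1 + C * exp (- \<kappa> * s))) \<longlongrightarrow> \<kappa> / (1 + C * 0)) at_top"
    by (intro tendsto_intros) auto
  hence "\<forall>\<^sub>F s in at_top. m < \<kappa> / (1 + C * exp (- \<kappa> * s))"
    using assms by (intro order_tendstoD) auto
  then obtain \<tau> where "\<And>s. s \<ge> \<tau> \<Longrightarrow> m < \<kappa> / (1 + C * exp (- \<kappa> * s))"
    unfolding eventually_at_top_linorder by auto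
  thus ?thesis by (intro exI[of _ "max \<tau> 0"]) (auto simp: less_imp_le)
qed

lemma exp_decay_eventually:
  fixes a M e :: real
  assumes "a > 0" "e > 0"
  shows "\<exists>\<tau>\<ge>0. \<forall>s\<ge>\<tau>. M * exp (- a * s) \<le> e"
proof -
  have "filterlim (\<lambda>s. - a * s) at_bot at_top"
    using assms by (simp add: filterlim_uminus_at_bot filterlim_tendsto_pos_mult_at_top[OF tendsto_const] filterlim_ident)
  hence "((\<lambda>s. exp (- a * s)) \<longlongrightarrow> 0) at_top" by (rule filterlim_compose[OF exp_at_bot])
  hence "((\<lambda>s. M * exp (- a * s)) \<longlongrightarrow> M * 0) at_top"
    by (intro tendsto_intros)
  hence "\<forall>\<^sub>F s in at_top. M * exp (- a * s) < e"
    using assms by (intro order_tendstoD) auto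
  then obtain \<tau> where "\<And>s. s \<ge> \<tau> \<Longrightarrow> M * exp (- a * s) < e"
    unfolding eventually_at_top_linorder by auto
  thus ?thesis by (intro exI[of _ "max \<tau> 0"]) (auto simp: less_imp_le)
qed

section \<open>One species behind a free boundary\<close>

locale free_boundary =
  fixes D \<nu> :: real and w wt wx wxx r :: "real \<Rightarrow> real \<Rightarrow> real" and s :: "real \<Rightarrow> real"
  assumes D: "D > 0" and nu: "\<nu> > 0"
    and cont_w: "continuous_on ({0..} \<times> {0..}) (\<lambda>(t, x). w t x)"
    and cont_r: "continuous_on ({0..} \<times> {0..}) (\<lambda>(t, x). r t x)"
    and cont_s: "continuous_on {0..} s"
    and s0: "s 0 > 0"
    and w_init: "0 \<le> x \<Longrightarrow> x < s 0 \<Longrightarrow> w 0 x > 0"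
    and w_zero: "0 \<le> t \<Longrightarrow> 0 \<le> x \<Longrightarrow> s t \<le> x \<Longrightarrow> w t x = 0"
    and dx_within: "t > 0 \<Longrightarrow> 0 \<le> x \<Longrightarrow> x \<le> s t \<Longrightarrow> (w t has_real_derivative wx t x) (at x within {0..s t})"
    and dxx: "t > 0 \<Longrightarrow> 0 < x \<Longrightarrow> x < s t \<Longrightarrow> (wx t has_real_derivative wxx t x) (at x)"
    and dt: "t > 0 \<Longrightarrow> 0 < x \<Longrightarrow> x < s t \<Longrightarrow> ((\<lambda>t. w t x) has_real_derivative wt t x) (at t)"
    and pde: "t > 0 \<Longrightarrow> 0 < x \<Longrightarrow> x < s t \<Longrightarrow> wt t x - D * wxx t x = w t x * r t x"
    and neumann: "t > 0 \<Longrightarrow> wx t 0 = 0"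
    and stefan: "t > 0 \<Longrightarrow> (s has_real_derivative - \<nu> * wx t (s t)) (at t)"
begin

lemma dx: "t > 0 \<Longrightarrow> 0 < x \<Longrightarrow> x < s t \<Longrightarrow> (w t has_real_derivative wx t x) (at x)"
  using dx_within[of t x] at_within_interior[of x "{0..s t}"] by simp

lemma parabolic:
  assumes "0 \<le> t0" "0 \<le> l" "\<And>t. t0 < t \<Longrightarrow> t \<le> T \<Longrightarrow> \<rho> t \<le> s t"
  shows "parabolic_on t0 T l \<rho> w wt wx wxx"
proof -
  have "continuous_on (region t0 T l \<rho>) (\<lambda>(t, x). w t x)"
    by (rule continuous_on_subset[OF cont_w]) (use assms in \<open>auto simp: region_def\<close>)
  moreover have "t > 0 \<and> 0 < x \<and> x < s t" if "t0 < t" "t \<le> T" "l < x" "x < \<rho> t" for t x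
    using assms(1,2) assms(3)[of t] that by linarith
  ultimately show ?thesis unfolding parabolic_on_def using dx dxx dt by blast
qed

lemma neumann_within:
  assumes "t > 0" "0 \<le> b" "b \<le> s t"
  shows "(w t has_real_derivative 0) (at 0 within {0..b})"
  using DERIV_subset[OF dx_within[of t 0], of "{0..b}"] neumann[of t] assms by auto

lemma cont_s_on: "0 \<le> t0 \<Longrightarrow> continuous_on {t0..T} s"
  by (rule continuous_on_subset[OF cont_s]) auto

lemma cont_w_slice: "t \<ge> 0 \<Longrightarrow> continuous_on {0..b} (w t)"
  using continuous_on_compose[OF _ continuous_on_subset[OF cont_w], of "{0..b}" "\<lambda>x. (t, x)"]
  by (force simp: o_def intro!: continuous_intros)

lemma r_bounded:
  assumes "0 \<le> t0" "0 \<le> l" "continuous_on {t0..T} \<rho>"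
  shows "\<exists>K. \<forall>t x. t0 \<le> t \<longrightarrow> t \<le> T \<longrightarrow> l \<le> x \<longrightarrow> x \<le> \<rho> t \<longrightarrow> \<bar>r t x\<bar> \<le> K"
  by (rule region_bounded[OF assms(3)], rule continuous_on_subset[OF cont_r])
     (use assms in \<open>auto simp: region_def\<close>)

lemma nonneg:
  assumes "t \<ge> 0" "x \<ge> 0" shows "w t x \<ge> 0"
proof (cases "x \<le> s t")
  case True
  obtain K where K: "\<And>t' x. 0 \<le> t' \<Longrightarrow> t' \<le> t \<Longrightarrow> 0 \<le> x \<Longrightarrow> x \<le> s t' \<Longrightarrow> \<bar>r t' x\<bar> \<le> K"
    using r_bounded[OF order_refl order_refl cont_s_on[of 0 t]] by auto
  show ?thesis
  proof (rule parabolic_minimum_principle[OF D cont_s_on[of 0 t] parabolic[of 0 0], of K])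
    fix x assume "0 \<le> x" "x \<le> s 0"
    thus "0 \<le> w 0 x" using w_init[of x] w_zero[of 0 x] by (cases "x = s 0") auto
  next
    fix t' x assume tx: "0 < t'" "t' \<le> t" "0 < x" "x < s t'" "w t' x < 0"
    have "K * w t' x \<le> r t' x * w t' x" using K[of t' x] tx by (intro mult_right_mono_neg) auto
    thus "K * w t' x \<le> wt t' x - D * wxx t' x" using pde[of t' x] tx by (simp add: mult.commute)
  next
    fix t' assume "0 < t'" "0 < s t'"
    thus "0 \<le> w t' 0 \<or> (\<exists>m\<le>0. (w t' has_real_derivative m) (at 0 within {0..s t'}))"
      using neumann_within[of t' "s t'"] by auto
  qed (use True assms w_zero in auto)
qed (use assms w_zero in auto)

lemma wx_boundary_nonpos:
  assumes "t > 0" "s t > 0" shows "wx t (s t) \<le> 0"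
proof (rule ccontr)
  assume "\<not> wx t (s t) \<le> 0"
  then obtain d where d: "d > 0" "\<And>h. h > 0 \<Longrightarrow> s t - h \<in> {0..s t} \<Longrightarrow> h < d \<Longrightarrow> w t (s t - h) < w t (s t)"
    using has_real_derivative_pos_inc_left[OF dx_within[of t "s t"]] assms by auto
  define h where "h = min (d/2) (s t)"
  have "w t (s t - h) < w t (s t)" using d assms by (intro d(2)) (auto simp: h_def)
  moreover have "w t (s t - h) \<ge> 0" using assms by (intro nonneg) (auto simp: h_def)
  ultimately show False using w_zero[of t "s t"] assms by auto
qed

lemma s_increasing:
  assumes "0 \<le> t" "\<And>t'. 0 < t' \<Longrightarrow> t' < t \<Longrightarrow> s t' > 0" shows "s 0 \<le> s t"
proof (rule DERIV_nonneg_imp_increasing_open[of 0 t s])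
  fix t' assume "0 < t'" "t' < t"
  thus "\<exists>y. (s has_real_derivative y) (at t') \<and> 0 \<le> y"
    using stefan[of t'] wx_boundary_nonpos[of t'] assms nu
    by (intro exI[of _ "- \<nu> * wx t' (s t')"]) (auto simp: mult_nonneg_nonpos)
qed (use assms cont_s_on in auto)

lemma s_ge: assumes "t \<ge> 0" shows "s t \<ge> s 0"
proof -
  have "s t' > 0" if t': "t' \<ge> 0" for t'
  proof (rule ccontr)
    assume "\<not> s t' > 0"
    hence neg: "s t' \<le> 0" by simp
    obtain X where "0 < X" "X \<le> t'" "s X = 0" "\<And>y. 0 \<le> y \<Longrightarrow> y < X \<Longrightarrow> s y > 0"
      by (rule first_zero[OF cont_s_on[OF order_refl] t' s0 neg], rule that)
    thus False using s_increasing[of X] s0 by auto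
  qed
  thus ?thesis using s_increasing[OF assms] by auto
qed

text \<open>With \<open>S = 1 - x\<^sup>2 / \<xi>\<^sup>2\<close> the barrier is \<open>m exp (- \<Lambda> (t - t1)) S\<^sup>2\<close>; it is a subsolution for large \<open>\<Lambda>\<close>
  because the defining inequality is a quadratic in \<open>S\<close> whose constant term \<open>- 8 D\<close> is negative.\<close>
lemma positivity_spreads:
  assumes t1: "0 \<le> t1" "t1 \<le> T" and p: "p > 0" and \<sigma>: "\<sigma> \<ge> 0"
    and below: "\<And>t. t1 \<le> t \<Longrightarrow> t \<le> T \<Longrightarrow> p + \<sigma> * (t - t1) \<le> s t"
    and init: "\<And>x. 0 \<le> x \<Longrightarrow> x \<le> p \<Longrightarrow> w t1 x > 0"
    and x: "0 \<le> x" "x < p + \<sigma> * (T - t1)"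
  shows "w T x > 0"
proof -
  define \<xi> where "\<xi> t = p + \<sigma> * (t - t1)" for t
  have c\<xi>: "continuous_on {t1..T} \<xi>" unfolding \<xi>_def by (intro continuous_intros)
  have \<xi>p: "\<xi> t \<ge> p" "\<xi> t > 0" if "t1 \<le> t" for t using that p \<sigma> by (auto simp: \<xi>_def add_pos_nonneg)
  have \<xi>T: "\<xi> t \<le> \<xi> T" if "t \<le> T" for t using that \<sigma> by (auto simp: \<xi>_def mult_left_mono)
  obtain K where K: "\<And>t x. t1 \<le> t \<Longrightarrow> t \<le> T \<Longrightarrow> 0 \<le> x \<Longrightarrow> x \<le> \<xi> t \<Longrightarrow> \<bar>r t x\<bar> \<le> K"
    using r_bounded[OF t1(1) order_refl c\<xi>] by auto
  have "continuous_on {0..p} (w t1)"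
    by (rule cont_w_slice) (use t1 in auto)
  then obtain y where y: "y \<in> {0..p}" "\<And>x. x \<in> {0..p} \<Longrightarrow> w t1 y \<le> w t1 x"
    using continuous_attains_inf[of "{0..p}" "w t1"] p by auto
  define m where "m = w t1 y"
  have m: "m > 0" using y init by (auto simp: m_def)
  define N where "N = 4 * \<sigma> * \<xi> T + 12 * D"
  define \<Lambda> where "\<Lambda> = K + N\<^sup>2 / (32 * D * p\<^sup>2)"
  define E where "E t = m * exp (- \<Lambda> * (t - t1))" for t
  have E: "E t > 0" for t using m by (simp add: E_def)
  define S where "S t x = 1 - x\<^sup>2 / (\<xi> t)\<^sup>2" for t x
  define \<phi> where "\<phi> t x = E t * (S t x)\<^sup>2" for t x
  define \<phi>t where "\<phi>t t x = E t * (- \<Lambda> * (S t x)\<^sup>2 + 4 * S t x * (x\<^sup>2 / (\<xi> t)\<^sup>2) * \<sigma> / \<xi> t)" for t x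
  define \<phi>x where "\<phi>x t x = E t * (- 4 * x * S t x / (\<xi> t)\<^sup>2)" for t x
  define \<phi>xx where "\<phi>xx t x = E t * ((8 - 12 * S t x) / (\<xi> t)\<^sup>2)" for t x
  have \<phi>: "parabolic_on t1 T 0 \<xi> \<phi> \<phi>t \<phi>x \<phi>xx"
    unfolding parabolic_on_def
  proof (intro conjI allI impI)
    have "continuous_on (region t1 T 0 \<xi>) (\<lambda>p. \<xi> (fst p))"
      unfolding \<xi>_def by (intro continuous_intros)
    thus "continuous_on (region t1 T 0 \<xi>) (\<lambda>(t, x). \<phi> t x)"
      unfolding \<phi>_def E_def S_def case_prod_beta using \<xi>p(2)
      by (intro continuous_intros) (force simp: region_def)+
    fix t x assume tx: "t1 < t" "t \<le> T" "0 < x" "x < \<xi> t"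
    have \<xi>: "\<xi> t > 0" using \<xi>p tx by auto
    show "(\<phi> t has_real_derivative \<phi>x t x) (at x)"
      unfolding \<phi>_def \<phi>x_def S_def using \<xi>
      by (auto intro!: derivative_eq_intros simp: field_simps power2_eq_square)
    show "(\<phi>x t has_real_derivative \<phi>xx t x) (at x)"
      unfolding \<phi>x_def \<phi>xx_def S_def using \<xi>
      by (auto intro!: derivative_eq_intros simp: field_simps power2_eq_square)
    have d\<xi>: "(\<xi> has_real_derivative \<sigma>) (at t)" unfolding \<xi>_def by (auto intro!: derivative_eq_intros)
    have dS: "((\<lambda>t. S t x) has_real_derivative 2 * (x\<^sup>2 / (\<xi> t)\<^sup>2) * \<sigma> / \<xi> t) (at t)"
      unfolding S_def using \<xi>
      by (auto intro!: derivative_eq_intros d\<xi> simp: field_simps power2_eq_square)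
    have dE: "(E has_real_derivative - \<Lambda> * E t) (at t)"
      unfolding E_def by (auto intro!: derivative_eq_intros)
    show "((\<lambda>t. \<phi> t x) has_real_derivative \<phi>t t x) (at t)"
      unfolding \<phi>_def \<phi>t_def by (auto intro!: derivative_eq_intros dS dE simp: algebra_simps power2_eq_square)
  qed
  have sub: "\<phi>t t x - D * \<phi>xx t x \<le> - K * \<phi> t x" if tx: "t1 < t" "t \<le> T" "0 < x" "x < \<xi> t" for t x
  proof -
    define Q where "Q = S t x"
    have \<xi>: "\<xi> t > 0" using \<xi>p tx by auto
    have "x\<^sup>2 \<le> (\<xi> t)\<^sup>2" using tx by (intro power_mono) auto
    hence y1: "0 \<le> x\<^sup>2 / (\<xi> t)\<^sup>2" "x\<^sup>2 / (\<xi> t)\<^sup>2 \<le> 1" using \<xi> by auto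
    hence Q: "0 \<le> Q" by (simp add: Q_def S_def)
    have NQ: "N * Q \<le> 8 * D + N\<^sup>2 / (32 * D) * Q\<^sup>2"
    proof -
      have "0 \<le> (16 * D - N * Q)\<^sup>2" by simp
      also have "\<dots> = 32 * D * (8 * D + N\<^sup>2 / (32 * D) * Q\<^sup>2 - N * Q)"
        using D by (simp add: power2_eq_square field_simps)
      finally show ?thesis using D by (simp add: zero_le_mult_iff)
    qed
    have "N\<^sup>2 / (32 * D) * Q\<^sup>2 \<le> (\<Lambda> - K) * (\<xi> t)\<^sup>2 * Q\<^sup>2"
    proof (rule mult_right_mono)
      have "N\<^sup>2 / (32 * D) = (\<Lambda> - K) * p\<^sup>2" using p D by (simp add: \<Lambda>_def field_simps)
      also have "\<dots> \<le> (\<Lambda> - K) * (\<xi> t)\<^sup>2"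
        using \<xi>p(1)[of t] tx p D by (intro mult_left_mono power_mono) (auto simp: \<Lambda>_def)
      finally show "N\<^sup>2 / (32 * D) \<le> (\<Lambda> - K) * (\<xi> t)\<^sup>2" .
    qed auto
    moreover have "4 * Q * (x\<^sup>2 / (\<xi> t)\<^sup>2) * \<sigma> * \<xi> t + 12 * D * Q \<le> N * Q"
    proof -
      have "(x\<^sup>2 / (\<xi> t)\<^sup>2) * (4 * Q * \<sigma> * \<xi> t) \<le> 1 * (4 * Q * \<sigma> * \<xi> t)"
        using y1 Q \<sigma> \<xi> by (intro mult_right_mono) auto
      also have "\<dots> \<le> 4 * Q * \<sigma> * \<xi> T" using Q \<sigma> \<xi>T[of t] tx by (simp add: mult_left_mono)
      finally show ?thesis by (simp add: N_def algebra_simps)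
    qed
    ultimately have "(K - \<Lambda>) * (\<xi> t)\<^sup>2 * Q\<^sup>2 + 4 * Q * (x\<^sup>2 / (\<xi> t)\<^sup>2) * \<sigma> * \<xi> t - D * (8 - 12 * Q) \<le> 0"
      using NQ by (simp add: algebra_simps)
    hence "E t / (\<xi> t)\<^sup>2 * ((K - \<Lambda>) * (\<xi> t)\<^sup>2 * Q\<^sup>2 + 4 * Q * (x\<^sup>2 / (\<xi> t)\<^sup>2) * \<sigma> * \<xi> t - D * (8 - 12 * Q)) \<le> 0"
      using E[of t] by (intro mult_nonneg_nonpos) auto
    also have "E t / (\<xi> t)\<^sup>2 * ((K - \<Lambda>) * (\<xi> t)\<^sup>2 * Q\<^sup>2 + 4 * Q * (x\<^sup>2 / (\<xi> t)\<^sup>2) * \<sigma> * \<xi> t - D * (8 - 12 * Q))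
      = \<phi>t t x - D * \<phi>xx t x + K * \<phi> t x"
      unfolding \<phi>t_def \<phi>xx_def \<phi>_def Q_def[symmetric] using \<xi>
      by (simp add: field_simps power2_eq_square)
    finally show ?thesis by simp
  qed
  have "w T x - \<phi> T x \<ge> 0"
  proof (rule parabolic_minimum_principle[OF D c\<xi> parabolic_on_diff[OF parabolic \<phi>], of "- K"])
    fix x assume x: "0 \<le> x" "x \<le> \<xi> t1"
    have "x\<^sup>2 \<le> p\<^sup>2" using x by (intro power_mono) (auto simp: \<xi>_def)
    hence "0 \<le> S t1 x" "S t1 x \<le> 1" using p by (auto simp: S_def \<xi>_def)
    hence "\<phi> t1 x \<le> m" using m by (simp add: \<phi>_def E_def power_le_one mult_left_le)
    also have "m \<le> w t1 x" using y(2)[of x] x by (simp add: m_def \<xi>_def)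
    finally show "0 \<le> w t1 x - \<phi> t1 x" by simp
  next
    fix t assume t: "t1 < t" "t \<le> T"
    have "S t (\<xi> t) = 0" using \<xi>p(2)[of t] t by (simp add: S_def)
    thus "0 \<le> w t (\<xi> t) - \<phi> t (\<xi> t)" using nonneg[of t "\<xi> t"] \<xi>p(2)[of t] t t1 by (simp add: \<phi>_def)
    have "(\<phi> t has_real_derivative 0) (at 0 within {0..\<xi> t})"
      unfolding \<phi>_def S_def using \<xi>p(2)[of t] t by (auto intro!: derivative_eq_intros)
    moreover have "(w t has_real_derivative 0) (at 0 within {0..\<xi> t})"
      using neumann_within[of t "\<xi> t"] below[of t] \<xi>p(2)[of t] t t1 by (auto simp: \<xi>_def)
    ultimately show "0 \<le> w t 0 - \<phi> t 0 \<or>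
      (\<exists>m\<le>0. ((\<lambda>x. w t x - \<phi> t x) has_real_derivative m) (at 0 within {0..\<xi> t}))"
      by (intro disjI2 exI[of _ 0]) (auto intro!: derivative_eq_intros)
  next
    fix t x assume tx: "t1 < t" "t \<le> T" "0 < x" "x < \<xi> t"
    have "- K * w t x \<le> r t x * w t x"
      using K[of t x] tx nonneg[of t x] t1 by (intro mult_right_mono) auto
    moreover have "wt t x - D * wxx t x = w t x * r t x"
      using tx t1 below[of t] by (intro pde) (auto simp: \<xi>_def)
    ultimately show "- K * (w t x - \<phi> t x) \<le> (wt t x - \<phi>t t x) - D * (wxx t x - \<phi>xx t x)"
      using sub[OF tx] by (simp add: algebra_simps)
  qed (use t1 x below in \<open>auto simp: \<xi>_def\<close>)
  moreover have "S T x > 0"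
  proof -
    have "x\<^sup>2 < (\<xi> T)\<^sup>2" using x by (intro power_strict_mono) (auto simp: \<xi>_def)
    thus ?thesis using \<xi>p(2)[of T] t1 by (simp add: S_def)
  qed
  ultimately show ?thesis using E[of T] unfolding \<phi>_def by (smt (verit) mult_pos_pos zero_less_power)
qed

lemma eventually_positive:
  assumes s_inf: "filterlim s at_top at_top" and R: "R > 0"
  obtains t1 \<alpha> where "t1 > \<tau>" "t1 > 0" "\<alpha> > 0" "\<And>t. t \<ge> t1 \<Longrightarrow> R \<le> s t" "\<And>x. 0 \<le> x \<Longrightarrow> x \<le> R \<Longrightarrow> \<alpha> \<le> w t1 x"
proof -
  obtain T where T: "\<And>t. t \<ge> T \<Longrightarrow> s t \<ge> R + 1"
    using s_inf unfolding filterlim_at_top eventually_at_top_linorder by blast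
  define T0 where "T0 = max (max T 0) \<tau> + 1"
  have T0: "T0 > 0" "T0 \<ge> T" "T0 > \<tau>" by (auto simp: T0_def)
  define p where "p = min (s 0 / 4) R"
  have p: "p > 0" "p \<le> R" "p < s 0 / 2" using s0 R by (auto simp: p_def)
  have 1: "w T0 x > 0" if "0 \<le> x" "x \<le> p" for x
  proof (rule positivity_spreads[of 0 T0 "s 0 / 2" 0])
    fix t :: real assume "0 \<le> t"
    thus "s 0 / 2 + 0 * (t - 0) \<le> s t" using s_ge[of t] s0 by simp
  qed (use that p T0 s0 w_init in auto)
  have 2: "w (T0 + 1) x > 0" if "0 \<le> x" "x \<le> R" for x
  proof (rule positivity_spreads[of T0 "T0 + 1" p "R + 1 - p"])
    fix t assume t: "T0 \<le> t" "t \<le> T0 + 1"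
    have "(R + 1 - p) * (t - T0) \<le> (R + 1 - p) * 1" using t p by (intro mult_left_mono) auto
    thus "p + (R + 1 - p) * (t - T0) \<le> s t" using T[of t] t T0 by simp
  qed (use that p T0 1 in auto)
  have "continuous_on {0..R} (w (T0 + 1))"
    by (rule cont_w_slice) (use T0 in auto)
  then obtain y where y: "y \<in> {0..R}" "\<And>x. x \<in> {0..R} \<Longrightarrow> w (T0 + 1) y \<le> w (T0 + 1) x"
    using continuous_attains_inf[of "{0..R}" "w (T0 + 1)"] R by auto
  show ?thesis
  proof (rule that[of "T0 + 1" "w (T0 + 1) y"])
    fix t assume "T0 + 1 \<le> t" thus "R \<le> s t" using T[of t] T0 by auto
  qed (use y 2 T0 in auto)
qed

lemma window_lower:
  assumes t1: "0 \<le> t1" "t1 \<le> T" and X: "0 \<le> X" and R: "R > 0" and \<alpha>: "\<alpha> > 0"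
    and \<kappa>: "\<kappa> = \<theta> - D * (pi / (2 * R))\<^sup>2" "\<kappa> > 0"
    and s: "\<And>t. t1 < t \<Longrightarrow> t \<le> T \<Longrightarrow> X + R \<le> s t"
    and r: "\<And>t x. t1 < t \<Longrightarrow> t \<le> T \<Longrightarrow> 0 < x \<Longrightarrow> \<bar>x - X\<bar> < R \<Longrightarrow> \<theta> - w t x \<le> r t x"
    and init: "\<And>x. 0 \<le> x \<Longrightarrow> \<bar>x - X\<bar> \<le> R \<Longrightarrow> \<alpha> \<le> w t1 x"
  shows "\<kappa> / (1 + \<kappa> / \<alpha> * exp (- \<kappa> * (T - t1))) \<le> w T X"
proof -
  define l where "l = max 0 (X - R)"
  have l: "0 \<le> l" "l \<le> X" "X - R \<le> l" using X R by (auto simp: l_def)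
  define \<omega> where "\<omega> = pi / (2 * R)"
  have \<omega>: "\<omega> > 0" "\<omega> * R = pi / 2" using R by (auto simp: \<omega>_def)
  define B where "B t = 1 + \<kappa> / \<alpha> * exp (- \<kappa> * (t - t1))" for t
  have B: "B t > 0" for t using \<kappa> \<alpha> by (simp add: B_def add_pos_pos)
  define A where "A t = \<kappa> / B t" for t
  have A: "A t > 0" for t using B \<kappa> by (simp add: A_def)
  have dA: "(A has_real_derivative A t * (\<kappa> - A t)) (at t)" for t
  proof -
    have "(B has_real_derivative - \<kappa> * (B t - 1)) (at t)"
      unfolding B_def using \<alpha> by (auto intro!: derivative_eq_intros)
    hence "(A has_real_derivative - (\<kappa> * (- \<kappa> * (B t - 1))) / (B t * B t)) (at t)"
      unfolding A_def using B[of t] by (auto intro!: derivative_eq_intros)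
    moreover have "- (\<kappa> * (- \<kappa> * (B t - 1))) / (B t * B t) = A t * (\<kappa> - A t)"
      unfolding A_def using B[of t] by (simp add: field_simps)
    ultimately show ?thesis by simp
  qed
  define c where "c x = cos (\<omega> * (x - X))" for x
  have c: "0 \<le> c x" "c x \<le> 1" if "\<bar>x - X\<bar> \<le> R" for x
  proof -
    have "\<bar>\<omega> * (x - X)\<bar> \<le> \<omega> * R" using that \<omega> by (simp add: abs_mult)
    thus "0 \<le> c x" unfolding c_def \<omega>(2) by (intro cos_ge_zero) auto
  qed (simp add: c_def)
  have A1: "A t1 \<le> \<alpha>" using \<kappa> \<alpha> by (simp add: A_def B_def field_simps)
  have "A T * c X \<le> w T X"
  proof (rule logistic_comparison[where ?t0.0 = t1 and T = T and l = l and r = "\<lambda>_. X + R" and \<theta> = \<theta>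
        and \<phi> = "\<lambda>t x. A t * c x" and \<phi>t = "\<lambda>t x. A t * (\<kappa> - A t) * c x"
        and \<phi>x = "\<lambda>t x. - A t * \<omega> * sin (\<omega> * (x - X))" and \<phi>xx = "\<lambda>t x. - A t * \<omega>\<^sup>2 * c x", OF D _ parabolic])
    show "parabolic_on t1 T l (\<lambda>_. X + R) (\<lambda>t x. A t * c x) (\<lambda>t x. A t * (\<kappa> - A t) * c x)
      (\<lambda>t x. - A t * \<omega> * sin (\<omega> * (x - X))) (\<lambda>t x. - A t * \<omega>\<^sup>2 * c x)"
      unfolding parabolic_on_def
    proof (intro conjI allI impI)
      have "continuous_on UNIV A" by (auto intro!: continuous_at_imp_continuous_on DERIV_isCont[OF dA])
      hence "continuous_on (region t1 T l (\<lambda>_. X + R)) (\<lambda>p. A (fst p))"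
        by (rule continuous_on_compose2[where f = fst and g = A]) (auto intro: continuous_intros)
      thus "continuous_on (region t1 T l (\<lambda>_. X + R)) (\<lambda>(t, x). A t * c x)"
        unfolding case_prod_beta c_def by (intro continuous_intros)
      fix t x
      show "((\<lambda>x. A t * c x) has_real_derivative - A t * \<omega> * sin (\<omega> * (x - X))) (at x)"
        unfolding c_def by (auto intro!: derivative_eq_intros)
      show "((\<lambda>x. - A t * \<omega> * sin (\<omega> * (x - X))) has_real_derivative - A t * \<omega>\<^sup>2 * c x) (at x)"
        unfolding c_def by (auto intro!: derivative_eq_intros simp: power2_eq_square)
      show "((\<lambda>t. A t * c x) has_real_derivative A t * (\<kappa> - A t) * c x) (at t)"
        by (auto intro!: derivative_eq_intros dA)
    qed
  next
    fix x assume x: "l \<le> x" "x \<le> X + R"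
    hence "\<bar>x - X\<bar> \<le> R" using l by auto
    hence "A t1 * c x \<le> A t1 * 1" "\<alpha> \<le> w t1 x" using c[of x] A[of t1] x l init by (auto intro!: mult_left_mono)
    thus "A t1 * c x \<le> w t1 x" using A1 by simp
  next
    fix t assume t: "t1 < t" "t \<le> T"
    have "c (X + R) = 0" by (simp add: c_def \<omega>)
    thus "A t * c (X + R) \<le> w t (X + R)" using nonneg[of t "X + R"] t t1 X R by simp
    show "A t * c l \<le> w t l \<or>
          (\<exists>m m'. m \<le> m' \<and> (w t has_real_derivative m) (at l within {l..X + R}) \<and>
             ((\<lambda>x. A t * c x) has_real_derivative m') (at l within {l..X + R}))"
    proof (cases "X - R \<ge> 0")
      case True
      hence "l = X - R" by (simp add: l_def)
      hence "c l = 0" by (simp add: c_def \<omega>)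
      thus ?thesis using nonneg[of t l] t t1 l by simp
    next
      case False
      hence l0: "l = 0" by (simp add: l_def)
      have "\<omega> * X \<le> \<omega> * R" using False \<omega> by (intro mult_left_mono) auto
      hence "\<omega> * X \<le> pi" using \<omega>(2) pi_gt_zero by linarith
      hence "sin (\<omega> * X) \<ge> 0" using \<omega> X by (intro sin_ge_zero) auto
      hence m: "0 \<le> A t * \<omega> * sin (\<omega> * X)" using A[of t] \<omega> by simp
      have "((\<lambda>x. A t * c x) has_real_derivative A t * \<omega> * sin (\<omega> * X)) (at 0 within {0..X + R})"
        unfolding c_def by (auto intro!: derivative_eq_intros)
      moreover have "(w t has_real_derivative 0) (at 0 within {0..X + R})"
        using t t1 X R s[of t] by (intro neumann_within) auto
      ultimately show ?thesis unfolding l0 using m by blast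
    qed
  next
    fix t x assume tx: "t1 < t" "t \<le> T" "l < x" "x < X + R"
    hence x: "x > 0" "\<bar>x - X\<bar> < R" using l by auto
    have "w t x * (\<theta> - w t x) \<le> w t x * r t x"
      using r[of t x] tx x nonneg[of t x] t1 by (intro mult_left_mono) auto
    also have "\<dots> = wt t x - D * wxx t x" using pde[of t x] s[of t] tx x t1 by simp
    finally show "w t x * (\<theta> - w t x) \<le> wt t x - D * wxx t x" .
    have Ac: "A t * c x * (\<theta> - A t) \<le> A t * c x * (\<theta> - A t * c x)"
      using c[of x] x A[of t] by (intro mult_left_mono) (auto simp: mult_left_le)
    have "A t * (\<kappa> - A t) * c x - D * (- A t * \<omega>\<^sup>2 * c x) = A t * c x * (\<theta> - A t)"
      unfolding \<kappa>(1) \<omega>_def by (simp add: algebra_simps)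
    thus "A t * (\<kappa> - A t) * c x - D * (- A t * \<omega>\<^sup>2 * c x) \<le> A t * c x * (\<theta> - A t * c x)" using Ac by simp
  qed (use t1 l s R in auto)
  thus ?thesis by (simp add: c_def A_def B_def)
qed

lemma window_upper:
  assumes t1: "0 \<le> t1" "t1 \<le> T" and X: "0 \<le> X" and R: "R > 0" and M: "M \<ge> 0" and \<Theta>: "\<Theta> > 0"
    and \<eta>: "\<eta> > 0" "2 * D * M / R\<^sup>2 \<le> \<Theta> * \<eta>"
    and s: "\<And>t. t1 < t \<Longrightarrow> t \<le> T \<Longrightarrow> X + R \<le> s t"
    and r: "\<And>t x. t1 < t \<Longrightarrow> t \<le> T \<Longrightarrow> 0 < x \<Longrightarrow> \<bar>x - X\<bar> < R \<Longrightarrow> r t x \<le> \<Theta> - w t x"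
    and bound: "\<And>t x. t1 \<le> t \<Longrightarrow> t \<le> T \<Longrightarrow> 0 \<le> x \<Longrightarrow> \<bar>x - X\<bar> \<le> R \<Longrightarrow> w t x \<le> M"
  shows "w T X \<le> \<Theta> + \<eta> + M * exp (- \<Theta> * (T - t1))"
proof -
  define l where "l = max 0 (X - R)"
  have l: "0 \<le> l" "l \<le> X" "X - R \<le> l" using X R by (auto simp: l_def)
  define E where "E t = M * exp (- \<Theta> * (t - t1))" for t
  have E: "E t \<ge> 0" for t using M by (simp add: E_def)
  have dE: "(E has_real_derivative - \<Theta> * E t) (at t)" for t
    unfolding E_def by (auto intro!: derivative_eq_intros)
  define G where "G x = M * (x - X)\<^sup>2 / R\<^sup>2" for x
  have G: "G x \<ge> 0" for x using M by (simp add: G_def)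
  have dG: "(G has_real_derivative 2 * M * (x - X) / R\<^sup>2) (at x within S)" for x S
    unfolding G_def using R by (auto intro!: derivative_eq_intros simp: field_simps power2_eq_square)
  have GR: "G (X + R) = M" "G (X - R) = M" using R by (auto simp: G_def)
  define \<phi> where "\<phi> t x = \<Theta> + \<eta> + E t + G x" for t x
  have "w T X \<le> \<phi> T X"
  proof (rule logistic_comparison[where ?t0.0 = t1 and T = T and l = l and r = "\<lambda>_. X + R" and \<theta> = \<Theta>
        and w = \<phi> and wt = "\<lambda>t x. - \<Theta> * E t"
        and wx = "\<lambda>t x. 2 * M * (x - X) / R\<^sup>2" and wxx = "\<lambda>t x. 2 * M / R\<^sup>2", OF D _ _ parabolic])
    show "parabolic_on t1 T l (\<lambda>_. X + R) \<phi> (\<lambda>t x. - \<Theta> * E t) (\<lambda>t x. 2 * M * (x - X) / R\<^sup>2) (\<lambda>t x. 2 * M / R\<^sup>2)"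
      unfolding parabolic_on_def
    proof (intro conjI allI impI)
      show "continuous_on (region t1 T l (\<lambda>_. X + R)) (\<lambda>(t, x). \<phi> t x)"
        unfolding case_prod_beta \<phi>_def E_def G_def using R by (intro continuous_intros) auto
      fix t x
      show "(\<phi> t has_real_derivative 2 * M * (x - X) / R\<^sup>2) (at x)"
        unfolding \<phi>_def by (auto intro!: derivative_eq_intros dG)
      show "((\<lambda>x. 2 * M * (x - X) / R\<^sup>2) has_real_derivative 2 * M / R\<^sup>2) (at x)"
        using R by (auto intro!: derivative_eq_intros simp: power2_eq_square)
      show "((\<lambda>t. \<phi> t x) has_real_derivative - \<Theta> * E t) (at t)"
        unfolding \<phi>_def by (auto intro!: derivative_eq_intros dE)
    qed
  next
    fix x assume x: "l \<le> x" "x \<le> X + R"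
    hence "w t1 x \<le> M" using l t1 by (intro bound) auto
    thus "w t1 x \<le> \<phi> t1 x" using G[of x] \<Theta> \<eta> by (simp add: \<phi>_def E_def)
  next
    fix t assume t: "t1 < t" "t \<le> T"
    have "w t (X + R) \<le> M" using t t1 X R by (intro bound) auto
    thus "w t (X + R) \<le> \<phi> t (X + R)" using E[of t] \<Theta> \<eta> by (simp add: \<phi>_def GR)
    show "w t l \<le> \<phi> t l \<or>
          (\<exists>m m'. m \<le> m' \<and> (\<phi> t has_real_derivative m) (at l within {l..X + R}) \<and>
             (w t has_real_derivative m') (at l within {l..X + R}))"
    proof (cases "X - R \<ge> 0")
      case True
      hence lX: "l = X - R" by (simp add: l_def)
      have "w t l \<le> M" using t t1 X R l lX by (intro bound) auto
      thus ?thesis using E[of t] \<Theta> \<eta> by (simp add: \<phi>_def lX GR)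
    next
      case False
      hence l0: "l = 0" by (simp add: l_def)
      have "(\<phi> t has_real_derivative 2 * M * (0 - X) / R\<^sup>2) (at 0 within {0..X + R})"
        unfolding \<phi>_def by (auto intro!: derivative_eq_intros dG)
      moreover have "2 * M * (0 - X) / R\<^sup>2 \<le> 0" using M X by (simp add: divide_nonpos_nonneg)
      moreover have "(w t has_real_derivative 0) (at 0 within {0..X + R})"
        using t t1 X R s[of t] by (intro neumann_within) auto
      ultimately show ?thesis unfolding l0 by blast
    qed
  next
    fix t x assume tx: "t1 < t" "t \<le> T" "l < x" "x < X + R"
    hence x: "x > 0" "\<bar>x - X\<bar> < R" using l by auto
    have "wt t x - D * wxx t x = w t x * r t x" using pde[of t x] s[of t] tx x t1 by simp
    also have "\<dots> \<le> w t x * (\<Theta> - w t x)"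
      using r[of t x] tx x nonneg[of t x] t1 by (intro mult_left_mono) auto
    finally show "wt t x - D * wxx t x \<le> w t x * (\<Theta> - w t x)" .
    have "\<Theta> * (\<eta> + E t) \<le> \<phi> t x * (\<phi> t x - \<Theta>)"
      using E[of t] G[of x] \<Theta> \<eta> by (intro mult_mono) (auto simp: \<phi>_def)
    thus "\<phi> t x * (\<Theta> - \<phi> t x) \<le> - \<Theta> * E t - D * (2 * M / R\<^sup>2)"
      using \<eta>(2) by (simp add: algebra_simps)
  qed (use t1 l s R in auto)
  thus ?thesis by (simp add: \<phi>_def E_def G_def)
qed

lemma global_upper:
  assumes t1: "0 \<le> t1" and \<Theta>: "\<Theta> > 0"
    and r: "\<And>t x. t1 < t \<Longrightarrow> 0 < x \<Longrightarrow> x < s t \<Longrightarrow> r t x \<le> \<Theta> - w t x"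
  shows "\<exists>M. \<forall>t\<ge>t1. \<forall>x\<ge>0. w t x \<le> \<Theta> + M * exp (- \<Theta> * (t - t1))"
proof -
  have s1: "s t > 0" if "t \<ge> 0" for t using s_ge[OF that] s0 by linarith
  obtain y where y: "y \<in> {0..s t1}" "\<And>x. x \<in> {0..s t1} \<Longrightarrow> w t1 x \<le> w t1 y"
    using continuous_attains_sup[of "{0..s t1}" "w t1"] cont_w_slice[OF t1, of "s t1"] s1[OF t1] by auto
  define M where "M = w t1 y"
  have M: "M \<ge> 0" using nonneg t1 y by (simp add: M_def)
  define E where "E t = M * exp (- \<Theta> * (t - t1))" for t
  have E: "E t \<ge> 0" for t using M by (simp add: E_def)
  define \<phi> :: "real \<Rightarrow> real \<Rightarrow> real" where "\<phi> t x = \<Theta> + E t" for t x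
  have "w T X \<le> \<phi> T X" if T: "t1 \<le> T" and X: "0 \<le> X" "X \<le> s T" for T X
  proof (rule logistic_comparison[where ?t0.0 = t1 and T = T and l = 0 and r = s and \<theta> = \<Theta>
        and w = \<phi> and wt = "\<lambda>t x. - \<Theta> * E t"
        and wx = "\<lambda>t x. 0" and wxx = "\<lambda>t x. 0", OF D _ _ parabolic])
    show "parabolic_on t1 T 0 s \<phi> (\<lambda>t x. - \<Theta> * E t) (\<lambda>t x. 0) (\<lambda>t x. 0)"
      unfolding parabolic_on_def
    proof (intro conjI allI impI)
      show "continuous_on (region t1 T 0 s) (\<lambda>(t, x). \<phi> t x)"
        unfolding \<phi>_def E_def case_prod_beta by (intro continuous_intros)
      fix t x
      show "((\<lambda>t. \<phi> t x) has_real_derivative - \<Theta> * E t) (at t)"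
        unfolding \<phi>_def E_def by (auto intro!: derivative_eq_intros)
      show "(\<phi> t has_real_derivative 0) (at x)" unfolding \<phi>_def by simp
    qed simp
  next
    fix x assume x: "0 \<le> x" "x \<le> s t1"
    thus "w t1 x \<le> \<phi> t1 x" using y(2)[of x] \<Theta> by (simp add: \<phi>_def E_def M_def)
  next
    fix t assume t: "t1 < t" "t \<le> T"
    show "w t (s t) \<le> \<phi> t (s t)"
      using w_zero[of t "s t"] s1[of t] t t1 E[of t] \<Theta> by (simp add: \<phi>_def)
    show "w t 0 \<le> \<phi> t 0 \<or>
          (\<exists>m m'. m \<le> m' \<and> (\<phi> t has_real_derivative m) (at 0 within {0..s t}) \<and>
             (w t has_real_derivative m') (at 0 within {0..s t}))"
      using neumann_within[of t "s t"] s1[of t] t t1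
      unfolding \<phi>_def by (intro disjI2 exI[of _ 0]) auto
  next
    fix t x assume tx: "t1 < t" "t \<le> T" "0 < x" "x < s t"
    have "wt t x - D * wxx t x = w t x * r t x" using pde[of t x] tx t1 by simp
    also have "\<dots> \<le> w t x * (\<Theta> - w t x)"
      using r[of t x] tx nonneg[of t x] t1 by (intro mult_left_mono) auto
    finally show "wt t x - D * wxx t x \<le> w t x * (\<Theta> - w t x)" .
    have "\<Theta> * E t \<le> (\<Theta> + E t) * E t" using E[of t] by (intro mult_right_mono) auto
    thus "\<phi> t x * (\<Theta> - \<phi> t x) \<le> - \<Theta> * E t - D * 0" by (simp add: \<phi>_def)
  qed (use T X t1 cont_s_on in auto)
  hence "w t x \<le> \<Theta> + M * exp (- \<Theta> * (t - t1))" if "t \<ge> t1" "x \<ge> 0" for t x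
    using that w_zero[of t x] t1 E[of t] \<Theta> by (cases "x \<le> s t") (auto simp: \<phi>_def E_def)
  thus ?thesis by blast
qed

lemma improve_lower:
  assumes k: "0 < k2" "k2 < k1" and \<alpha>: "\<alpha> > 0" and \<theta>: "\<theta> > 0" and \<epsilon>: "\<epsilon> > 0"
    and ev: "\<forall>\<^sub>F t in at_top. k1 * t \<le> s t \<and>
      (\<forall>x. 0 \<le> x \<longrightarrow> x \<le> k1 * t \<longrightarrow> \<alpha> \<le> w t x \<and> \<theta> - w t x \<le> r t x)"
  shows "\<forall>\<^sub>F t in at_top. \<forall>x. 0 \<le> x \<longrightarrow> x \<le> k2 * t \<longrightarrow> \<theta> - \<epsilon> \<le> w t x"
proof -
  obtain t0 where t0: "\<And>t. t \<ge> t0 \<Longrightarrow> k1 * t \<le> s t"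
    "\<And>t x. t \<ge> t0 \<Longrightarrow> 0 \<le> x \<Longrightarrow> x \<le> k1 * t \<Longrightarrow> \<alpha> \<le> w t x \<and> \<theta> - w t x \<le> r t x"
    using ev unfolding eventually_at_top_linorder by blast
  define e where "e = min \<epsilon> \<theta>"
  have e: "e > 0" "e \<le> \<epsilon>" "e \<le> \<theta>" using \<epsilon> \<theta> by (auto simp: e_def)
  define R where "R = pi / 2 * sqrt (2 * D / e)"
  have R: "R > 0" using D e by (simp add: R_def)
  have "pi / (2 * R) = 1 / sqrt (2 * D / e)" using pi_gt_zero by (simp add: R_def)
  hence "D * (pi / (2 * R))\<^sup>2 = D * (1 / (2 * D / e))" using D e by (simp add: power_divide)
  hence DR: "D * (pi / (2 * R))\<^sup>2 = e / 2" using D by simp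
  define \<kappa> where "\<kappa> = \<theta> - D * (pi / (2 * R))\<^sup>2"
  have \<kappa>: "\<kappa> > 0" "\<kappa> = \<theta> - e / 2" using e unfolding \<kappa>_def DR by auto
  obtain \<tau> where \<tau>: "\<tau> \<ge> 0" "\<And>t. t \<ge> \<tau> \<Longrightarrow> \<theta> - \<epsilon> \<le> \<kappa> / (1 + \<kappa> / \<alpha> * exp (- \<kappa> * t))"
    using logistic_eventually[OF \<kappa>(1), of "\<theta> - \<epsilon>" "\<kappa> / \<alpha>"] \<kappa>(2) e by auto
  have "\<theta> - \<epsilon> \<le> w T X" if T: "T \<ge> max (max t0 0 + \<tau>) ((R + k1 * \<tau>) / (k1 - k2))" and X: "0 \<le> X" "X \<le> k2 * T" for T X
  proof -
    have T1: "T - \<tau> \<ge> t0" "T - \<tau> \<ge> 0" using T by auto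
    have "(R + k1 * \<tau>) / (k1 - k2) \<le> T" using T by simp
    hence "R + k1 * \<tau> \<le> T * (k1 - k2)" using k by (simp add: pos_divide_le_eq)
    hence XR: "X + R \<le> k1 * (T - \<tau>)" using X(2) by (simp add: algebra_simps)
    have XRt: "X + R \<le> k1 * t" if "t \<ge> T - \<tau>" for t
      using XR that k by (smt (verit) mult_left_mono)
    have "\<kappa> / (1 + \<kappa> / \<alpha> * exp (- \<kappa> * (T - (T - \<tau>)))) \<le> w T X"
    proof (rule window_lower[OF T1(2) _ X(1) R \<alpha> \<kappa>_def \<kappa>(1)])
      fix t assume "T - \<tau> < t"
      thus "X + R \<le> s t" using XRt[of t] t0(1)[of t] T1 by linarith
    next
      fix t x assume "T - \<tau> < t" "0 < x" "\<bar>x - X\<bar> < R"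
      thus "\<theta> - w t x \<le> r t x" using XRt[of t] t0(2)[of t x] T1 by simp
    next
      fix x assume "0 \<le> x" "\<bar>x - X\<bar> \<le> R"
      thus "\<alpha> \<le> w (T - \<tau>) x" using XRt[of "T - \<tau>"] t0(2)[of "T - \<tau>" x] T1 by simp
    qed (use \<tau> in auto)
    thus ?thesis using \<tau>(2)[of "T - (T - \<tau>)"] by simp
  qed
  thus ?thesis unfolding eventually_at_top_linorder by blast
qed

lemma improve_upper:
  assumes k: "0 < k2" "k2 < k1" and M: "M \<ge> 0" and \<Theta>: "\<Theta> > 0" and \<epsilon>: "\<epsilon> > 0"
    and ev: "\<forall>\<^sub>F t in at_top. k1 * t \<le> s t \<and>
      (\<forall>x. 0 \<le> x \<longrightarrow> x \<le> k1 * t \<longrightarrow> w t x \<le> M \<and> r t x \<le> \<Theta> - w t x)"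
  shows "\<forall>\<^sub>F t in at_top. \<forall>x. 0 \<le> x \<longrightarrow> x \<le> k2 * t \<longrightarrow> w t x \<le> \<Theta> + \<epsilon>"
proof -
  obtain t0 where t0: "\<And>t. t \<ge> t0 \<Longrightarrow> k1 * t \<le> s t"
    "\<And>t x. t \<ge> t0 \<Longrightarrow> 0 \<le> x \<Longrightarrow> x \<le> k1 * t \<Longrightarrow> w t x \<le> M \<and> r t x \<le> \<Theta> - w t x"
    using ev unfolding eventually_at_top_linorder by blast
  define \<eta> where "\<eta> = \<epsilon> / 2"
  have \<eta>: "\<eta> > 0" using \<epsilon> by (simp add: \<eta>_def)
  define R where "R = sqrt (2 * D * M / (\<Theta> * \<eta>)) + 1"
  have Q: "0 \<le> 2 * D * M / (\<Theta> * \<eta>)" using D M \<Theta> \<eta> by simp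
  have R: "R > 0" using Q by (simp add: R_def add_nonneg_pos)
  have "2 * D * M / (\<Theta> * \<eta>) = (sqrt (2 * D * M / (\<Theta> * \<eta>)))\<^sup>2" using Q by simp
  also have "\<dots> \<le> R\<^sup>2" using Q by (intro power_mono) (auto simp: R_def)
  finally have DR: "2 * D * M / R\<^sup>2 \<le> \<Theta> * \<eta>" using R \<Theta> \<eta> by (simp add: field_simps)
  obtain \<tau> where \<tau>: "\<tau> \<ge> 0" "\<And>t. t \<ge> \<tau> \<Longrightarrow> M * exp (- \<Theta> * t) \<le> \<eta>"
    using exp_decay_eventually[OF \<Theta> \<eta>, of M] by auto
  have "w T X \<le> \<Theta> + \<epsilon>" if T: "T \<ge> max (max t0 0 + \<tau>) ((R + k1 * \<tau>) / (k1 - k2))" and X: "0 \<le> X" "X \<le> k2 * T" for T X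
  proof -
    have T1: "T - \<tau> \<ge> t0" "T - \<tau> \<ge> 0" using T by auto
    have "(R + k1 * \<tau>) / (k1 - k2) \<le> T" using T by simp
    hence "R + k1 * \<tau> \<le> T * (k1 - k2)" using k by (simp add: pos_divide_le_eq)
    hence XR: "X + R \<le> k1 * (T - \<tau>)" using X(2) by (simp add: algebra_simps)
    have XRt: "X + R \<le> k1 * t" if "t \<ge> T - \<tau>" for t
      using XR that k by (smt (verit) mult_left_mono)
    have "w T X \<le> \<Theta> + \<eta> + M * exp (- \<Theta> * (T - (T - \<tau>)))"
    proof (rule window_upper[OF T1(2) _ X(1) R M \<Theta> \<eta> DR])
      fix t assume "T - \<tau> < t"
      thus "X + R \<le> s t" using XRt[of t] t0(1)[of t] T1 by linarith
    next
      fix t x assume "T - \<tau> < t" "0 < x" "\<bar>x - X\<bar> < R"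
      thus "r t x \<le> \<Theta> - w t x" using XRt[of t] t0(2)[of t x] T1 by simp
    next
      fix t x assume "T - \<tau> \<le> t" "0 \<le> x" "\<bar>x - X\<bar> \<le> R"
      thus "w t x \<le> M" using XRt[of t] t0(2)[of t x] T1 by simp
    qed (use \<tau> in auto)
    thus ?thesis using \<tau>(2)[of "T - (T - \<tau>)"] by (simp add: \<eta>_def)
  qed
  thus ?thesis unfolding eventually_at_top_linorder by blast
qed

text \<open>Comparison with \<open>(1 - \<epsilon>) q (\<xi> t - x)\<close>, \<open>\<xi> t = 1 + (1 - 2 \<epsilon>) k (t - t0)\<close>. The semi-wave of speed \<open>k\<close> slowed down
  in this way still is a subsolution after \<open>\<theta>\<close> has been lowered to \<open>\<theta> - \<delta>\<close>.\<close>
lemma semi_wave_barrier: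
  assumes sw: "semi_wave \<nu> D \<theta> k q q' q''" and k: "k > 0" and \<theta>: "\<theta> > 0" and \<epsilon>: "0 < \<epsilon>" "\<epsilon> \<le> 1/4"
    and t0: "t0 > 0" "1 < s t0"
    and \<delta>: "\<And>x. x > 0 \<Longrightarrow> \<delta> * q x \<le> \<epsilon> * (q x)\<^sup>2 + 2 * \<epsilon> * k * q' x"
    and r: "\<And>t x. t > t0 \<Longrightarrow> 0 < x \<Longrightarrow> x < s t \<Longrightarrow> \<theta> - \<delta> - w t x \<le> r t x"
    and core: "\<And>t x. t \<ge> t0 \<Longrightarrow> 0 \<le> x \<Longrightarrow> x \<le> 1 \<Longrightarrow> (1 - \<epsilon>) * \<theta> \<le> w t x"
    and \<xi>: "\<And>t. \<xi> t = 1 + (1 - 2 * \<epsilon>) * k * (t - t0)"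
    and t: "t \<ge> t0"
  shows "\<xi> t < s t" "\<And>x. 0 \<le> x \<Longrightarrow> x \<le> \<xi> t \<Longrightarrow> (1 - \<epsilon>) * q (\<xi> t - x) \<le> w t x"
proof -
  define c where "c = (1 - 2 * \<epsilon>) * k"
  have c: "c > 0" using k \<epsilon> by (simp add: c_def)
  have d\<xi>: "(\<xi> has_real_derivative c) (at t)" for t
  proof -
    have "\<xi> = (\<lambda>t. 1 + c * (t - t0))" by (auto simp: \<xi> c_def)
    thus ?thesis by (auto intro!: derivative_eq_intros)
  qed
  have cont\<xi>: "continuous_on S \<xi>" for S
    by (auto intro!: continuous_at_imp_continuous_on DERIV_isCont[OF d\<xi>])
  have \<xi>1: "\<xi> t \<ge> 1" if "t \<ge> t0" for t using that c by (simp add: \<xi> c_def[symmetric])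
  note q = sw_nonneg[OF sw nu D \<theta> k] sw_less[OF sw nu D \<theta> k]
  have q0: "q 0 = 0" "q' 0 = k / \<nu>" and contq: "continuous_on {0..} q" using sw by (auto simp: semi_wave_def)
  define \<phi> where "\<phi> t x = (1 - \<epsilon>) * q (\<xi> t - x)" for t x
  have \<phi>le: "\<phi> t x \<le> (1 - \<epsilon>) * \<theta>" if "x \<le> \<xi> t" for t x
    unfolding \<phi>_def using q(2)[of "\<xi> t - x"] that \<epsilon> by (intro mult_left_mono) auto
  have comp: "\<phi> T x \<le> w T x" if T: "t0 \<le> T" and below: "\<And>t. t0 \<le> t \<Longrightarrow> t \<le> T \<Longrightarrow> \<xi> t \<le> s t"
    and x: "0 \<le> x" "x \<le> \<xi> T" for T x
  proof (rule logistic_comparison[where ?t0.0 = t0 and T = T and l = 0 and r = \<xi> and \<theta> = "\<theta> - \<delta>" and \<phi> = \<phi>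
        and \<phi>t = "\<lambda>t x. (1 - \<epsilon>) * (q' (\<xi> t - x) * c)" and \<phi>x = "\<lambda>t x. - ((1 - \<epsilon>) * q' (\<xi> t - x))"
        and \<phi>xx = "\<lambda>t x. (1 - \<epsilon>) * q'' (\<xi> t - x)", OF D cont\<xi> parabolic])
    show "parabolic_on t0 T 0 \<xi> \<phi> (\<lambda>t x. (1 - \<epsilon>) * (q' (\<xi> t - x) * c)) (\<lambda>t x. - ((1 - \<epsilon>) * q' (\<xi> t - x)))
      (\<lambda>t x. (1 - \<epsilon>) * q'' (\<xi> t - x))"
      unfolding parabolic_on_def
    proof (intro conjI allI impI)
      have "continuous_on (region t0 T 0 \<xi>) (\<lambda>p. \<xi> (fst p))"
        by (rule continuous_on_compose2[OF cont\<xi>[of UNIV], where f = fst]) (auto intro: continuous_intros)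
      hence "continuous_on (region t0 T 0 \<xi>) (\<lambda>p. \<xi> (fst p) - snd p)" by (intro continuous_intros)
      hence "continuous_on (region t0 T 0 \<xi>) (\<lambda>p. q (\<xi> (fst p) - snd p))"
        by (rule continuous_on_compose2[OF contq, where f = "\<lambda>p. \<xi> (fst p) - snd p"]) (auto simp: region_def)
      thus "continuous_on (region t0 T 0 \<xi>) (\<lambda>(t, x). \<phi> t x)"
        unfolding \<phi>_def case_prod_beta by (intro continuous_intros)
      fix t x assume "0 < x" "x < \<xi> t"
      hence y: "\<xi> t - x > 0" by simp
      have dq: "((\<lambda>z. q (G z)) has_real_derivative q' (\<xi> t - x) * E) (at z)"
        if "(G has_real_derivative E) (at z)" "G z = \<xi> t - x" for G z E
        by (rule DERIV_chain2[where f = q and g = G]) (use sw_dq[OF sw nu D \<theta> k y] that in auto)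
      have dq': "((\<lambda>z. q' (G z)) has_real_derivative q'' (\<xi> t - x) * E) (at z)"
        if "(G has_real_derivative E) (at z)" "G z = \<xi> t - x" for G z E
        by (rule DERIV_chain2[where f = q' and g = G]) (use sw_dq'[OF sw nu D \<theta> k y] that in auto)
      have 1: "((\<lambda>x. \<xi> t - x) has_real_derivative - 1) (at x)" by (auto intro!: derivative_eq_intros)
      have 2: "((\<lambda>t. \<xi> t - x) has_real_derivative c) (at t)" by (auto intro!: derivative_eq_intros d\<xi>)
      show "(\<phi> t has_real_derivative - ((1 - \<epsilon>) * q' (\<xi> t - x))) (at x)"
        unfolding \<phi>_def using DERIV_cmult[OF dq[OF 1 refl], of "1 - \<epsilon>"] by simp
      show "((\<lambda>x. - ((1 - \<epsilon>) * q' (\<xi> t - x))) has_real_derivative (1 - \<epsilon>) * q'' (\<xi> t - x)) (at x)"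
        using DERIV_minus[OF DERIV_cmult[OF dq'[OF 1 refl], of "1 - \<epsilon>"]] by simp
      show "((\<lambda>t. \<phi> t x) has_real_derivative (1 - \<epsilon>) * (q' (\<xi> t - x) * c)) (at t)"
        unfolding \<phi>_def by (rule DERIV_cmult[OF dq[OF 2 refl]])
    qed
  next
    fix x assume "0 \<le> x" "x \<le> \<xi> t0"
    thus "\<phi> t0 x \<le> w t0 x" using \<phi>le[of x t0] core[of t0 x] by (simp add: \<xi>)
  next
    fix t assume t: "t0 < t" "t \<le> T"
    show "\<phi> t (\<xi> t) \<le> w t (\<xi> t)" using nonneg[of t "\<xi> t"] \<xi>1[of t] t t0 by (simp add: \<phi>_def q0)
    have "\<phi> t 0 \<le> w t 0" using \<phi>le[of 0 t] core[of t 0] t \<xi>1[of t] by simp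
    thus "\<phi> t 0 \<le> w t 0 \<or> (\<exists>m m'. m \<le> m' \<and> (w t has_real_derivative m) (at 0 within {0..\<xi> t}) \<and>
          (\<phi> t has_real_derivative m') (at 0 within {0..\<xi> t}))" by blast
  next
    fix t x assume tx: "t0 < t" "t \<le> T" "0 < x" "x < \<xi> t"
    have xs: "x < s t" using below[of t] tx by simp
    have "w t x * (\<theta> - \<delta> - w t x) \<le> w t x * r t x"
      using r[of t x] tx xs nonneg[of t x] t0 by (intro mult_left_mono) auto
    thus "w t x * (\<theta> - \<delta> - w t x) \<le> wt t x - D * wxx t x" using pde[of t x] tx xs t0 by simp
    define y where "y = \<xi> t - x"
    have y: "y > 0" using tx by (simp add: y_def)
    have ode: "D * q'' y = k * q' y - q y * (\<theta> - q y)" by (rule sw_ode[OF sw nu D \<theta> k y])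
    have "c * q' y - D * q'' y \<le> q y * (\<theta> - \<delta> - (1 - \<epsilon>) * q y)"
      using \<delta>[OF y] unfolding ode c_def by (simp add: algebra_simps power2_eq_square)
    hence "(1 - \<epsilon>) * (c * q' y - D * q'' y) \<le> (1 - \<epsilon>) * (q y * (\<theta> - \<delta> - (1 - \<epsilon>) * q y))"
      using \<epsilon> by (intro mult_left_mono) auto
    thus "(1 - \<epsilon>) * (q' (\<xi> t - x) * c) - D * ((1 - \<epsilon>) * q'' (\<xi> t - x)) \<le> \<phi> t x * (\<theta> - \<delta> - \<phi> t x)"
      unfolding \<phi>_def y_def[symmetric] by (simp add: algebra_simps)
  qed (use T x t0 below in auto)
  have front: "\<xi> t < s t" if t: "t \<ge> t0" for t
  proof (rule ccontr)
    assume "\<not> \<xi> t < s t"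
    hence neg: "s t - \<xi> t \<le> 0" by simp
    have cm: "continuous_on {t0..t} (\<lambda>t. s t - \<xi> t)"
      using t0 by (intro continuous_intros cont_s_on cont\<xi>) auto
    have m0: "s t0 - \<xi> t0 > 0" using t0 by (simp add: \<xi>)
    obtain T where T: "t0 < T" "T \<le> t" "s T - \<xi> T = 0" "\<And>y. t0 \<le> y \<Longrightarrow> y < T \<Longrightarrow> s y - \<xi> y > 0"
      by (rule first_zero[OF cm t m0 neg], rule that)
    have below: "\<xi> t \<le> s t" if "t0 \<le> t" "t \<le> T" for t
      using T(3) T(4)[of t] that by (cases "t = T") auto
    have sT: "s T = \<xi> T" "s T \<ge> 1" "T > 0" using T \<xi>1[of T] t0 by auto
    define g where "g x = w T x - \<phi> T x" for x
    have g0: "g x \<ge> 0" if "0 \<le> x" "x \<le> s T" for x using comp[of T x] below T that sT by (simp add: g_def)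
    have gs: "g (s T) = 0" using w_zero[of T "s T"] sT by (simp add: g_def \<phi>_def q0)
    have "(q has_real_derivative k / \<nu>) (at 0 within {0..})"
      using sw_dq0[OF sw nu D \<theta> k, of 0] q0 by simp
    moreover have "(\<lambda>x. s T - x) ` {0..s T} \<subseteq> {0..}" by auto
    ultimately have "(q has_real_derivative k / \<nu>) (at 0 within (\<lambda>x. s T - x) ` {0..s T})"
      by (rule DERIV_subset)
    hence 1: "(q has_real_derivative k / \<nu>) (at ((\<lambda>x. s T - x) (s T)) within (\<lambda>x. s T - x) ` {0..s T})"
      by simp
    have 2: "((\<lambda>x. s T - x) has_real_derivative - 1) (at (s T) within {0..s T})"
      by (auto intro!: derivative_eq_intros)
    have 3: "((\<lambda>x. (1 - \<epsilon>) * q (s T - x)) has_real_derivative (1 - \<epsilon>) * (k / \<nu> * - 1)) (at (s T) within {0..s T})"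
      by (rule DERIV_cmult[OF DERIV_image_chain[OF 1 2, unfolded o_def]])
    have 4: "(w T has_real_derivative wx T (s T)) (at (s T) within {0..s T})"
      by (rule dx_within) (use sT(2,3) in auto)
    have dg: "(g has_real_derivative wx T (s T) - (1 - \<epsilon>) * (k / \<nu> * - 1)) (at (s T) within {0..s T})"
      unfolding g_def \<phi>_def sT(1)[symmetric] by (rule DERIV_diff[OF 4 3])
    have wx: "wx T (s T) + (1 - \<epsilon>) * k / \<nu> \<le> 0"
    proof (rule ccontr)
      assume "\<not> wx T (s T) + (1 - \<epsilon>) * k / \<nu> \<le> 0"
      hence "wx T (s T) - (1 - \<epsilon>) * (k / \<nu> * - 1) > 0" by simp
      from has_real_derivative_pos_inc_left[OF dg this] obtain d where d: "d > 0"
        "\<And>h. h > 0 \<Longrightarrow> s T - h \<in> {0..s T} \<Longrightarrow> h < d \<Longrightarrow> g (s T - h) < g (s T)" by auto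
      define h where "h = min (d / 2) 1"
      have "g (s T - h) < g (s T)" using d sT by (intro d(2)) (auto simp: h_def)
      moreover have "g (s T - h) \<ge> 0" using sT d by (intro g0) (auto simp: h_def)
      ultimately show False using gs by simp
    qed
    have "((\<lambda>t. s t - \<xi> t) has_real_derivative - \<nu> * wx T (s T) - c) (at T)"
      using sT by (intro derivative_intros stefan d\<xi>)
    moreover have "- \<nu> * wx T (s T) - c > 0"
    proof -
      have "\<nu> * (wx T (s T) + (1 - \<epsilon>) * k / \<nu>) \<le> 0" using wx nu by (intro mult_nonneg_nonpos) auto
      hence "\<nu> * wx T (s T) + (1 - \<epsilon>) * k \<le> 0" using nu by (simp add: distrib_left)
      moreover have "c < (1 - \<epsilon>) * k" using \<epsilon> k by (simp add: c_def)
      ultimately show ?thesis by linarith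
    qed
    ultimately obtain d where d: "d > 0" "\<And>h. h > 0 \<Longrightarrow> h < d \<Longrightarrow> s (T - h) - \<xi> (T - h) < s T - \<xi> T"
      using DERIV_pos_inc_left by blast
    define h where "h = min (d / 2) (T - t0)"
    have h: "h > 0" "h < d" "t0 \<le> T - h" using d T by (auto simp: h_def)
    show False using d(2)[OF h(1,2)] T(3) T(4)[of "T - h"] h by simp
  qed
  show "\<xi> t < s t" by (rule front[OF t])
  show "(1 - \<epsilon>) * q (\<xi> t - x) \<le> w t x" if "0 \<le> x" "x \<le> \<xi> t" for x
    using comp[OF t _ that] front less_imp_le unfolding \<phi>_def by blast
qed

lemma spreading:
  assumes s_inf: "filterlim s at_top at_top" and sw: "semi_wave \<nu> D \<theta> k q q' q''" and k: "k > 0" and \<theta>: "\<theta> > 0"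
    and r: "\<And>\<delta>. \<delta> > 0 \<Longrightarrow> \<forall>\<^sub>F t in at_top. \<forall>x. 0 < x \<longrightarrow> x < s t \<longrightarrow> \<theta> - \<delta> - w t x \<le> r t x"
    and k1: "k1 < k" and \<eta>: "\<eta> > 0"
  shows "\<forall>\<^sub>F t in at_top. k1 * t \<le> s t \<and> (\<forall>x. 0 \<le> x \<longrightarrow> x \<le> k1 * t \<longrightarrow> \<theta> - \<eta> \<le> w t x)"
proof -
  note q = sw_nonneg[OF sw nu D \<theta> k] sw_less[OF sw nu D \<theta> k]
  define \<epsilon> where "\<epsilon> = min (1/4) (min ((k - k1) / (4 * k)) (\<eta> / (2 * \<theta>)))"
  have \<epsilon>: "0 < \<epsilon>" "\<epsilon> \<le> 1/4" "\<epsilon> \<le> (k - k1) / (4 * k)" "\<epsilon> \<le> \<eta> / (2 * \<theta>)"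
    using k k1 \<eta> \<theta> by (auto simp: \<epsilon>_def)
  have \<epsilon>k: "4 * \<epsilon> * k \<le> k - k1" using \<epsilon>(3) k by (simp add: field_simps)
  have \<epsilon>\<theta>: "\<epsilon> * \<theta> \<le> \<eta> / 2" using \<epsilon>(4) \<theta> by (simp add: field_simps)
  define c where "c = (1 - 2 * \<epsilon>) * k"
  have ck: "c > k1" using \<epsilon>k k1 by (simp add: c_def algebra_simps)
  have "k / (2 * \<nu>) < k / \<nu>" using k nu by (simp add: field_simps)
  from order_tendstoD(1)[OF sw_q'_tendsto_0[OF sw nu D \<theta> k] this]
  obtain x0 where x0: "x0 > 0" "\<And>x. 0 < x \<Longrightarrow> x < x0 \<Longrightarrow> q' x > k / (2 * \<nu>)"
    unfolding eventually_at_right_field by auto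
  have qx0: "q x0 > 0" using sw_strict_mono[OF sw nu D \<theta> k, of 0 x0] x0 sw by (auto simp: semi_wave_def)
  define \<delta> where "\<delta> = min (\<epsilon> * q x0) (min (\<epsilon> * k\<^sup>2 / (\<nu> * \<theta>)) (\<epsilon> * \<theta> / 3))"
  have \<delta>: "\<delta> > 0" "\<delta> \<le> \<epsilon> * q x0" "\<delta> \<le> \<epsilon> * k\<^sup>2 / (\<nu> * \<theta>)" "\<delta> \<le> \<epsilon> * \<theta> / 3"
    using \<epsilon>(1) qx0 k nu \<theta> unfolding \<delta>_def by (simp, meson min.cobounded1 min.cobounded2 order_trans)+
  have sub: "\<delta> * q x \<le> \<epsilon> * (q x)\<^sup>2 + 2 * \<epsilon> * k * q' x" if x: "x > 0" for x
  proof (cases "x < x0")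
    case True
    have "\<delta> * q x \<le> \<delta> * \<theta>" using q(2)[of x] x \<delta> by (intro mult_left_mono) auto
    also have "\<dots> \<le> \<epsilon> * k\<^sup>2 / \<nu>" using mult_right_mono[OF \<delta>(3), of \<theta>] \<theta> nu by simp
    also have "\<dots> = 2 * \<epsilon> * k * (k / (2 * \<nu>))" by (simp add: power2_eq_square)
    also have "\<dots> \<le> 2 * \<epsilon> * k * q' x" using x0(2)[OF x True] \<epsilon> k by (intro mult_left_mono) auto
    also have "\<dots> \<le> \<epsilon> * (q x)\<^sup>2 + 2 * \<epsilon> * k * q' x" using \<epsilon> by simp
    finally show ?thesis .
  next
    case False
    have "q x0 \<le> q x" using False sw_strict_mono[OF sw nu D \<theta> k, of x0 x] x0 by (cases "x = x0") auto
    hence "\<delta> \<le> \<epsilon> * q x" using \<delta>(2) \<epsilon> by (meson less_imp_le mult_left_mono order_trans)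
    hence "\<delta> * q x \<le> \<epsilon> * q x * q x" using q(1)[of x] x by (intro mult_right_mono) auto
    moreover have "2 * \<epsilon> * k * q' x \<ge> 0" using sw_q'_pos[OF sw nu D \<theta> k, of x] x \<epsilon> k by simp
    ultimately show ?thesis by (simp add: power2_eq_square)
  qed
  obtain tr where tr: "\<And>t x. t \<ge> tr \<Longrightarrow> 0 < x \<Longrightarrow> x < s t \<Longrightarrow> \<theta> - \<delta> - w t x \<le> r t x"
    using r[OF \<delta>(1)] unfolding eventually_at_top_linorder by blast
  define R where "R = pi / 2 * sqrt (3 * D / (\<epsilon> * \<theta>))"
  have R: "R > 0" using D \<epsilon> \<theta> by (simp add: R_def)
  have "pi / (2 * R) = 1 / sqrt (3 * D / (\<epsilon> * \<theta>))" using pi_gt_zero by (simp add: R_def)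
  hence "D * (pi / (2 * R))\<^sup>2 = D * (1 / (3 * D / (\<epsilon> * \<theta>)))" using D \<epsilon> \<theta> by (simp add: power_divide)
  hence DR: "D * (pi / (2 * R))\<^sup>2 = \<epsilon> * \<theta> / 3" using D by simp
  define \<kappa> where "\<kappa> = (\<theta> - \<delta>) - D * (pi / (2 * R))\<^sup>2"
  have et: "0 < \<epsilon> * \<theta>" "\<epsilon> * \<theta> \<le> 1/4 * \<theta>" using \<epsilon> \<theta> by (auto intro!: mult_right_mono)
  have \<kappa>1: "(1 - \<epsilon>) * \<theta> < \<kappa>" using \<delta>(4) et unfolding \<kappa>_def DR by (simp add: algebra_simps)
  hence \<kappa>: "\<kappa> > 0" using et by (simp add: algebra_simps)
  have R1: "R + 1 > 0" using R by simp
  obtain t1 \<alpha> where t1: "t1 > tr" "t1 > 0" "\<alpha> > 0" "\<And>t. t \<ge> t1 \<Longrightarrow> R + 1 \<le> s t"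
    "\<And>x. 0 \<le> x \<Longrightarrow> x \<le> R + 1 \<Longrightarrow> \<alpha> \<le> w t1 x"
    by (rule eventually_positive[OF s_inf R1, of tr], rule that)
  obtain \<tau> where \<tau>: "\<tau> \<ge> 0" "\<And>t. t \<ge> \<tau> \<Longrightarrow> (1 - \<epsilon>) * \<theta> \<le> \<kappa> / (1 + \<kappa> / \<alpha> * exp (- \<kappa> * t))"
    using logistic_eventually[OF \<kappa> \<kappa>1, of "\<kappa> / \<alpha>"] by auto
  have core: "(1 - \<epsilon>) * \<theta> \<le> w t x" if t: "t \<ge> t1 + \<tau>" and x: "0 \<le> x" "x \<le> 1" for t x
  proof -
    have "\<kappa> / (1 + \<kappa> / \<alpha> * exp (- \<kappa> * (t - t1))) \<le> w t x"
    proof (rule window_lower[OF _ _ x(1) R t1(3) \<kappa>_def \<kappa>])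
      fix t' assume "t1 < t'" thus "x + R \<le> s t'" using t1(4)[of t'] x by simp
    next
      fix t' y assume "t1 < t'" "0 < y" "\<bar>y - x\<bar> < R"
      thus "\<theta> - \<delta> - w t' y \<le> r t' y" using tr[of t' y] t1(1) t1(4)[of t'] x by simp
    next
      fix y assume "0 \<le> y" "\<bar>y - x\<bar> \<le> R"
      thus "\<alpha> \<le> w t1 y" using x by (intro t1(5)) auto
    qed (use t1 t \<tau> in auto)
    thus ?thesis using \<tau>(2)[of "t - t1"] t by simp
  qed
  define t0 where "t0 = t1 + \<tau>"
  define \<xi> where "\<xi> t = 1 + (1 - 2 * \<epsilon>) * k * (t - t0)" for t
  have t0: "t0 > 0" "1 < s t0" using t1(2) t1(4)[of t0] R \<tau> by (auto simp: t0_def)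
  have rb: "\<theta> - \<delta> - w t x \<le> r t x" if "t > t0" "0 < x" "x < s t" for t x
    using tr[of t x] that t1 \<tau> by (simp add: t0_def)
  have barrier: "\<xi> t < s t" "\<And>x. 0 \<le> x \<Longrightarrow> x \<le> \<xi> t \<Longrightarrow> (1 - \<epsilon>) * q (\<xi> t - x) \<le> w t x" if "t \<ge> t0" for t
    by (rule semi_wave_barrier[OF sw k \<theta> \<epsilon>(1,2) t0 sub rb _ \<xi>_def that]; use core[folded t0_def] in blast)+
  have "\<forall>\<^sub>F x in at_top. q x > \<theta> - \<eta> / 2"
    by (rule order_tendstoD(1)[of q \<theta>]) (use sw \<eta> in \<open>auto simp: semi_wave_def\<close>)
  then obtain x1 where x1: "\<And>x. x \<ge> x1 \<Longrightarrow> q x > \<theta> - \<eta> / 2" unfolding eventually_at_top_linorder by auto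
  have "k1 * t \<le> s t \<and> (\<forall>x. 0 \<le> x \<longrightarrow> x \<le> k1 * t \<longrightarrow> \<theta> - \<eta> \<le> w t x)"
    if t: "t \<ge> max t0 ((max x1 0 + c * t0) / (c - k1))" for t
  proof -
    have t': "t \<ge> t0" using t by simp
    have "(max x1 0 + c * t0) / (c - k1) \<le> t" using t by simp
    hence "max x1 0 + c * t0 \<le> t * (c - k1)" using ck by (simp add: pos_divide_le_eq)
    hence far: "max x1 0 \<le> \<xi> t - k1 * t" unfolding \<xi>_def c_def[symmetric] by (simp add: algebra_simps)
    have "\<theta> - \<eta> \<le> w t x" if x: "0 \<le> x" "x \<le> k1 * t" for x
    proof -
      have y: "\<xi> t - x \<ge> x1" "\<xi> t - x \<ge> 0" using far x by auto
      have "\<epsilon> * q (\<xi> t - x) \<le> \<epsilon> * \<theta>" using q(2)[OF y(2)] \<epsilon> by (intro mult_left_mono) auto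
      hence "\<theta> - \<eta> \<le> (1 - \<epsilon>) * q (\<xi> t - x)" using x1[OF y(1)] \<epsilon>\<theta> by (simp add: algebra_simps)
      also have "\<dots> \<le> w t x" using barrier(2)[OF t' x(1)] y by simp
      finally show ?thesis .
    qed
    thus ?thesis using barrier(1)[OF t'] far by auto
  qed
  thus ?thesis unfolding eventually_at_top_linorder by blast
qed

end

section \<open>The coupled system\<close>

lemma SUP_abs_tendsto_0:
  fixes f :: "real \<Rightarrow> real \<Rightarrow> real"
  assumes k: "k > 0"
    and lower: "\<And>\<epsilon>. \<epsilon> > 0 \<Longrightarrow> \<forall>\<^sub>F t in at_top. \<forall>x. 0 \<le> x \<longrightarrow> x \<le> k * t \<longrightarrow> l - \<epsilon> \<le> f t x"
    and upper: "\<And>\<epsilon>. \<epsilon> > 0 \<Longrightarrow> \<forall>\<^sub>F t in at_top. \<forall>x. 0 \<le> x \<longrightarrow> x \<le> k * t \<longrightarrow> f t x \<le> l + \<epsilon>"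
  shows "((\<lambda>t. SUP x\<in>{0..k * t}. \<bar>f t x - l\<bar>) \<longlongrightarrow> 0) at_top"
proof (rule tendstoI)
  fix e :: real assume "e > 0"
  hence e: "e / 2 > 0" by simp
  show "\<forall>\<^sub>F t in at_top. dist (SUP x\<in>{0..k * t}. \<bar>f t x - l\<bar>) 0 < e"
    using lower[OF e] upper[OF e] eventually_ge_at_top[of 0]
  proof eventually_elim
    case (elim t)
    have b: "\<bar>f t x - l\<bar> \<le> e / 2" if "x \<in> {0..k * t}" for x
    proof -
      have "l - e / 2 \<le> f t x" "f t x \<le> l + e / 2" using elim that by auto
      thus ?thesis by linarith
    qed
    have 0: "0 \<in> {0..k * t}" using k elim by simp
    have "(SUP x\<in>{0..k * t}. \<bar>f t x - l\<bar>) \<le> e / 2" by (rule cSUP_least) (use 0 b in auto)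
    moreover have "bdd_above ((\<lambda>x. \<bar>f t x - l\<bar>) ` {0..k * t})"
      by (rule bdd_aboveI2[of _ _ "e / 2"]) (use b in auto)
    hence "0 \<le> (SUP x\<in>{0..k * t}. \<bar>f t x - l\<bar>)" by (rule cSUP_upper2[OF _ 0]) auto
    ultimately show ?case using \<open>e > 0\<close> by (simp add: dist_real_def)
  qed
qed

theorem theorem4p4:
  fixes a b c d \<beta> \<mu> g0 h0 k0 :: real
    and u0 v0 u0' v0' g h :: "real \<Rightarrow> real"
    and u v :: "real \<Rightarrow> real \<Rightarrow> real"
  assumes params: "a > 0" "b > 0" "c > 0" "d > 0" "\<beta> > 0" "\<mu> > 0"
    and h0g0: "0 < h0" "h0 \<le> g0"
    and u0_C2: "C2_on 0 g0 u0 u0'" and u0'_0: "u0' 0 = 0"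
    and u0_pos: "\<forall>x\<in>{0..<g0}. u0 x > 0" and u0_zero: "\<forall>x\<ge>g0. u0 x = 0"
    and v0_C2: "C2_on 0 h0 v0 v0'" and v0'_0: "v0' 0 = 0"
    and v0_pos: "\<forall>x\<in>{0..<h0}. v0 x > 0" and v0_zero: "\<forall>x\<ge>h0. v0 x = 0"
    and sol: "fbp_solution a b c d \<beta> \<mu> g0 h0 u0 v0 u v g h"
    and g_inf: "filterlim g at_top at_top"
    and h_inf: "filterlim h at_top at_top"
    and hb: "b < min a (1 / c)" and hab: "a > b * (1 + a * c)"
    and k0: "0 < k0"
      "k0 < min (semi_wave_speed \<beta> d (a - b * (1 + a * c))) (semi_wave_speed \<mu> 1 1)"
  shows "((\<lambda>t. SUP x\<in>{0..k0 * t}. \<bar>u t x - (a - b) / (1 + b * c)\<bar>) \<longlongrightarrow> 0) at_top \<and>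
         ((\<lambda>t. SUP x\<in>{0..k0 * t}. \<bar>v t x - (1 + a * c) / (1 + b * c)\<bar>) \<longlongrightarrow> 0) at_top"
proof -
  have S: "continuous_on ({0..} \<times> {0..}) (\<lambda>(t, x). u t x)" "continuous_on ({0..} \<times> {0..}) (\<lambda>(t, x). v t x)"
    "continuous_on {0..} g" "continuous_on {0..} h" "g 0 = g0" "h 0 = h0"
    "\<forall>x\<ge>0. u 0 x = u0 x \<and> v 0 x = v0 x" "\<forall>t>0. \<forall>x\<ge>g t. u t x = 0" "\<forall>t>0. \<forall>x\<ge>h t. v t x = 0"
    using sol by (simp_all add: fbp_solution_def)
  obtain ut ux uxx where U:
    "\<forall>t>0. \<forall>x\<in>{0..g t}. ((\<lambda>y. u t y) has_real_derivative ux t x) (at x within {0..g t})"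
    "\<forall>t>0. \<forall>x\<in>{0<..<g t}. ((\<lambda>y. ux t y) has_real_derivative uxx t x) (at x)"
    "\<forall>t>0. \<forall>x\<in>{0<..<g t}. ((\<lambda>s. u s x) has_real_derivative ut t x) (at t)"
    "\<forall>t>0. \<forall>x\<in>{0<..<g t}. ut t x - d * uxx t x = u t x * (a - u t x - b * v t x)"
    "\<forall>t>0. ux t 0 = 0" "\<forall>t>0. (g has_real_derivative (- \<beta> * ux t (g t))) (at t)"
    using sol unfolding fbp_solution_def by (elim conjE exE) (rule that)
  obtain vt vx vxx where V:
    "\<forall>t>0. \<forall>x\<in>{0..h t}. ((\<lambda>y. v t y) has_real_derivative vx t x) (at x within {0..h t})"
    "\<forall>t>0. \<forall>x\<in>{0<..<h t}. ((\<lambda>y. vx t y) has_real_derivative vxx t x) (at x)"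
    "\<forall>t>0. \<forall>x\<in>{0<..<h t}. ((\<lambda>s. v s x) has_real_derivative vt t x) (at t)"
    "\<forall>t>0. \<forall>x\<in>{0<..<h t}. vt t x - vxx t x = v t x * (1 - v t x + c * u t x)"
    "\<forall>t>0. vx t 0 = 0" "\<forall>t>0. (h has_real_derivative (- \<mu> * vx t (h t))) (at t)"
    using sol unfolding fbp_solution_def by (elim conjE exE) (rule that)
  have g0: "g0 > 0" using h0g0 by simp
  interpret U: free_boundary d \<beta> u ut ux uxx "\<lambda>t x. a - u t x - b * v t x" g
  proof
    show "continuous_on ({0..} \<times> {0..}) (\<lambda>(t, x). a - u t x - b * v t x)"
      using S(1,2) unfolding case_prod_beta by (intro continuous_intros)
    fix t x :: real assume "0 \<le> t" "0 \<le> x" "g t \<le> x"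
    thus "u t x = 0" using S u0_zero by (cases "t = 0") auto
  qed (use params S U g0 u0_pos in auto)
  interpret V: free_boundary 1 \<mu> v vt vx vxx "\<lambda>t x. 1 - v t x + c * u t x" h
  proof
    show "continuous_on ({0..} \<times> {0..}) (\<lambda>(t, x). 1 - v t x + c * u t x)"
      using S(1,2) unfolding case_prod_beta by (intro continuous_intros)
    fix t x :: real assume "0 \<le> t" "0 \<le> x" "h t \<le> x"
    thus "v t x = 0" using S v0_zero by (cases "t = 0") auto
  qed (use params S V h0g0 v0_pos in auto)

  define \<theta> where "\<theta> = a - b * (1 + a * c)"
  have \<theta>: "\<theta> > 0" using hab by (simp add: \<theta>_def)
  define K where "K = min (semi_wave_speed \<beta> d \<theta>) (semi_wave_speed \<mu> 1 1)"
  have k0K: "k0 < K" using k0 by (simp add: K_def \<theta>_def)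
  obtain q q' q'' where q: "semi_wave \<beta> d \<theta> (semi_wave_speed \<beta> d \<theta>) q q' q''"
    using semi_wave_speed_is_speed(2)[OF params(5,4) \<theta>] by blast
  obtain p p' p'' where p: "semi_wave \<mu> 1 1 (semi_wave_speed \<mu> 1 1) p p' p''"
    using semi_wave_speed_is_speed(2)[OF params(6), of 1 1] by auto

  have u_upper: "\<forall>\<^sub>F t in at_top. \<forall>x\<ge>0. u t x \<le> a + \<epsilon>" if \<epsilon>: "\<epsilon> > 0" for \<epsilon>
  proof -
    have "\<exists>M. \<forall>t\<ge>0. \<forall>x\<ge>0. u t x \<le> a + M * exp (- a * (t - 0))"
    proof (rule U.global_upper[OF order_refl params(1)])
      fix t x :: real assume "0 < t" "0 < x"
      thus "a - u t x - b * v t x \<le> a - u t x" using V.nonneg[of t x] params by simp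
    qed
    then obtain M where M: "\<And>t x. t \<ge> 0 \<Longrightarrow> x \<ge> 0 \<Longrightarrow> u t x \<le> a + M * exp (- a * t)" by auto
    obtain \<tau> where \<tau>: "\<tau> \<ge> 0" "\<And>t. t \<ge> \<tau> \<Longrightarrow> M * exp (- a * t) \<le> \<epsilon>"
      using exp_decay_eventually[OF params(1) \<epsilon>, of M] by auto
    show ?thesis unfolding eventually_at_top_linorder
    proof (intro exI[of _ \<tau>] allI impI)
      fix t x :: real assume "t \<ge> \<tau>" "x \<ge> 0"
      thus "u t x \<le> a + \<epsilon>" using M[of t x] \<tau>(1) \<tau>(2)[of t] by simp
    qed
  qed
  have v_upper: "\<forall>\<^sub>F t in at_top. \<forall>x\<ge>0. v t x \<le> 1 + a * c + \<epsilon>" if \<epsilon>: "\<epsilon> > 0" for \<epsilon>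
  proof -
    have "\<epsilon> / (2 * c) > 0" using \<epsilon> params by simp
    from u_upper[OF this] obtain t1 where "\<And>t x. t \<ge> t1 \<Longrightarrow> x \<ge> 0 \<Longrightarrow> u t x \<le> a + \<epsilon> / (2 * c)"
      unfolding eventually_at_top_linorder by blast
    hence t1: "c * u t x \<le> a * c + \<epsilon> / 2" if "t \<ge> t1" "x \<ge> 0" for t x
      using that params by (force simp: field_simps)
    define \<Theta> where "\<Theta> = 1 + a * c + \<epsilon> / 2"
    have \<Theta>: "\<Theta> > 0" using params \<epsilon> by (simp add: \<Theta>_def add_pos_pos)
    define t2 where "t2 = max t1 0"
    have "\<exists>M. \<forall>t\<ge>t2. \<forall>x\<ge>0. v t x \<le> \<Theta> + M * exp (- \<Theta> * (t - t2))"
    proof (rule V.global_upper[OF _ \<Theta>])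
      fix t x :: real assume "t2 < t" "0 < x"
      thus "1 - v t x + c * u t x \<le> \<Theta> - v t x" using t1[of t x] by (simp add: \<Theta>_def t2_def)
    qed (simp add: t2_def)
    then obtain M where M: "\<And>t x. t \<ge> t2 \<Longrightarrow> x \<ge> 0 \<Longrightarrow> v t x \<le> \<Theta> + M * exp (- \<Theta> * (t - t2))" by auto
    have "\<epsilon> / 2 > 0" using \<epsilon> by simp
    from exp_decay_eventually[OF \<Theta> this, of M]
    obtain \<tau> where \<tau>: "\<tau> \<ge> 0" "\<And>t. t \<ge> \<tau> \<Longrightarrow> M * exp (- \<Theta> * t) \<le> \<epsilon> / 2" by auto
    show ?thesis unfolding eventually_at_top_linorder
    proof (intro exI[of _ "t2 + \<tau>"] allI impI)
      fix t x :: real assume "t \<ge> t2 + \<tau>" "x \<ge> 0"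
      thus "v t x \<le> 1 + a * c + \<epsilon>" using M[of t x] \<tau>(1) \<tau>(2)[of "t - t2"] by (simp add: \<Theta>_def)
    qed
  qed

  have u_spread: "\<forall>\<^sub>F t in at_top. k * t \<le> g t \<and> (\<forall>x. 0 \<le> x \<longrightarrow> x \<le> k * t \<longrightarrow> \<theta> - \<epsilon> \<le> u t x)"
    if "k < K" "\<epsilon> > 0" for k \<epsilon>
  proof (rule U.spreading[OF g_inf q _ \<theta>])
    fix \<delta> :: real assume "\<delta> > 0"
    hence "\<delta> / b > 0" using params by simp
    from v_upper[OF this] eventually_gt_at_top[of 0]
    show "\<forall>\<^sub>F t in at_top. \<forall>x. 0 < x \<longrightarrow> x < g t \<longrightarrow> \<theta> - \<delta> - u t x \<le> a - u t x - b * v t x"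
    proof eventually_elim
      case (elim t)
      show ?case
      proof (intro allI impI)
        fix x :: real assume "0 < x"
        hence "v t x \<le> 1 + a * c + \<delta> / b" using elim by simp
        hence "b * v t x \<le> b * (1 + a * c + \<delta> / b)" using params by (intro mult_left_mono) auto
        also have "\<dots> = b * (1 + a * c) + \<delta>" using params by (simp add: field_simps)
        finally show "\<theta> - \<delta> - u t x \<le> a - u t x - b * v t x" by (simp add: \<theta>_def)
      qed
    qed
  qed (use that semi_wave_speed_is_speed(1)[OF params(5,4) \<theta>] in \<open>auto simp: K_def\<close>)
  have v_spread: "\<forall>\<^sub>F t in at_top. k * t \<le> h t \<and> (\<forall>x. 0 \<le> x \<longrightarrow> x \<le> k * t \<longrightarrow> 1 - \<epsilon> \<le> v t x)"
    if "k < K" "\<epsilon> > 0" for k \<epsilon>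
  proof (rule V.spreading[OF h_inf p])
    fix \<delta> :: real assume "\<delta> > 0"
    show "\<forall>\<^sub>F t in at_top. \<forall>x. 0 < x \<longrightarrow> x < h t \<longrightarrow> 1 - \<delta> - v t x \<le> 1 - v t x + c * u t x"
      using eventually_gt_at_top[of 0]
    proof eventually_elim
      case (elim t)
      have "0 \<le> c * u t x" if "0 < x" for x using U.nonneg[of t x] elim that params by simp
      thus ?case using \<open>\<delta> > 0\<close> by (smt (verit))
    qed
  qed (use that semi_wave_speed_is_speed(1)[OF params(6), of 1 1] in \<open>auto simp: K_def\<close>)

  define LU where "LU \<alpha> \<longleftrightarrow> (\<forall>k \<epsilon>. 0 < k \<longrightarrow> k < K \<longrightarrow> \<epsilon> > 0 \<longrightarrow>
    (\<forall>\<^sub>F t in at_top. \<forall>x. 0 \<le> x \<longrightarrow> x \<le> k * t \<longrightarrow> \<alpha> - \<epsilon> \<le> u t x))" for \<alpha>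
  define UU where "UU \<alpha> \<longleftrightarrow> (\<forall>k \<epsilon>. 0 < k \<longrightarrow> k < K \<longrightarrow> \<epsilon> > 0 \<longrightarrow>
    (\<forall>\<^sub>F t in at_top. \<forall>x. 0 \<le> x \<longrightarrow> x \<le> k * t \<longrightarrow> u t x \<le> \<alpha> + \<epsilon>))" for \<alpha>
  define LV where "LV \<alpha> \<longleftrightarrow> (\<forall>k \<epsilon>. 0 < k \<longrightarrow> k < K \<longrightarrow> \<epsilon> > 0 \<longrightarrow>
    (\<forall>\<^sub>F t in at_top. \<forall>x. 0 \<le> x \<longrightarrow> x \<le> k * t \<longrightarrow> \<alpha> - \<epsilon> \<le> v t x))" for \<alpha>
  define UV where "UV \<alpha> \<longleftrightarrow> (\<forall>k \<epsilon>. 0 < k \<longrightarrow> k < K \<longrightarrow> \<epsilon> > 0 \<longrightarrow>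
    (\<forall>\<^sub>F t in at_top. \<forall>x. 0 \<le> x \<longrightarrow> x \<le> k * t \<longrightarrow> v t x \<le> \<alpha> + \<epsilon>))" for \<alpha>

  have LU_LV: "LV (1 + c * \<alpha>)" if LU: "LU \<alpha>" and \<alpha>: "\<alpha> \<ge> 0" for \<alpha>
    unfolding LV_def
  proof (intro allI impI)
    fix k \<epsilon> :: real assume k: "0 < k" "k < K" and \<epsilon>: "\<epsilon> > 0"
    define k1 where "k1 = (k + K) / 2"
    have k1: "k < k1" "k1 < K" "0 < k1" using k by (auto simp: k1_def)
    define e where "e = min \<epsilon> 1 / 2"
    have e: "e > 0" "e \<le> \<epsilon> / 2" "e \<le> 1 / 2" using \<epsilon> by (auto simp: e_def)
    have ec: "e / c > 0" using e params by simp
    have ca: "c * \<alpha> \<ge> 0" using \<alpha> params by simp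
    have "\<forall>\<^sub>F t in at_top. \<forall>x. 0 \<le> x \<longrightarrow> x \<le> k * t \<longrightarrow> (1 + c * \<alpha> - e) - \<epsilon> / 2 \<le> v t x"
    proof (rule V.improve_lower[OF k(1) k1(1), of "1/2"])
      have "\<forall>\<^sub>F t in at_top. \<forall>x. 0 \<le> x \<longrightarrow> x \<le> k1 * t \<longrightarrow> \<alpha> - e / c \<le> u t x"
        using LU k1 ec unfolding LU_def by blast
      moreover have "\<forall>\<^sub>F t in at_top. k1 * t \<le> h t \<and> (\<forall>x. 0 \<le> x \<longrightarrow> x \<le> k1 * t \<longrightarrow> 1 - 1/2 \<le> v t x)"
        using v_spread[OF k1(2), of "1/2"] by simp
      ultimately show "\<forall>\<^sub>F t in at_top. k1 * t \<le> h t \<and> (\<forall>x. 0 \<le> x \<longrightarrow> x \<le> k1 * t \<longrightarrow>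
          1/2 \<le> v t x \<and> 1 + c * \<alpha> - e - v t x \<le> 1 - v t x + c * u t x)"
      proof eventually_elim
        case (elim t)
        have "c * \<alpha> - e \<le> c * u t x" if "0 \<le> x" "x \<le> k1 * t" for x
        proof -
          have "c * (\<alpha> - e / c) \<le> c * u t x" using elim that params by (intro mult_left_mono) auto
          thus ?thesis using params by (simp add: right_diff_distrib)
        qed
        thus ?case using elim by auto
      qed
    qed (use e ca \<epsilon> in auto)
    thus "\<forall>\<^sub>F t in at_top. \<forall>x. 0 \<le> x \<longrightarrow> x \<le> k * t \<longrightarrow> 1 + c * \<alpha> - \<epsilon> \<le> v t x"
      by eventually_elim (use e in force)
  qed
  have LV_UU: "UU (a - b * \<alpha>)" if LV: "LV \<alpha>" and \<alpha>: "a - b * \<alpha> > 0" for \<alpha>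
    unfolding UU_def
  proof (intro allI impI)
    fix k \<epsilon> :: real assume k: "0 < k" "k < K" and \<epsilon>: "\<epsilon> > 0"
    define k1 where "k1 = (k + K) / 2"
    have k1: "k < k1" "k1 < K" "0 < k1" using k by (auto simp: k1_def)
    have eb: "\<epsilon> / 2 / b > 0" using \<epsilon> params by simp
    have "\<forall>\<^sub>F t in at_top. \<forall>x. 0 \<le> x \<longrightarrow> x \<le> k * t \<longrightarrow> u t x \<le> (a - b * \<alpha> + \<epsilon> / 2) + \<epsilon> / 2"
    proof (rule U.improve_upper[OF k(1) k1(1), of "a + 1"])
      have "\<forall>\<^sub>F t in at_top. \<forall>x. 0 \<le> x \<longrightarrow> x \<le> k1 * t \<longrightarrow> \<alpha> - \<epsilon> / 2 / b \<le> v t x"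
        using LV k1 eb unfolding LV_def by blast
      moreover have "\<forall>\<^sub>F t in at_top. k1 * t \<le> g t" using u_spread[OF k1(2), of 1] by (auto elim: eventually_mono)
      moreover have "\<forall>\<^sub>F t in at_top. \<forall>x\<ge>0. u t x \<le> a + 1" by (rule u_upper) simp
      ultimately show "\<forall>\<^sub>F t in at_top. k1 * t \<le> g t \<and> (\<forall>x. 0 \<le> x \<longrightarrow> x \<le> k1 * t \<longrightarrow>
          u t x \<le> a + 1 \<and> a - u t x - b * v t x \<le> a - b * \<alpha> + \<epsilon> / 2 - u t x)"
      proof eventually_elim
        case (elim t)
        have "b * \<alpha> - \<epsilon> / 2 \<le> b * v t x" if "0 \<le> x" "x \<le> k1 * t" for x
        proof -
          have "b * (\<alpha> - \<epsilon> / 2 / b) \<le> b * v t x" using elim that params by (intro mult_left_mono) auto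
          thus ?thesis using params by (simp add: right_diff_distrib)
        qed
        thus ?case using elim by fastforce
      qed
    qed (use \<alpha> \<epsilon> params in auto)
    thus "\<forall>\<^sub>F t in at_top. \<forall>x. 0 \<le> x \<longrightarrow> x \<le> k * t \<longrightarrow> u t x \<le> a - b * \<alpha> + \<epsilon>"
      by eventually_elim force
  qed
  have UU_UV: "UV (1 + c * \<alpha>)" if UU: "UU \<alpha>" and \<alpha>: "\<alpha> \<ge> 0" for \<alpha>
    unfolding UV_def
  proof (intro allI impI)
    fix k \<epsilon> :: real assume k: "0 < k" "k < K" and \<epsilon>: "\<epsilon> > 0"
    define k1 where "k1 = (k + K) / 2"
    have k1: "k < k1" "k1 < K" "0 < k1" using k by (auto simp: k1_def)
    have ec: "\<epsilon> / 2 / c > 0" using \<epsilon> params by simp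
    have ca: "c * \<alpha> \<ge> 0" using \<alpha> params by simp
    have "\<forall>\<^sub>F t in at_top. \<forall>x. 0 \<le> x \<longrightarrow> x \<le> k * t \<longrightarrow> v t x \<le> (1 + c * \<alpha> + \<epsilon> / 2) + \<epsilon> / 2"
    proof (rule V.improve_upper[OF k(1) k1(1), of "1 + a * c + 1"])
      have "\<forall>\<^sub>F t in at_top. \<forall>x. 0 \<le> x \<longrightarrow> x \<le> k1 * t \<longrightarrow> u t x \<le> \<alpha> + \<epsilon> / 2 / c"
        using UU k1 ec unfolding UU_def by blast
      moreover have "\<forall>\<^sub>F t in at_top. k1 * t \<le> h t" using v_spread[OF k1(2), of 1] by (auto elim: eventually_mono)
      moreover have "\<forall>\<^sub>F t in at_top. \<forall>x\<ge>0. v t x \<le> 1 + a * c + 1" by (rule v_upper) simp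
      ultimately show "\<forall>\<^sub>F t in at_top. k1 * t \<le> h t \<and> (\<forall>x. 0 \<le> x \<longrightarrow> x \<le> k1 * t \<longrightarrow>
          v t x \<le> 1 + a * c + 1 \<and> 1 - v t x + c * u t x \<le> 1 + c * \<alpha> + \<epsilon> / 2 - v t x)"
      proof eventually_elim
        case (elim t)
        have "c * u t x \<le> c * \<alpha> + \<epsilon> / 2" if "0 \<le> x" "x \<le> k1 * t" for x
        proof -
          have "c * u t x \<le> c * (\<alpha> + \<epsilon> / 2 / c)" using elim that params by (intro mult_left_mono) auto
          thus ?thesis using params by (simp add: distrib_left)
        qed
        thus ?case using elim by fastforce
      qed
    qed (use ca \<epsilon> params in auto)
    thus "\<forall>\<^sub>F t in at_top. \<forall>x. 0 \<le> x \<longrightarrow> x \<le> k * t \<longrightarrow> v t x \<le> 1 + c * \<alpha> + \<epsilon>"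
      by eventually_elim force
  qed
  have UV_LU: "LU (a - b * \<alpha>)" if UV: "UV \<alpha>" and \<alpha>: "a - b * \<alpha> > 0" for \<alpha>
    unfolding LU_def
  proof (intro allI impI)
    fix k \<epsilon> :: real assume k: "0 < k" "k < K" and \<epsilon>: "\<epsilon> > 0"
    define k1 where "k1 = (k + K) / 2"
    have k1: "k < k1" "k1 < K" "0 < k1" using k by (auto simp: k1_def)
    define e where "e = min \<epsilon> (a - b * \<alpha>) / 2"
    have e: "e > 0" "e \<le> \<epsilon> / 2" "e < a - b * \<alpha>" using \<epsilon> \<alpha> unfolding e_def min_def by (auto split: if_splits simp: mult.commute)
    have eb: "e / b > 0" using e params by simp
    have "\<forall>\<^sub>F t in at_top. \<forall>x. 0 \<le> x \<longrightarrow> x \<le> k * t \<longrightarrow> (a - b * \<alpha> - e) - \<epsilon> / 2 \<le> u t x"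
    proof (rule U.improve_lower[OF k(1) k1(1), of "\<theta> / 2"])
      have "\<forall>\<^sub>F t in at_top. \<forall>x. 0 \<le> x \<longrightarrow> x \<le> k1 * t \<longrightarrow> v t x \<le> \<alpha> + e / b"
        using UV k1 eb unfolding UV_def by blast
      moreover have "\<forall>\<^sub>F t in at_top. k1 * t \<le> g t \<and> (\<forall>x. 0 \<le> x \<longrightarrow> x \<le> k1 * t \<longrightarrow> \<theta> - \<theta> / 2 \<le> u t x)"
        using u_spread[OF k1(2), of "\<theta> / 2"] \<theta> by simp
      ultimately show "\<forall>\<^sub>F t in at_top. k1 * t \<le> g t \<and> (\<forall>x. 0 \<le> x \<longrightarrow> x \<le> k1 * t \<longrightarrow>
          \<theta> / 2 \<le> u t x \<and> a - b * \<alpha> - e - u t x \<le> a - u t x - b * v t x)"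
      proof eventually_elim
        case (elim t)
        have "b * v t x \<le> b * \<alpha> + e" if "0 \<le> x" "x \<le> k1 * t" for x
        proof -
          have "b * v t x \<le> b * (\<alpha> + e / b)" using elim that params by (intro mult_left_mono) auto
          thus ?thesis using params by (simp add: distrib_left)
        qed
        thus ?case using elim by fastforce
      qed
    qed (use \<theta> e \<epsilon> in auto)
    thus "\<forall>\<^sub>F t in at_top. \<forall>x. 0 \<le> x \<longrightarrow> x \<le> k * t \<longrightarrow> a - b * \<alpha> - \<epsilon> \<le> u t x"
      by eventually_elim (use e in force)
  qed

  define A where "A = (a - b) / (1 + b * c)"
  define B where "B = (1 + a * c) / (1 + b * c)"
  have bc: "0 < b * c" "b * c < 1" using params hb by (auto simp: field_simps)
  have AB: "1 + c * A = B" "a - b * B = A" using bc by (simp_all add: A_def B_def field_simps)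
  have ba: "b < a" using hb by simp
  have A0: "A > 0" using ba bc by (simp add: A_def)
  have "a - A = b * B" using AB by simp
  moreover have "B > 0" using bc params by (simp add: B_def add_pos_pos)
  ultimately have Aa: "A \<le> a" using params by (simp add: algebra_simps)
  have \<theta>A: "\<theta> \<le> A"
  proof -
    have "b * (1 + c * A) \<le> b * (1 + a * c)" using Aa params by (intro mult_left_mono) auto
    thus ?thesis using AB by (simp add: \<theta>_def)
  qed
  define \<alpha> where "\<alpha> n = A - (b * c) ^ (2 * n) * (A - \<theta>)" for n :: nat
  have \<alpha>: "\<theta> \<le> \<alpha> n" "\<alpha> n \<le> A" for n
  proof -
    have "(b * c) ^ (2 * n) * (A - \<theta>) \<le> 1 * (A - \<theta>)"
      using bc \<theta>A by (intro mult_right_mono power_le_one) auto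
    thus "\<theta> \<le> \<alpha> n" by (simp add: \<alpha>_def)
    show "\<alpha> n \<le> A" using bc \<theta>A by (simp add: \<alpha>_def)
  qed
  have step: "LU (a - b * (1 + c * (a - b * (1 + c * \<alpha>))))" if LU: "LU \<alpha>" and \<alpha>: "\<theta> \<le> \<alpha>" "\<alpha> \<le> A" for \<alpha>
  proof -
    have 1: "LV (1 + c * \<alpha>)" by (rule LU_LV[OF LU]) (use \<theta> \<alpha> in simp)
    have "b * (1 + c * \<alpha>) \<le> b * (1 + c * A)" using \<alpha> params by (intro mult_left_mono add_left_mono) auto
    hence 2: "a - b * (1 + c * \<alpha>) > 0" using AB A0 by simp
    have 3: "UV (1 + c * (a - b * (1 + c * \<alpha>)))"
      by (rule UU_UV[OF LV_UU[OF 1 2]]) (use 2 in simp)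
    have "b * (1 + c * \<alpha>) \<ge> 0" using \<alpha> \<theta> params by simp
    hence "b * (1 + c * (a - b * (1 + c * \<alpha>))) \<le> b * (1 + c * a)"
      using params by (intro mult_left_mono add_left_mono) auto
    hence "a - b * (1 + c * (a - b * (1 + c * \<alpha>))) > 0" using \<theta> by (simp add: \<theta>_def mult.commute)
    thus ?thesis by (rule UV_LU[OF 3])
  qed
  have LU_n: "LU (\<alpha> n)" for n
  proof (induction n)
    case 0
    have "LU \<theta>" unfolding LU_def
    proof (intro allI impI)
      fix k \<epsilon> :: real assume "k < K" "\<epsilon> > 0"
      from u_spread[OF this] show "\<forall>\<^sub>F t in at_top. \<forall>x. 0 \<le> x \<longrightarrow> x \<le> k * t \<longrightarrow> \<theta> - \<epsilon> \<le> u t x"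
        by eventually_elim blast
    qed
    thus ?case by (simp add: \<alpha>_def)
  next
    case (Suc n)
    have "A - (a - b * (1 + c * (a - b * (1 + c * \<alpha> n)))) = (b * c)\<^sup>2 * (A - \<alpha> n)"
    proof -
      have A: "A = a - b * (1 + c * (a - b * (1 + c * A)))" using AB by simp
      have "A - (a - b * (1 + c * (a - b * (1 + c * \<alpha> n))))
        = (a - b * (1 + c * (a - b * (1 + c * A)))) - (a - b * (1 + c * (a - b * (1 + c * \<alpha> n))))"
        using A by simp
      also have "\<dots> = (b * c)\<^sup>2 * (A - \<alpha> n)" by (simp add: algebra_simps power2_eq_square)
      finally show ?thesis .
    qed
    moreover have "(b * c)\<^sup>2 * (A - \<alpha> n) = A - \<alpha> (Suc n)" by (simp add: \<alpha>_def power_add power2_eq_square)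
    ultimately have "a - b * (1 + c * (a - b * (1 + c * \<alpha> n))) = \<alpha> (Suc n)" by simp
    thus ?case using step[OF Suc \<alpha>] by simp
  qed
  have LU_A: "LU A"
    unfolding LU_def
  proof (intro allI impI)
    fix k \<epsilon> :: real assume k: "0 < k" "k < K" and \<epsilon>: "\<epsilon> > 0"
    have bc2: "\<bar>(b * c)\<^sup>2\<bar> < 1" using bc by (simp add: power_less_one_iff abs_square_less_1)
    have "(\<lambda>n. ((b * c)\<^sup>2) ^ n * (A - \<theta>)) \<longlonglongrightarrow> 0 * (A - \<theta>)"
      by (intro tendsto_intros LIMSEQ_power_zero) (use bc2 in simp)
    hence "\<forall>\<^sub>F n in sequentially. ((b * c)\<^sup>2) ^ n * (A - \<theta>) < \<epsilon> / 2"
      using \<epsilon> by (intro order_tendstoD) auto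
    then obtain n where "((b * c)\<^sup>2) ^ n * (A - \<theta>) < \<epsilon> / 2"
      unfolding eventually_sequentially by auto
    hence n: "A - \<epsilon> / 2 \<le> \<alpha> n" by (simp add: \<alpha>_def power_mult)
    have "\<forall>\<^sub>F t in at_top. \<forall>x. 0 \<le> x \<longrightarrow> x \<le> k * t \<longrightarrow> \<alpha> n - \<epsilon> / 2 \<le> u t x"
      using LU_n[of n] k \<epsilon> unfolding LU_def by (meson half_gt_zero)
    thus "\<forall>\<^sub>F t in at_top. \<forall>x. 0 \<le> x \<longrightarrow> x \<le> k * t \<longrightarrow> A - \<epsilon> \<le> u t x"
      by eventually_elim (use n in force)
  qed
  have LV_B: "LV B" using LU_LV[OF LU_A] A0 AB by simp
  have UU_A: "UU A" using LV_UU[OF LV_B] A0 AB by simp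
  have UV_B: "UV B" using UU_UV[OF UU_A] A0 AB by simp
  have "((\<lambda>t. SUP x\<in>{0..k0 * t}. \<bar>u t x - A\<bar>) \<longlongrightarrow> 0) at_top"
    by (rule SUP_abs_tendsto_0[OF k0(1)]) (use LU_A UU_A k0 k0K in \<open>auto simp: LU_def UU_def\<close>)
  moreover have "((\<lambda>t. SUP x\<in>{0..k0 * t}. \<bar>v t x - B\<bar>) \<longlongrightarrow> 0) at_top"
    by (rule SUP_abs_tendsto_0[OF k0(1)]) (use LV_B UV_B k0 k0K in \<open>auto simp: LV_def UV_def\<close>)
  ultimately show ?thesis unfolding A_def B_def by simp
qed

end
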